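(* Suppose Assumptions A1, A2, A3 (stated in the context) hold and let $\{(X^{(t)},\Lambda^{(t)},Y^{(t)})\}_{t\ge0}$ be generated by the VRLM algorithm with the STORM option with $\beta\in(0,1)$, $\eta_y=\frac{\sqrt\beta}{4\sqrt2L}$, $$\eta_x=\min\Big\{\frac{\kappa(1-\rho)^2}{40L(24\kappa^2+8\kappa+5)},\ \frac{\sqrt\beta}{48(L+1)(24\kappa^2+7\kappa+4)}\Big\},\qquad \eta_\Lambda=\min\Big\{\frac{(1-\rho)^2}{4L(20\kappa+3)},\ \frac{\sqrt\beta}{4(L+1)(52\kappa^2+\kappa+1)}\Big\}.$$ For any integer $T\ge1$, select $\tau$ uniformly at random from $\{0,\dots,T-1\}$. Put $$E_T=\frac{C_0}T+\Big(\frac1{(1-\rho)^2\kappa L}+\frac{1+1/L}{\sqrt\beta L}\Big)\beta^2\sum_{t=0}^{T-1}\frac{\Upsilon_{t+1}}T,$$ $$C_0=\phi(\bar x^{(0)},\Lambda^{(0)})-\phi^*+\frac1{40m(1-\rho)\kappa L}\mathbb E\|V_{\perp,x}^{(0)}\|_F^2+\Big(\frac{1+1/L}{2\sqrt\beta mL}+\frac1{4m\kappa L(1-\rho)^2}\Big)\mathbb E\|R^{(0)}\|_F^2$$ $$+\Big(\frac{L+1}{5m\kappa}+\frac{\sqrt\beta L}{10m\kappa^2(1-\rho)^2}\Big)\|\widetilde Y^{(0)}-Y^{(0)}\|_F^2+\frac{\sqrt\beta}{\sqrt2}\Big(\frac1{(1-\rho)^2\kappa}+\frac{1+1/L}{\sqrt\beta}\Big)\hat\delta_0.$$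 Then $$\mathbb E\Big\|\tfrac1{\eta_x}\big(\bar x^{(\tau)}-\mathrm{prox}_{\eta_xg}(\bar x^{(\tau)}-\eta_x\nabla_xP(\bar x^{(\tau)},\Lambda^{(\tau)}))\big)\Big\|_2^2+\frac{L^2}m\mathbb E\|X_\perp^{(\tau)}\|_F^2$$ $$\le E_T\cdot\Big[\frac{20}{\eta_x}+6\eta_x\Big(2L^2(3+5\kappa^2)+\frac5{\eta_x^2}\Big)+\frac{1600\kappa^2L}{\sqrt\beta}+\frac{80L}{\sqrt\beta}+\frac{5(1-\rho)^2}{\eta_x}\Big]$$ and $$\mathbb E\|\nabla_\Lambda P(\bar x^{(\tau)},\Lambda^{(\tau)})\|_F^2\le E_T\cdot\Big[\frac4{\eta_\Lambda}+24\kappa^2L^2\eta_x+\frac{640\kappa^2L}{\sqrt\beta}\Big].$$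
   Context: **Setting and notation.** $m,d_1,d_2\ge1$ are integers, $[m]=\{1,\dots,m\}$. For $i\in[m]$, $\mathcal D_i$ is a probability distribution and $f_i(x,y)=\mathbb E_{\xi\sim\mathcal D_i}[\tilde f_i(x,y;\xi)]$ on $\mathbb R^{d_1}\times\mathbb R^{d_2}$. $g:\mathbb R^{d_1}\to\mathbb R\cup\{+\infty\}$ and $h:\mathbb R^{d_2}\to\mathbb R\cup\{+\infty\}$ are closed convex functions. $W=(w_{ij})\in\mathbb R^{m\times m}$ is the mixing matrix, $I$ the identity, $\mathbf 1\in\mathbb R^m$ the all-ones vector. $X=[x_1,\dots,x_m]^\top\in\mathbb R^{m\times d_1}$, $Y=[y_1,\dots,y_m]^\top\in\mathbb R^{m\times d_2}$, $\Lambda=[\lambda_1,\dots,\lambda_m]^\top\in\mathbb R^{m\times d_2}$, and $Z$ has rows $z_i=[x_i;y_i]$; $\nabla F(Z)$ has rows $\nabla f_i(x_i,y_i)$. For such a matrix, $\bar x=\frac1m\sum_i x_i$, $X_\perp=X-\mathbf 1\bar x^\top$ (similarly $V_{\perp,x}=(V_x)_\perp$). $\mathrm{prox}_r(u)=\arg\min_v\{r(v)+\frac12\|v-u\|^2\}$, acting row-wise on matrices. $$\Phi(X,\Lambda,Y)=\frac1m\sum_{i=1}^m\big(f_i(x_i,y_i)-h(y_i)\big)-\frac{L}{2\sqrt m}\langle\Lambda,(W-I)Y\rangle,$$ $P(x,\Lambda)=\max_Y\Phi(\mathbf 1x^\top,\Lambda,Y)$, $\phi(x,\Lambda)=P(x,\Lambda)+g(x)$,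 $Q(X,\Lambda)=\max_Y\Phi(X,\Lambda,Y)$, $\widetilde Y^{(t)}=\arg\max_Y\Phi(X^{(t)},\Lambda^{(t)},Y)$, and $\hat\delta_t=Q(X^{(t)},\Lambda^{(t)})-\Phi(X^{(t)},\Lambda^{(t)},Y^{(t)})$. **Assumptions.** A1: for each $i$, $f_i(x,\cdot)$ is $\mu$-strongly concave with $\mu>0$; there is $\phi^*\in\mathbb R$ with $\phi(x,\Lambda)\ge\phi^*$ for all $x,\Lambda$; $\mathrm{dom}(h)$ has nonempty relative interior. A2: $\mathrm{Null}(W-I)=\mathrm{Span}\{\mathbf 1\}$, $W^\top\mathbf 1=\mathbf 1$, $\rho:=\|W-\frac1m\mathbf 1\mathbf 1^\top\|_2<1$, $\|W-I\|_2\le2$. A3: each $f_i$ is $L$-smooth (gradient $L$-Lipschitz), and the stochastic gradient $\tilde\nabla f_i(x,y;\xi)$, $\xi\sim\mathcal D_i$, satisfies (i) $\mathbb E_\xi[\tilde\nabla f_i(x,y;\xi)]=\nabla f_i(x,y)$; (ii) $\mathbb E_\xi\|\tilde\nabla f_i(x,y;\xi)-\nabla f_i(x,y)\|_2^2\le\sigma^2$ for some $\sigma^2\ge0$; (iii) $\mathbb E_\xi\|\tilde\nabla f_i(x,y;\xi)-\tilde\nabla f_i(x',y';\xi)\|_2^2\le L^2(\|x-x'\|_2^2+\|y-y'\|_2^2)$ for all $(x,y),(x',y')$. The condition number is $\kappa=L/\mu$. **VRLM algorithm with STORM option.** For a finite sample set $\mathcal B$, $G_i^{(t)}(\mathcal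 B)=\frac1{|\mathcal B|}\sum_{\xi\in\mathcal B}\tilde\nabla f_i(x_i^{(t)},y_i^{(t)};\xi)$. Samples are drawn i.i.d. from $\mathcal D_i$, independently of the past. Start from deterministic $x_i^{(0)}=x^{(0)}\in\mathrm{dom}(g)$, $y_i^{(0)}=y^{(0)}\in\mathrm{dom}(h)$ for all $i$, $\Lambda^{(0)}=0$; $d_i^{(0)}=[d_{x,i}^{(0)};d_{y,i}^{(0)}]=G_i^{(0)}(\mathcal B_i^{(0)})$ with $|\mathcal B_i^{(0)}|=\mathcal S_0$; $V_x^{(0)}=D_x^{(0)}$. Here $D_x^{(t)},D_y^{(t)},D^{(t)}$ have rows $d_{x,i}^{(t)},d_{y,i}^{(t)},d_i^{(t)}$. For $t\ge1$: $d_i^{(t)}=G_i^{(t)}(\mathcal B_i^{(t)})+(1-\beta)\big(d_i^{(t-1)}-G_i^{(t-1)}(\mathcal B_i^{(t)})\big)$ with $|\mathcal B_i^{(t)}|=\mathcal S_t$, and $V_x^{(t)}=W(V_x^{(t-1)}+D_x^{(t)}-D_x^{(t-1)})$. For $t\ge0$: $V_y^{(t)}=D_y^{(t)}-\frac{L\sqrt m}{2}(W-I)^\top\Lambda^{(t)}$, $\Lambda^{(t+1)}=\Lambda^{(t)}+\frac{L\eta_\Lambda}{2\sqrt m}(W-I)Y^{(t)}$, $X^{(t+1)}=\mathrm{prox}_{\eta_xg}(WX^{(t)}-\eta_xV_x^{(t)})$, $Y^{(t+1)}=\mathrm{prox}_{\eta_yh}(Y^{(t)}+\eta_yV_y^{(t)})$.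 $R^{(t)}=D^{(t)}-\nabla F(Z^{(t)})$ and $\Upsilon_t=\sigma^2/\mathcal S_t$. Expectations are over all random samples and over $\tau$, which is independent of the samples. *)

theory Defs
  imports "HOL-Probability.Probability"
begin

text \<open>
  An $m \times d$ matrix with rows $x_1,\dots,x_m$ has type \<open>real^'d^'m\<close>; on this type \<open>norm\<close>
  is the Frobenius norm and \<open>inner\<close> the Frobenius inner product.  A stacked vector $[x;y]$ is the pair
  \<open>(x, y)\<close>, whose product norm is the Euclidean one; a matrix with rows $[x_i;y_i]$ therefore has type
  \<open>((real^'p) \<times> (real^'q))^'m\<close>.  Functions into $\mathbb R \cup \{+\infty\}$ are \<open>ereal\<close>-valued functions
  that omit \<open>-\<infinity>\<close>.
\<close>

section \<open>Convex analysis\<close>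

definition eff_dom :: "('a \<Rightarrow> ereal) \<Rightarrow> 'a set" where
  "eff_dom r = {x. r x < \<infinity>}"

definition closed_convex_fun :: "('a::euclidean_space \<Rightarrow> ereal) \<Rightarrow> bool" where
  "closed_convex_fun r \<longleftrightarrow>
     (\<forall>x. r x \<noteq> -\<infinity>) \<and>
     convex {(x, s::real). r x \<le> ereal s} \<and>
     closed {(x, s::real). r x \<le> ereal s}"

definition strongly_concave :: "real \<Rightarrow> ('a::euclidean_space \<Rightarrow> real) \<Rightarrow> bool" where
  "strongly_concave \<mu> \<psi> \<longleftrightarrow>
     (\<forall>y y'. \<forall>t\<in>{0..1}.
        \<psi> (t *\<^sub>R y + (1 - t) *\<^sub>R y')
          \<ge> t * \<psi> y + (1 - t) * \<psi> y' + \<mu> / 2 * t * (1 - t) * (norm (y - y'))\<^sup>2)"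

text \<open>Meaningful only where \<open>\<psi>\<close> is differentiable.\<close>

definition grad :: "('a::euclidean_space \<Rightarrow> real) \<Rightarrow> 'a \<Rightarrow> 'a" where
  "grad \<psi> z = (THE D. GDERIV \<psi> z :> D)"

definition smooth_fun :: "real \<Rightarrow> ('a::euclidean_space \<Rightarrow> real) \<Rightarrow> bool" where
  "smooth_fun L \<psi> \<longleftrightarrow> (\<forall>z. \<psi> differentiable (at z)) \<and> L-lipschitz_on UNIV (grad \<psi>)"

text \<open>The minimizer exists and is unique when \<open>r\<close> is closed, convex and not identically \<open>\<infinity>\<close>.\<close>

definition prox :: "('a::euclidean_space \<Rightarrow> ereal) \<Rightarrow> 'a \<Rightarrow> 'a" where
  "prox r u = arg_min (\<lambda>v. r v + ereal (1 / 2 * (norm (v - u))\<^sup>2)) (\<lambda>_. True)"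

definition prox_rows ::
  "('a::euclidean_space \<Rightarrow> ereal) \<Rightarrow> 'a^'m \<Rightarrow> 'a^'m" where
  "prox_rows r U = (\<chi> i. prox r (U $ i))"

section \<open>Matrices indexed by agents\<close>

text \<open>The matrix $\mathbf 1 x^\top$.\<close>

definition const_rows :: "'a \<Rightarrow> 'a^'m::finite" where
  "const_rows x = (\<chi> i. x)"

definition row_avg :: "'a::real_vector^'m::finite \<Rightarrow> 'a" where
  "row_avg X = (1 / real CARD('m)) *\<^sub>R (\<Sum>i\<in>UNIV. X $ i)"

definition perp :: "'a::real_vector^'m::finite \<Rightarrow> 'a^'m" where
  "perp X = X - const_rows (row_avg X)"

definition x_part :: "((real^'p) \<times> (real^'q))^'m::finite \<Rightarrow> real^'p^'m" where
  "x_part D = (\<chi> i. fst (D $ i))"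

definition y_part :: "((real^'p) \<times> (real^'q))^'m::finite \<Rightarrow> real^'q^'m" where
  "y_part D = (\<chi> i. snd (D $ i))"

section \<open>The saddle-point problem\<close>

definition Phi_fun ::
  "('m::finite \<Rightarrow> real^'p \<Rightarrow> real^'q \<Rightarrow> real) \<Rightarrow> (real^'q \<Rightarrow> ereal) \<Rightarrow> real^'m^'m \<Rightarrow> real
    \<Rightarrow> real^'p^'m \<Rightarrow> real^'q^'m \<Rightarrow> real^'q^'m \<Rightarrow> ereal" where
  "Phi_fun f h W L X \<Lambda> Y =
     ereal (1 / real CARD('m)) * (\<Sum>i\<in>UNIV. ereal (f i (X $ i) (Y $ i)) - h (Y $ i))
     - ereal (L / (2 * sqrt (real CARD('m))) * (\<Lambda> \<bullet> ((W - mat 1) ** Y)))"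

text \<open>The maxima over \<open>Y\<close> are written as suprema; they are attained, at a unique point, when each
  \<open>f i x\<close> is strongly concave and smooth and \<open>h\<close> is closed, convex and not identically \<open>\<infinity>\<close>.\<close>

definition Q_fun ::
  "('m::finite \<Rightarrow> real^'p \<Rightarrow> real^'q \<Rightarrow> real) \<Rightarrow> (real^'q \<Rightarrow> ereal) \<Rightarrow> real^'m^'m \<Rightarrow> real
    \<Rightarrow> real^'p^'m \<Rightarrow> real^'q^'m \<Rightarrow> ereal" where
  "Q_fun f h W L X \<Lambda> = (SUP Y. Phi_fun f h W L X \<Lambda> Y)"

definition Y_argmax ::
  "('m::finite \<Rightarrow> real^'p \<Rightarrow> real^'q \<Rightarrow> real) \<Rightarrow> (real^'q \<Rightarrow> ereal) \<Rightarrow> real^'m^'m \<Rightarrow> real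
    \<Rightarrow> real^'p^'m \<Rightarrow> real^'q^'m \<Rightarrow> real^'q^'m" where
  "Y_argmax f h W L X \<Lambda> = arg_max (Phi_fun f h W L X \<Lambda>) (\<lambda>_. True)"

definition P_fun ::
  "('m::finite \<Rightarrow> real^'p \<Rightarrow> real^'q \<Rightarrow> real) \<Rightarrow> (real^'q \<Rightarrow> ereal) \<Rightarrow> real^'m^'m \<Rightarrow> real
    \<Rightarrow> real^'p \<Rightarrow> real^'q^'m \<Rightarrow> ereal" where
  "P_fun f h W L x \<Lambda> = (SUP Y. Phi_fun f h W L (const_rows x) \<Lambda> Y)"

definition phi_fun ::
  "('m::finite \<Rightarrow> real^'p \<Rightarrow> real^'q \<Rightarrow> real) \<Rightarrow> (real^'p \<Rightarrow> ereal) \<Rightarrow> (real^'q \<Rightarrow> ereal)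
    \<Rightarrow> real^'m^'m \<Rightarrow> real \<Rightarrow> real^'p \<Rightarrow> real^'q^'m \<Rightarrow> ereal" where
  "phi_fun f g h W L x \<Lambda> = P_fun f h W L x \<Lambda> + g x"

definition grad_x_P ::
  "('m::finite \<Rightarrow> real^'p \<Rightarrow> real^'q \<Rightarrow> real) \<Rightarrow> (real^'q \<Rightarrow> ereal) \<Rightarrow> real^'m^'m \<Rightarrow> real
    \<Rightarrow> real^'p \<Rightarrow> real^'q^'m \<Rightarrow> real^'p" where
  "grad_x_P f h W L x \<Lambda> = grad (\<lambda>u. real_of_ereal (P_fun f h W L u \<Lambda>)) x"

definition grad_\<Lambda>_P ::
  "('m::finite \<Rightarrow> real^'p \<Rightarrow> real^'q \<Rightarrow> real) \<Rightarrow> (real^'q \<Rightarrow> ereal) \<Rightarrow> real^'m^'m \<Rightarrow> real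
    \<Rightarrow> real^'p \<Rightarrow> real^'q^'m \<Rightarrow> real^'q^'m" where
  "grad_\<Lambda>_P f h W L x \<Lambda> = grad (\<lambda>U. real_of_ereal (P_fun f h W L x U)) \<Lambda>"

definition grad_F ::
  "('m::finite \<Rightarrow> real^'p \<Rightarrow> real^'q \<Rightarrow> real) \<Rightarrow> real^'p^'m \<Rightarrow> real^'q^'m
    \<Rightarrow> ((real^'p) \<times> (real^'q))^'m" where
  "grad_F f X Y = (\<chi> i. grad (\<lambda>(x, y). f i x y) (X $ i, Y $ i))"

section \<open>The algorithm\<close>

text \<open>A batch of size \<open>n\<close> is a family of draws \<open>b 0, \<dots>, b (n - 1)\<close> rather than a set, since draws may
  coincide.\<close>

definition batch_grad ::
  "(real^'p \<Rightarrow> real^'q \<Rightarrow> 's \<Rightarrow> (real^'p) \<times> (real^'q)) \<Rightarrow> nat \<Rightarrow> (nat \<Rightarrow> 's)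
    \<Rightarrow> real^'p \<Rightarrow> real^'q \<Rightarrow> (real^'p) \<times> (real^'q)" where
  "batch_grad G n b x y = (1 / real n) *\<^sub>R (\<Sum>k<n. G x y (b k))"

text \<open>The samples with index \<open>(t, i, k)\<close> in \<open>J\<close>, as one random variable \<open>samples \<xi> J\<close> with values in
  \<open>sample_space \<D> J\<close>.\<close>

definition sample_space ::
  "('m \<Rightarrow> 's measure) \<Rightarrow> (nat \<times> 'm \<times> nat) set \<Rightarrow> (nat \<times> 'm \<times> nat \<Rightarrow> 's) measure" where
  "sample_space \<D> J = PiM J (\<lambda>(t, i, k). \<D> i)"

definition samples ::
  "(nat \<Rightarrow> 'm \<Rightarrow> nat \<Rightarrow> 'w \<Rightarrow> 's) \<Rightarrow> (nat \<times> 'm \<times> nat) set \<Rightarrow> 'w \<Rightarrow> (nat \<times> 'm \<times> nat \<Rightarrow> 's)" where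
  "samples \<xi> J \<omega> = restrict (\<lambda>(t, i, k). \<xi> t i k \<omega>) J"

text \<open>One realization of the algorithm: \<open>b t i k\<close> is the \<open>k\<close>-th sample drawn by agent \<open>i\<close> at
  iteration \<open>t\<close>, and \<open>S t\<close> the batch size.\<close>

definition vrlm_storm ::
  "('m::finite \<Rightarrow> real^'p \<Rightarrow> real^'q \<Rightarrow> 's \<Rightarrow> (real^'p) \<times> (real^'q))
    \<Rightarrow> (real^'p \<Rightarrow> ereal) \<Rightarrow> (real^'q \<Rightarrow> ereal) \<Rightarrow> real^'m^'m \<Rightarrow> real
    \<Rightarrow> real \<Rightarrow> real \<Rightarrow> real \<Rightarrow> real \<Rightarrow> (nat \<Rightarrow> nat) \<Rightarrow> real^'p \<Rightarrow> real^'q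
    \<Rightarrow> (nat \<Rightarrow> 'm \<Rightarrow> nat \<Rightarrow> 's)
    \<Rightarrow> (nat \<Rightarrow> real^'p^'m) \<Rightarrow> (nat \<Rightarrow> real^'q^'m) \<Rightarrow> (nat \<Rightarrow> real^'q^'m)
    \<Rightarrow> (nat \<Rightarrow> ((real^'p) \<times> (real^'q))^'m) \<Rightarrow> (nat \<Rightarrow> real^'p^'m) \<Rightarrow> bool" where
  "vrlm_storm G g h W L \<beta> \<eta>x \<eta>y \<eta>\<Lambda> S x0 y0 b X \<Lambda> Y D V \<longleftrightarrow>
     X 0 = const_rows x0 \<and>
     Y 0 = const_rows y0 \<and>
     \<Lambda> 0 = 0 \<and>
     (\<forall>i. D 0 $ i = batch_grad (G i) (S 0) (b 0 i) (X 0 $ i) (Y 0 $ i)) \<and>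
     V 0 = x_part (D 0) \<and>
     (\<forall>t i. D (Suc t) $ i =
        batch_grad (G i) (S (Suc t)) (b (Suc t) i) (X (Suc t) $ i) (Y (Suc t) $ i)
        + (1 - \<beta>) *\<^sub>R
          (D t $ i - batch_grad (G i) (S (Suc t)) (b (Suc t) i) (X t $ i) (Y t $ i))) \<and>
     (\<forall>t. V (Suc t) = W ** (V t + x_part (D (Suc t)) - x_part (D t))) \<and>
     (\<forall>t. \<Lambda> (Suc t) =
        \<Lambda> t + (L * \<eta>\<Lambda> / (2 * sqrt (real CARD('m)))) *\<^sub>R ((W - mat 1) ** Y t)) \<and>
     (\<forall>t. X (Suc t) =
        prox_rows (\<lambda>v. ereal \<eta>x * g v) (W ** X t - \<eta>x *\<^sub>R V t)) \<and>
     (\<forall>t. Y (Suc t) =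
        prox_rows (\<lambda>v. ereal \<eta>y * h v)
          (Y t + \<eta>y *\<^sub>R
            (y_part (D t) - (L * sqrt (real CARD('m)) / 2) *\<^sub>R (transpose (W - mat 1) ** \<Lambda> t))))"

end

theory Submission
  imports Defs
begin

text \<open>
  Everything except two conditional second-moment bounds is pathwise.  Fix a realization, let \<open>R\<close> be the gradient
  error and treat it as arbitrary.  Danskin's theorem makes \<open>P\<close> smooth with the Lipschitz maximizer
  controlling its gradients, so the proximal step in \<open>X\<close> and the gradient step in \<open>\<Lambda>\<close> decrease \<open>\<phi>\<close> at the averaged
  iterate, up to consensus errors, the distance of \<open>Y\<close> to its maximizer, and \<open>R\<close>.  The proximal
  ascent step contracts that distance and decreases the gap \<open>Q - \<Phi>\<close> by a multiple of the squared displacement of \<open>Y\<close>;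
  the consensus errors of \<open>X\<close> and \<open>V\<close> contract by the factor \<open>\<rho>\<close>.  A weighted sum of these quantities is therefore a
  Lyapunov function whose decrease dominates the two stationarity measures and the displacement of \<open>(X, Y)\<close>, and whose
  increase is a small multiple of the squared norms of \<open>R\<close> and of the increment of \<open>D\<close>.

  In expectation, STORM contracts the squared norm of \<open>R\<close> by \<open>1 - \<beta>\<close> up to the displacement of \<open>(X, Y)\<close> and the
  noise \<open>\<beta>\<^sup>2 \<Upsilon>\<close>.  The step size in \<open>Y\<close> is proportional to the square root of \<open>\<beta>\<close>, which makes the displacement
  gained from the gap outweigh the one lost here, and summing over the iterations closes the estimate.
\<close>

section \<open>Gradients, smoothness and strong concavity\<close>

text \<open>The obstacle is a loop of estimates: \<open>R\<close> is controlled by the displacement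
  of the iterates, the displacement by \<open>R\<close> and the increment of \<open>D\<close>, and
  that increment again by both. The loop closes only if the constants match. The unit of account is
  \<open>cU\<close>: the initial constant allows \<open>cU / (2 * L)\<close>, up to the factor
  \<open>m\<close>, for the squared norm of \<open>R\<close>. Multiplying the summed STORM recursion
  by this number fixes what a Lyapunov step must deliver: a multiple of \<open>L * cU\<close> of the
  displacement, at the price of a multiple of \<open>\<beta> * cU / L\<close> of the squared norm of
  \<open>R\<close>. The other weights are tuned to stay below the remaining initial coefficients.
  The same loop makes integrability nontrivial, since the iterates come with no a priori moment
  bounds; it is extracted from the pathwise inequality one iteration at a time. The Lyapunov gain
  finally yields the factors \<open>50 / \<eta>x\<close> and \<open>2 / \<eta>L\<close>, which the
  brackets in the claim dominate.\<close>

lemma GDERIV_unique: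
  fixes \<psi> :: "'a::euclidean_space \<Rightarrow> real"
  assumes "GDERIV \<psi> z :> a" "GDERIV \<psi> z :> b"
  shows "a = b"
proof -
  have "(\<lambda>h. inner h a) = (\<lambda>h. inner h b)"
    using assms unfolding gderiv_def by (rule has_derivative_unique)
  then show ?thesis by (metis vector_eq_ldot)
qed

lemma grad_eqI:
  fixes \<psi> :: "'a::euclidean_space \<Rightarrow> real"
  assumes "GDERIV \<psi> z :> D"
  shows "grad \<psi> z = D"
  unfolding grad_def using assms by (blast intro: the_equality GDERIV_unique)

lemma GDERIV_grad:
  fixes \<psi> :: "'a::euclidean_space \<Rightarrow> real"
  assumes "\<psi> differentiable (at z)"
  shows "GDERIV \<psi> z :> grad \<psi> z"
proof -
  obtain T where T: "(\<psi> has_derivative T) (at z)" using assms differentiable_def by blast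
  interpret T: linear T using T has_derivative_linear by blast
  \<comment> \<open>Riesz representation of the derivative through its values on the standard
    basis.\<close>
  have "T = (\<lambda>h. inner h (\<Sum>b\<in>Basis. T b *\<^sub>R b))"
  proof
    fix h
    have "T h = T (\<Sum>b\<in>Basis. (h \<bullet> b) *\<^sub>R b)" by (simp add: euclidean_representation)
    also have "\<dots> = (\<Sum>b\<in>Basis. (h \<bullet> b) * T b)" by (simp add: T.sum T.scale)
    also have "\<dots> = inner h (\<Sum>b\<in>Basis. T b *\<^sub>R b)"
      by (simp add: inner_sum_right mult.commute)
    finally show "T h = inner h (\<Sum>b\<in>Basis. T b *\<^sub>R b)" .
  qed
  then have "GDERIV \<psi> z :> (\<Sum>b\<in>Basis. T b *\<^sub>R b)" using T by (simp add: gderiv_def)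
  then show ?thesis using grad_eqI by fastforce
qed

text \<open>A two-sided quadratic error around an affine model identifies the gradient. Applied to
  the maximum function, it avoids differentiating the maximizer.\<close>

lemma GDERIV_of_quadratic_bound:
  fixes \<psi> :: "'a::euclidean_space \<Rightarrow> real"
  assumes "\<And>z'. \<bar>\<psi> z' - \<psi> z - D \<bullet> (z' - z)\<bar> \<le> C * (norm (z' - z))\<^sup>2"
  shows "GDERIV \<psi> z :> D"
  unfolding gderiv_def
proof (rule has_derivativeI)
  show "bounded_linear (\<lambda>h. h \<bullet> D)" by (rule bounded_linear_inner_left)
  have "((\<lambda>y. \<bar>C\<bar> * norm (y - z)) \<longlongrightarrow> \<bar>C\<bar> * norm (z - z)) (at z)"
    by (intro tendsto_intros)
  then have lim: "((\<lambda>y. \<bar>C\<bar> * norm (y - z)) \<longlongrightarrow> 0) (at z)" by simp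
  show "((\<lambda>y. ((\<psi> y - \<psi> z) - (y - z) \<bullet> D) /\<^sub>R norm (y - z)) \<longlongrightarrow> 0) (at z)"
  proof (rule Lim_null_comparison[OF _ lim], rule always_eventually, rule allI)
    fix y
    show "norm (((\<psi> y - \<psi> z) - (y - z) \<bullet> D) /\<^sub>R norm (y - z)) \<le> \<bar>C\<bar> * norm (y - z)"
    proof (cases "y = z")
      case False
      then have n: "norm (y - z) > 0" by simp
      have "\<bar>(\<psi> y - \<psi> z) - (y - z) \<bullet> D\<bar> \<le> \<bar>C\<bar> * norm (y - z) * norm (y - z)"
        using assms[of y] mult_right_mono[OF abs_ge_self[of C], of "(norm (y - z))\<^sup>2"]
        by (simp add: inner_commute power2_eq_square)
      then show ?thesis using n by (simp add: field_simps)
    qed simp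
  qed
qed

lemma GDERIV_compose_line:
  fixes \<psi> :: "'a::euclidean_space \<Rightarrow> real"
  assumes "GDERIV \<psi> (z + t *\<^sub>R v) :> D"
  shows "((\<lambda>t. \<psi> (z + t *\<^sub>R v)) has_real_derivative (v \<bullet> D)) (at t)"
proof -
  have 1: "((\<lambda>t. z + t *\<^sub>R v) has_derivative (\<lambda>h. h *\<^sub>R v)) (at t)"
    by (auto intro!: derivative_eq_intros)
  have 2: "(\<psi> has_derivative (\<lambda>h. h \<bullet> D)) (at (z + t *\<^sub>R v))"
    using assms by (simp add: gderiv_def)
  have "((\<lambda>t. \<psi> (z + t *\<^sub>R v)) has_derivative (\<lambda>h. (h *\<^sub>R v) \<bullet> D)) (at t)"
    using diff_chain_at[OF 1 2] by (simp add: o_def)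
  then show ?thesis
    by (simp add: has_field_derivative_def mult.commute[of _ "v \<bullet> D"])
qed

lemma mean_value_line:
  fixes \<psi> :: "'a::euclidean_space \<Rightarrow> real"
  assumes "\<And>z. GDERIV \<psi> z :> G z"
  obtains t where "0 < t" "t < 1" "\<psi> (z + v) - \<psi> z = v \<bullet> G (z + t *\<^sub>R v)"
proof -
  have "\<exists>t::real. t > 0 \<and> t < 1 \<and> (\<lambda>t. \<psi> (z + t *\<^sub>R v)) 1 - (\<lambda>t. \<psi> (z + t *\<^sub>R v)) 0
       = (1 - 0) * (v \<bullet> G (z + t *\<^sub>R v))"
    by (rule MVT2) (auto intro: GDERIV_compose_line assms)
  then show ?thesis using that by auto
qed

lemma smooth_GDERIV: "smooth_fun L \<psi> \<Longrightarrow> GDERIV \<psi> z :> grad \<psi> z"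
  by (simp add: smooth_fun_def GDERIV_grad)

lemma smooth_grad_lipschitz:
  "smooth_fun L \<psi> \<Longrightarrow> norm (grad \<psi> z - grad \<psi> z') \<le> L * norm (z - z')"
  using lipschitz_onD[of L UNIV "grad \<psi>" z z'] by (auto simp: smooth_fun_def dist_norm)

lemma smooth_nonneg: "smooth_fun L \<psi> \<Longrightarrow> 0 \<le> L"
  by (auto simp: smooth_fun_def lipschitz_on_def)

text \<open>Along the segment, the deviation from the affine model has derivative at most
  \<open>L * t * (norm v)\<^sup>2\<close> in absolute value. Adding or subtracting the primitive of
  this bound gives a monotone function, so no integral of the gradient is needed.\<close>

lemma smooth_quadratic_bound:
  fixes \<psi> :: "'a::euclidean_space \<Rightarrow> real"
  assumes sm: "smooth_fun L \<psi>"
  shows "\<bar>\<psi> z' - \<psi> z - grad \<psi> z \<bullet> (z' - z)\<bar> \<le> L / 2 * (norm (z' - z))\<^sup>2"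
proof -
  define v where "v = z' - z"
  note L0 = smooth_nonneg[OF sm]
  have der: "((\<lambda>t. \<psi> (z + t *\<^sub>R v) - t * (v \<bullet> grad \<psi> z)) has_real_derivative
        (v \<bullet> grad \<psi> (z + t *\<^sub>R v) - v \<bullet> grad \<psi> z)) (at t)" for t
    by (rule derivative_eq_intros GDERIV_compose_line[OF smooth_GDERIV[OF sm]] | simp)+
  have bd: "\<bar>v \<bullet> grad \<psi> (z + t *\<^sub>R v) - v \<bullet> grad \<psi> z\<bar> \<le> L * t * (norm v)\<^sup>2" if "t \<ge> 0" for t
  proof -
    have "\<bar>v \<bullet> (grad \<psi> (z + t *\<^sub>R v) - grad \<psi> z)\<bar> \<le> norm v * norm (grad \<psi> (z + t *\<^sub>R v) - grad \<psi> z)"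
      by (rule Cauchy_Schwarz_ineq2)
    also have "\<dots> \<le> norm v * (L * norm (z + t *\<^sub>R v - z))"
      by (intro mult_left_mono smooth_grad_lipschitz sm) auto
    finally show ?thesis using that by (simp add: inner_diff_right power2_eq_square algebra_simps)
  qed
  define u where "u t = \<psi> (z + t *\<^sub>R v) - t * (v \<bullet> grad \<psi> z)" for t
  have up: "u 1 - L/2 * (norm v)\<^sup>2 * 1^2 \<le> u 0 - L/2 * (norm v)\<^sup>2 * 0^2"
  proof (rule DERIV_nonpos_imp_nonincreasing[of 0 1])
    fix t :: real assume t: "0 \<le> t" "t \<le> 1"
    have "((\<lambda>t. u t - L/2 * (norm v)\<^sup>2 * t^2) has_real_derivative
       (v \<bullet> grad \<psi> (z + t *\<^sub>R v) - v \<bullet> grad \<psi> z) - L * t * (norm v)\<^sup>2) (at t)"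
      unfolding u_def by (rule derivative_eq_intros der | simp)+
    moreover have "(v \<bullet> grad \<psi> (z + t *\<^sub>R v) - v \<bullet> grad \<psi> z) - L * t * (norm v)\<^sup>2 \<le> 0"
      using bd[OF t(1)] by linarith
    ultimately show "\<exists>y. ((\<lambda>t. u t - L/2 * (norm v)\<^sup>2 * t^2) has_real_derivative y) (at t) \<and> y \<le> 0"
      by blast
  qed simp
  have lo: "u 1 + L/2 * (norm v)\<^sup>2 * 1^2 \<ge> u 0 + L/2 * (norm v)\<^sup>2 * 0^2"
  proof (rule DERIV_nonneg_imp_nondecreasing[of 0 1])
    fix t :: real assume t: "0 \<le> t" "t \<le> 1"
    have "((\<lambda>t. u t + L/2 * (norm v)\<^sup>2 * t^2) has_real_derivative
       (v \<bullet> grad \<psi> (z + t *\<^sub>R v) - v \<bullet> grad \<psi> z) + L * t * (norm v)\<^sup>2) (at t)"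
      unfolding u_def by (rule derivative_eq_intros der | simp)+
    moreover have "(v \<bullet> grad \<psi> (z + t *\<^sub>R v) - v \<bullet> grad \<psi> z) + L * t * (norm v)\<^sup>2 \<ge> 0"
      using bd[OF t(1)] by linarith
    ultimately show "\<exists>y. ((\<lambda>t. u t + L/2 * (norm v)\<^sup>2 * t^2) has_real_derivative y) (at t) \<and> y \<ge> 0"
      by blast
  qed simp
  show ?thesis using up lo by (intro abs_leI) (simp_all add: u_def v_def inner_commute)
qed

lemma strongly_concave_upper:
  fixes \<psi> :: "'a::euclidean_space \<Rightarrow> real"
  assumes sc: "strongly_concave \<mu> \<psi>" and D: "GDERIV \<psi> y :> D"
  shows "\<psi> z \<le> \<psi> y + D \<bullet> (z - y) - \<mu> / 2 * (norm (z - y))\<^sup>2"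
proof -
  define v where "v = z - y"
  have 0: "((\<lambda>t. \<psi> (y + t *\<^sub>R v)) has_real_derivative (v \<bullet> D)) (at 0)"
    by (rule GDERIV_compose_line) (simp add: D)
  have "((\<lambda>t. (\<psi> (y + t *\<^sub>R v) - \<psi> y) / t) \<longlongrightarrow> v \<bullet> D) (at_right 0)"
    using has_field_derivative_at_within[OF 0, of "{0<..}"] by (simp add: has_field_derivative_iff)
  moreover have "((\<lambda>t. \<psi> z - \<psi> y + \<mu> / 2 * (1 - t) * (norm v)\<^sup>2)
       \<longlongrightarrow> \<psi> z - \<psi> y + \<mu> / 2 * (1 - 0) * (norm v)\<^sup>2) (at_right 0)"
    by (intro tendsto_intros)
  \<comment> \<open>Strong concavity on the segment, divided by \<open>t\<close>, bounds a
    difference quotient from below; in the limit \<open>t\<close> to \<open>0\<close> the factor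
    \<open>1 - t\<close> disappears.\<close>
  moreover have "eventually (\<lambda>t. \<psi> z - \<psi> y + \<mu> / 2 * (1 - t) * (norm v)\<^sup>2
         \<le> (\<psi> (y + t *\<^sub>R v) - \<psi> y) / t) (at_right 0)"
    unfolding eventually_at_right_field
  proof (intro exI[of _ 1] conjI allI impI)
    fix t :: real assume t: "0 < t" "t < 1"
    have "t *\<^sub>R z + (1 - t) *\<^sub>R y = y + t *\<^sub>R v" by (simp add: v_def algebra_simps)
    then have "\<psi> (y + t *\<^sub>R v) \<ge> t * \<psi> z + (1 - t) * \<psi> y + \<mu> / 2 * t * (1 - t) * (norm v)\<^sup>2"
      using sc t unfolding strongly_concave_def v_def by (metis atLeastAtMost_iff less_eq_real_def)
    then have "t * (\<psi> z - \<psi> y + \<mu> / 2 * (1 - t) * (norm v)\<^sup>2) \<le> \<psi> (y + t *\<^sub>R v) - \<psi> y"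
      by (simp add: algebra_simps)
    then show "\<psi> z - \<psi> y + \<mu> / 2 * (1 - t) * (norm v)\<^sup>2 \<le> (\<psi> (y + t *\<^sub>R v) - \<psi> y) / t"
      using t by (simp add: field_simps)
  qed simp
  ultimately have "\<psi> z - \<psi> y + \<mu> / 2 * (1 - 0) * (norm v)\<^sup>2 \<le> v \<bullet> D"
    by (intro tendsto_le[of "at_right (0::real)"]) auto
  then show ?thesis by (simp add: v_def inner_commute)
qed

section \<open>Existence of optimal points for a closed convex plus a strongly convex
  function\<close>

lemma closed_convex_affine_minorant:
  fixes r :: "'a::euclidean_space \<Rightarrow> ereal"
  assumes cc: "closed_convex_fun r" and x0: "r x0 < \<infinity>"
  obtains a b where "\<And>x s. r x \<le> ereal s \<Longrightarrow> a \<bullet> x + b \<le> s"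
proof -
  define E where "E = {(x, s::real). r x \<le> ereal s}"
  obtain s0 where s0: "r x0 = ereal s0"
    using cc x0 unfolding closed_convex_fun_def by (metis ereal_cases less_ereal.simps(2) not_less_iff_gr_or_eq order_less_irrefl)
  \<comment> \<open>The point one unit below the graph is separated from the epigraph. As
    \<open>(x0, s0)\<close> lies vertically above it, the hyperplane cannot be vertical and
    \<open>\<tau>\<close> is positive.\<close>
  have "(x0, s0 - 1) \<notin> E" by (simp add: E_def s0)
  moreover have "convex E" "closed E" using cc by (auto simp: closed_convex_fun_def E_def)
  ultimately obtain p c where p: "p \<bullet> (x0, s0 - 1) < c" "\<And>y. y \<in> E \<Longrightarrow> c < p \<bullet> y"
    using separating_hyperplane_closed_point by metis
  obtain u \<tau> where pu: "p = (u, \<tau>)" by (cases p)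
  have "(x0, s0) \<in> E" by (simp add: E_def s0)
  then have "\<tau> > 0" using p(1) p(2)[of "(x0, s0)"] by (auto simp: pu algebra_simps)
  show ?thesis
  proof (rule that[of "- (1 / \<tau>) *\<^sub>R u" "c / \<tau>"])
    fix x s assume "r x \<le> ereal s"
    then have "c < u \<bullet> x + \<tau> * s" using p(2)[of "(x, s)"] by (simp add: pu E_def)
    then show "(- (1 / \<tau>) *\<^sub>R u) \<bullet> x + c / \<tau> \<le> s" using \<open>\<tau> > 0\<close> by (simp add: field_simps)
  qed
qed

lemma closed_convex_finite:
  assumes "closed_convex_fun r" "x \<in> eff_dom r"
  shows "r x = ereal (real_of_ereal (r x))"
  using assms unfolding closed_convex_fun_def eff_dom_def by (cases "r x") auto

text \<open>Minimizing over the epigraph replaces the extended-valued \<open>r\<close> by the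
  continuous function \<open>s - \<psi> x\<close> on a closed set. The affine minorant of
  \<open>r\<close> and the quadratic upper bound on \<open>\<psi>\<close> make its sublevel sets
  compact. The quadratic growth in the conclusion is the form of optimality from which uniqueness,
  Lipschitz dependence and the proximal inequalities follow.\<close>

lemma strongly_concave_max_exists:
  fixes r :: "'a::euclidean_space \<Rightarrow> ereal" and \<psi> :: "'a \<Rightarrow> real"
  assumes cc: "closed_convex_fun r" and x0: "x0 \<in> eff_dom r"
    and mu: "\<mu> > 0" and sc: "strongly_concave \<mu> \<psi>" and cont: "continuous_on UNIV \<psi>"
    and ub: "\<And>z. \<psi> z \<le> k + a \<bullet> z - \<mu> / 2 * (norm z)\<^sup>2"
  shows "\<exists>p. p \<in> eff_dom r \<and> (\<forall>z\<in>eff_dom r.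
     real_of_ereal (r p) - \<psi> p + \<mu> / 2 * (norm (z - p))\<^sup>2 \<le> real_of_ereal (r z) - \<psi> z)"
proof -
  have x0': "r x0 < \<infinity>" using x0 by (simp add: eff_dom_def)
  obtain a' b' where am: "\<And>x s. r x \<le> ereal s \<Longrightarrow> a' \<bullet> x + b' \<le> s"
    using closed_convex_affine_minorant[OF cc x0'] by blast
  define E where "E = {(x, s::real). r x \<le> ereal s}"
  define s0 where "s0 = real_of_ereal (r x0)"
  define K where "K = s0 - \<psi> x0"
  define E' where "E' = E \<inter> {e. snd e - \<psi> (fst e) \<le> K}"
  have E0: "(x0, s0) \<in> E'" using closed_convex_finite[OF cc x0] by (simp add: E'_def E_def K_def s0_def)
  have cont2: "continuous_on UNIV (\<lambda>e::'a\<times>real. snd e - \<psi> (fst e))"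
    by (intro continuous_intros continuous_on_compose2[OF cont]) auto
  have "closed E'" unfolding E'_def
    using cc by (intro closed_Int closed_Collect_le cont2 continuous_on_const) (auto simp: closed_convex_fun_def E_def)
  moreover have "bounded E'"
  proof -
    define q where "q = norm (a' - a)"
    \<comment> \<open>Beyond this radius the quadratic term beats the linear and constant ones. The
      radius is at least \<open>1\<close>, so constants may be multiplied by
      \<open>norm x\<close>.\<close>
    define Rr where "Rr = 2 * (q + \<bar>K\<bar> + \<bar>b'\<bar> + \<bar>k\<bar> + 1) / \<mu> + 1"
    have R1: "norm x \<le> Rr" if "(x, s) \<in> E'" for x s
    proof (rule ccontr)
      assume "\<not> norm x \<le> Rr"
      then have nx: "norm x > Rr" by simp
      have R1: "Rr \<ge> 1" using mu by (simp add: Rr_def q_def)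
      have "a' \<bullet> x + b' \<le> s" "s - \<psi> x \<le> K" using that am by (auto simp: E'_def E_def)
      then have "(a' - a) \<bullet> x + b' - k + \<mu> / 2 * (norm x)\<^sup>2 \<le> K" using ub[of x] by (simp add: inner_diff_left)
      moreover have "(a' - a) \<bullet> x \<ge> - (q * norm x)"
        using Cauchy_Schwarz_ineq2[of "a' - a" x] by (simp add: q_def)
      ultimately have "\<mu> / 2 * norm x * norm x \<le> K - b' + k + q * norm x" by (simp add: power2_eq_square)
      also have "\<dots> \<le> (\<bar>K\<bar> + \<bar>b'\<bar> + \<bar>k\<bar>) * 1 + q * norm x"
        using abs_ge_self[of K] abs_ge_self[of k] abs_ge_minus_self[of b'] by simp
      also have "\<dots> \<le> (\<bar>K\<bar> + \<bar>b'\<bar> + \<bar>k\<bar>) * norm x + q * norm x"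
        using nx R1 by (intro add_right_mono mult_left_mono) auto
      finally have "(\<mu> / 2 * norm x) * norm x \<le> (q + \<bar>K\<bar> + \<bar>b'\<bar> + \<bar>k\<bar>) * norm x" by (simp add: algebra_simps)
      then have "\<mu> / 2 * norm x \<le> q + \<bar>K\<bar> + \<bar>b'\<bar> + \<bar>k\<bar>" using nx R1 by (meson less_le_trans mult_right_le_imp_le zero_less_one less_trans)
      moreover have "\<mu> / 2 * norm x > \<mu> / 2 * Rr" using nx mu by simp
      moreover have "\<mu> / 2 * Rr \<ge> q + \<bar>K\<bar> + \<bar>b'\<bar> + \<bar>k\<bar>" using mu by (simp add: Rr_def field_simps)
      ultimately show False by linarith
    qed
    have "compact (cball (0::'a) Rr)" by simp
    then have "compact (\<psi> ` cball 0 Rr)"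
      by (intro compact_continuous_image continuous_on_subset[OF cont]) auto
    then obtain B where "\<forall>y\<in>\<psi> ` cball 0 Rr. norm y \<le> B"
      using compact_imp_bounded bounded_iff by metis
    then have B: "\<And>x. x \<in> cball 0 Rr \<Longrightarrow> \<bar>\<psi> x\<bar> \<le> B" by auto
    have "E' \<subseteq> cball 0 Rr \<times> {- norm a' * Rr + b' .. K + B}"
    proof clarify
      fix x s assume e: "(x, s) \<in> E'"
      have x: "norm x \<le> Rr" by (rule R1[OF e])
      have 1: "a' \<bullet> x + b' \<le> s" "s - \<psi> x \<le> K" using e am by (auto simp: E'_def E_def)
      have "\<bar>a' \<bullet> x\<bar> \<le> norm a' * norm x" by (rule Cauchy_Schwarz_ineq2)
      also have "\<dots> \<le> norm a' * Rr" by (intro mult_left_mono x) auto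
      finally have "a' \<bullet> x \<ge> - norm a' * Rr" by simp
      moreover have "\<psi> x \<le> B" using B[of x] x by (auto simp: abs_le_iff)
      ultimately show "x \<in> cball 0 Rr \<and> s \<in> {- norm a' * Rr + b' .. K + B}" using 1 x by auto
    qed
    then show ?thesis by (rule bounded_subset[rotated]) (intro bounded_Times bounded_cball bounded_closed_interval)
  qed
  ultimately have "compact E'" by (simp add: compact_eq_bounded_closed)
  then obtain e where e: "e \<in> E'" and emin: "\<And>e'. e' \<in> E' \<Longrightarrow> snd e - \<psi> (fst e) \<le> snd e' - \<psi> (fst e')"
    using continuous_attains_inf[of E' "\<lambda>e. snd e - \<psi> (fst e)"] E0 continuous_on_subset[OF cont2] by blast
  obtain p s where ps: "e = (p, s)" by (cases e)
  have psE: "(p, s) \<in> E" using e ps by (simp add: E'_def)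
  have min: "s - \<psi> p \<le> s' - \<psi> z" if "(z, s') \<in> E" for z s'
    using emin[of "(z, s')"] that e ps by (cases "s' - \<psi> z \<le> K") (auto simp: E'_def)
  have pdom: "p \<in> eff_dom r" using psE by (auto simp: E_def eff_dom_def)
  define sp where "sp = real_of_ereal (r p)"
  have spE: "(p, sp) \<in> E" using closed_convex_finite[OF cc pdom] by (simp add: E_def sp_def)
  have sps: "sp \<le> s" using psE closed_convex_finite[OF cc pdom] unfolding E_def sp_def
    by (metis case_prodD ereal_less_eq(3) mem_Collect_eq)
  have min': "sp - \<psi> p \<le> s' - \<psi> z" if "(z, s') \<in> E" for z s' using min[OF that] sps by linarith
  have conv: "convex E" using cc by (simp add: closed_convex_fun_def E_def)
  have "sp - \<psi> p + \<mu> / 2 * (norm (z - p))\<^sup>2 \<le> real_of_ereal (r z) - \<psi> z" if z: "z \<in> eff_dom r" for z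
  proof -
    define sz where "sz = real_of_ereal (r z)"
    have zE: "(z, sz) \<in> E" using closed_convex_finite[OF cc z] by (simp add: E_def sz_def)
    \<comment> \<open>Minimality of \<open>p\<close> is tested on the segment towards
      \<open>z\<close>. Division by \<open>t\<close> leaves the factor \<open>1 - t\<close>, which
      tends to \<open>1\<close>.\<close>
    have *: "sp - \<psi> p + \<mu> / 2 * (1 - t) * (norm (z - p))\<^sup>2 \<le> sz - \<psi> z" if t: "0 < t" "t < 1" for t
    proof -
      have "t *\<^sub>R (z, sz) + (1 - t) *\<^sub>R (p, sp) \<in> E" using conv zE spE t by (intro convexD) auto
      then have "sp - \<psi> p \<le> t * sz + (1 - t) * sp - \<psi> (t *\<^sub>R z + (1 - t) *\<^sub>R p)" by (intro min') simp
      moreover have "\<psi> (t *\<^sub>R z + (1 - t) *\<^sub>R p) \<ge> t * \<psi> z + (1 - t) * \<psi> p + \<mu> / 2 * t * (1 - t) * (norm (z - p))\<^sup>2"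
        using sc t unfolding strongly_concave_def by auto
      ultimately have "t * (sp - \<psi> p + \<mu> / 2 * (1 - t) * (norm (z - p))\<^sup>2) \<le> t * (sz - \<psi> z)" by (simp add: algebra_simps)
      then show ?thesis using t by simp
    qed
    have "((\<lambda>t. sp - \<psi> p + \<mu> / 2 * (1 - t) * (norm (z - p))\<^sup>2)
       \<longlongrightarrow> sp - \<psi> p + \<mu> / 2 * (1 - 0) * (norm (z - p))\<^sup>2) (at_right 0)"
      by (intro tendsto_intros)
    moreover have "eventually (\<lambda>t. sp - \<psi> p + \<mu> / 2 * (1 - t) * (norm (z - p))\<^sup>2 \<le> sz - \<psi> z) (at_right 0)"
      unfolding eventually_at_right_field using * by (intro exI[of _ 1]) auto
    ultimately have "sp - \<psi> p + \<mu> / 2 * (1 - 0) * (norm (z - p))\<^sup>2 \<le> sz - \<psi> z"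
      by (intro tendsto_upperbound[of _ _ "at_right (0::real)"]) auto
    then show ?thesis by (simp add: sz_def)
  qed
  then show ?thesis using pdom sp_def by blast
qed

section \<open>Proximal maps\<close>

lemma norm_convex_comb_sq:
  fixes a b :: "'a::real_inner"
  shows "(norm (t *\<^sub>R a + (1 - t) *\<^sub>R b))\<^sup>2
     = t * (norm a)\<^sup>2 + (1 - t) * (norm b)\<^sup>2 - t * (1 - t) * (norm (a - b))\<^sup>2"
  unfolding power2_norm_eq_inner
  by (simp add: inner_add_left inner_add_right inner_diff_left inner_diff_right inner_commute) algebra

text \<open>Divided by \<open>\<eta>\<close>, the proximal objective is an instance of the previous
  problem with modulus \<open>1 / \<eta>\<close>. Quadratic growth makes its minimizer unique, so
  the choice made by \<open>arg_min\<close> is the point found there.\<close>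

lemma prox_scaled:
  fixes r :: "'a::euclidean_space \<Rightarrow> ereal"
  assumes cc: "closed_convex_fun r" and x0: "x0 \<in> eff_dom r" and eta: "\<eta> > 0"
  defines "p \<equiv> \<lambda>u. prox (\<lambda>v. ereal \<eta> * r v) u"
  shows prox_in_dom: "p u \<in> eff_dom r"
    and prox_min: "\<And>z. z \<in> eff_dom r \<Longrightarrow> \<eta> * real_of_ereal (r (p u)) + 1/2 * (norm (p u - u))\<^sup>2 + 1/2 * (norm (z - p u))\<^sup>2
        \<le> \<eta> * real_of_ereal (r z) + 1/2 * (norm (z - u))\<^sup>2"
proof -
  define \<psi> where "\<psi> v = - (1 / (2 * \<eta>)) * (norm (v - u))\<^sup>2" for v
  have "strongly_concave (1 / \<eta>) \<psi>"
    unfolding strongly_concave_def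
  proof (intro allI ballI)
    fix y y' :: 'a and t :: real assume "t \<in> {0..1}"
    have e: "t *\<^sub>R y + (1 - t) *\<^sub>R y' - u = t *\<^sub>R (y - u) + (1 - t) *\<^sub>R (y' - u)" by (simp add: algebra_simps)
    have "\<psi> (t *\<^sub>R y + (1 - t) *\<^sub>R y') = t * \<psi> y + (1 - t) * \<psi> y' + 1 / \<eta> / 2 * t * (1 - t) * (norm (y - y'))\<^sup>2"
      unfolding \<psi>_def e norm_convex_comb_sq
      by (simp add: add_divide_distrib diff_divide_distrib algebra_simps)
    then show "\<psi> (t *\<^sub>R y + (1 - t) *\<^sub>R y') \<ge> t * \<psi> y + (1 - t) * \<psi> y' + 1 / \<eta> / 2 * t * (1 - t) * (norm (y - y'))\<^sup>2" by simp
  qed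
  moreover have "continuous_on UNIV \<psi>" unfolding \<psi>_def by (intro continuous_intros)
  moreover have "\<psi> z \<le> 0 + ((1 / \<eta>) *\<^sub>R u) \<bullet> z - (1 / \<eta>) / 2 * (norm z)\<^sup>2" for z
  proof -
    have "(norm (z - u))\<^sup>2 = (norm z)\<^sup>2 - 2 * (u \<bullet> z) + (norm u)\<^sup>2"
      by (simp add: power2_norm_eq_inner inner_diff_left inner_diff_right inner_commute)
    then show ?thesis using eta by (simp add: \<psi>_def field_simps)
  qed
  moreover have "1 / \<eta> > 0" using eta by simp
  ultimately obtain q where q: "q \<in> eff_dom r" and qmin: "\<And>z. z \<in> eff_dom r \<Longrightarrow>
     real_of_ereal (r q) - \<psi> q + (1 / \<eta>) / 2 * (norm (z - q))\<^sup>2 \<le> real_of_ereal (r z) - \<psi> z"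
    using strongly_concave_max_exists[OF cc x0] by metis
  have qmin': "\<eta> * real_of_ereal (r q) + 1/2 * (norm (q - u))\<^sup>2 + 1/2 * (norm (z - q))\<^sup>2
        \<le> \<eta> * real_of_ereal (r z) + 1/2 * (norm (z - u))\<^sup>2" if "z \<in> eff_dom r" for z
  proof -
    have e: "\<eta> * (a - - (1 / (2 * \<eta>)) * b + 1 / \<eta> / 2 * c) = \<eta> * a + 1/2 * b + 1/2 * c"
      "\<eta> * (a - - (1 / (2 * \<eta>)) * b) = \<eta> * a + 1/2 * b" for a b c
      using eta by (simp_all add: field_simps)
    show ?thesis
      using mult_left_mono[OF qmin[OF that], of \<eta>] eta unfolding \<psi>_def e by simp
  qed
  define F where "F v = ereal \<eta> * r v + ereal (1 / 2 * (norm (v - u))\<^sup>2)" for v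
  have Fdom: "F v = ereal (\<eta> * real_of_ereal (r v) + 1/2 * (norm (v - u))\<^sup>2)" if "v \<in> eff_dom r" for v
    unfolding F_def by (subst closed_convex_finite[OF cc that]) simp
  have Finf: "F v = \<infinity>" if "v \<notin> eff_dom r" for v
    using that eta by (simp add: F_def eff_dom_def)
  have "F q \<le> F z" for z
  proof (cases "z \<in> eff_dom r")
    case True
    have "0 \<le> 1/2 * (norm (z - q))\<^sup>2" by simp
    then show ?thesis using qmin'[OF True] by (simp only: Fdom[OF True] Fdom[OF q] ereal_less_eq)
  qed (simp add: Finf)
  then have "is_arg_min F (\<lambda>_. True) q" by (simp add: is_arg_min_linorder)
  then have "is_arg_min F (\<lambda>_. True) (p u)"
    unfolding p_def prox_def arg_min_def F_def[symmetric] by (rule someI)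
  then have le: "F (p u) \<le> F q" by (simp add: is_arg_min_linorder)
  have pd: "p u \<in> eff_dom r"
  proof (rule ccontr)
    assume nd: "p u \<notin> eff_dom r"
    from le show False unfolding Finf[OF nd] Fdom[OF q] by simp
  qed
  have "1/2 * (norm (p u - q))\<^sup>2 \<le> 0" using qmin'[OF pd] le unfolding Fdom[OF q] Fdom[OF pd] ereal_less_eq by linarith
  then have "p u = q" by simp
  then show "p u \<in> eff_dom r"
    "\<And>z. z \<in> eff_dom r \<Longrightarrow> \<eta> * real_of_ereal (r (p u)) + 1/2 * (norm (p u - u))\<^sup>2 + 1/2 * (norm (z - p u))\<^sup>2
        \<le> \<eta> * real_of_ereal (r z) + 1/2 * (norm (z - u))\<^sup>2"
    using q qmin' by simp_all
qed

text \<open>The three-point inequality: quadratic growth at the proximal point with the squares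
  expanded around \<open>y\<close>, so that \<open>v\<close> appears as the direction of the
  step.\<close>

lemma prox_step:
  fixes r :: "'a::euclidean_space \<Rightarrow> ereal"
  assumes cc: "closed_convex_fun r" and eta: "\<eta> > 0" and z: "z \<in> eff_dom r"
    and p: "p = prox (\<lambda>v. ereal \<eta> * r v) (y + \<eta> *\<^sub>R v)"
  shows "real_of_ereal (r p) \<le> real_of_ereal (r z) + v \<bullet> (p - z)
     + 1 / (2 * \<eta>) * ((norm (z - y))\<^sup>2 - (norm (z - p))\<^sup>2 - (norm (p - y))\<^sup>2)"
proof -
  have *: "(norm (w - (y + \<eta> *\<^sub>R v)))\<^sup>2 = (norm (w - y))\<^sup>2 - 2 * \<eta> * (v \<bullet> (w - y)) + (norm (\<eta> *\<^sub>R v))\<^sup>2" for w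
    by (simp add: power2_norm_eq_inner inner_diff_left inner_diff_right inner_add_left inner_add_right inner_commute algebra_simps
        flip: power2_eq_square)
  have "\<eta> * real_of_ereal (r p) + 1/2 * (norm (p - (y + \<eta> *\<^sub>R v)))\<^sup>2 + 1/2 * (norm (z - p))\<^sup>2
        \<le> \<eta> * real_of_ereal (r z) + 1/2 * (norm (z - (y + \<eta> *\<^sub>R v)))\<^sup>2"
    unfolding p by (rule prox_min[OF cc z eta z])
  then have "\<eta> * real_of_ereal (r p) \<le> \<eta> * real_of_ereal (r z) + \<eta> * (v \<bullet> (p - z))
     + 1 / 2 * ((norm (z - y))\<^sup>2 - (norm (z - p))\<^sup>2 - (norm (p - y))\<^sup>2)"
    unfolding * by (simp add: inner_diff_right algebra_simps)
  also have "\<dots> = \<eta> * (real_of_ereal (r z) + v \<bullet> (p - z)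
     + 1 / (2 * \<eta>) * ((norm (z - y))\<^sup>2 - (norm (z - p))\<^sup>2 - (norm (p - y))\<^sup>2))"
    using eta by (simp add: field_simps)
  finally show ?thesis using eta by simp
qed

text \<open>Each proximal point is tested in the growth inequality of the other. In the sum
  \<open>r\<close> cancels, which leaves firm nonexpansiveness.\<close>

lemma prox_nonexpansive:
  fixes r :: "'a::euclidean_space \<Rightarrow> ereal"
  assumes cc: "closed_convex_fun r" and x0: "x0 \<in> eff_dom r" and eta: "\<eta> > 0"
  shows "norm (prox (\<lambda>v. ereal \<eta> * r v) u - prox (\<lambda>v. ereal \<eta> * r v) u') \<le> norm (u - u')"
proof -
  define p where "p = prox (\<lambda>v. ereal \<eta> * r v) u"
  define p' where "p' = prox (\<lambda>v. ereal \<eta> * r v) u'"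
  have 1: "\<eta> * real_of_ereal (r p) + 1/2 * (norm (p - u))\<^sup>2 + 1/2 * (norm (p' - p))\<^sup>2
        \<le> \<eta> * real_of_ereal (r p') + 1/2 * (norm (p' - u))\<^sup>2"
    unfolding p_def by (rule prox_min[OF cc x0 eta]) (simp add: p'_def prox_in_dom[OF cc x0 eta])
  have 2: "\<eta> * real_of_ereal (r p') + 1/2 * (norm (p' - u'))\<^sup>2 + 1/2 * (norm (p - p'))\<^sup>2
        \<le> \<eta> * real_of_ereal (r p) + 1/2 * (norm (p - u'))\<^sup>2"
    unfolding p'_def by (rule prox_min[OF cc x0 eta]) (simp add: p_def prox_in_dom[OF cc x0 eta])
  have "(norm (p' - u))\<^sup>2 + (norm (p - u'))\<^sup>2 - (norm (p - u))\<^sup>2 - (norm (p' - u'))\<^sup>2 = 2 * ((p - p') \<bullet> (u - u'))"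
    by (simp add: power2_norm_eq_inner inner_diff_left inner_diff_right inner_commute)
  then have "(norm (p - p'))\<^sup>2 \<le> (p - p') \<bullet> (u - u')" using 1 2 by (simp add: norm_minus_commute)
  also have "\<dots> \<le> norm (p - p') * norm (u - u')" by (rule norm_cauchy_schwarz)
  finally have "norm (p - p') * norm (p - p') \<le> norm (p - p') * norm (u - u')" by (simp add: power2_eq_square)
  then show ?thesis unfolding p_def[symmetric] p'_def[symmetric]
    by (cases "norm (p - p') = 0") auto
qed

lemma continuous_on_prox:
  fixes r :: "'a::euclidean_space \<Rightarrow> ereal"
  assumes "closed_convex_fun r" "x0 \<in> eff_dom r" "\<eta> > 0"
  shows "continuous_on UNIV (prox (\<lambda>v. ereal \<eta> * r v))"
proof (rule lipschitz_on_continuous_on[of 1])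
  show "1-lipschitz_on UNIV (prox (\<lambda>v. ereal \<eta> * r v))"
    using prox_nonexpansive[OF assms] by (intro lipschitz_onI) (auto simp: dist_norm)
qed

section \<open>Rows, averages and the mixing matrix\<close>

lemma norm_rows_sq: "(norm X)\<^sup>2 = (\<Sum>i\<in>UNIV. (norm (X $ i))\<^sup>2)"
  for X :: "'a::real_normed_vector^'m::finite"
  by (simp add: norm_vec_def L2_set_def real_sqrt_pow2 sum_nonneg)

lemma const_rows_nth [simp]: "const_rows x $ i = x"
  by (simp add: const_rows_def)

lemma row_avg_const [simp]: "row_avg (const_rows x :: 'a::real_vector^'m::finite) = x"
  by (simp add: row_avg_def sum_constant_scaleR)

lemma row_avg_add: "row_avg (X + Y) = row_avg X + row_avg Y"
  and row_avg_diff: "row_avg (X - Y) = row_avg X - row_avg Y"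
  and row_avg_scaleR: "row_avg (c *\<^sub>R X) = c *\<^sub>R row_avg X"
  by (simp_all add: row_avg_def sum.distrib sum_subtractf scaleR_sum_right scaleR_add_right scaleR_diff_right ac_simps)

lemma row_avg_perp [simp]: "row_avg (perp X) = 0"
  by (simp add: perp_def row_avg_diff)

lemma perp_diff: "perp (X - Y) = perp X - perp Y"
  by (simp add: perp_def row_avg_diff vec_eq_iff)

lemma perp_add: "perp (X + Y) = perp X + perp Y"
  by (simp add: perp_def row_avg_add vec_eq_iff)

lemma perp_scaleR: "perp (c *\<^sub>R X) = c *\<^sub>R perp X"
  by (simp add: perp_def row_avg_scaleR vec_eq_iff scaleR_diff_right)

lemma perp_const [simp]: "perp (const_rows x :: 'a::real_vector^'m::finite) = 0"
  by (simp add: perp_def)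

lemma norm_const_rows_sq: "(norm (const_rows x :: 'a::real_normed_vector^'m::finite))\<^sup>2 = real CARD('m) * (norm x)\<^sup>2"
  by (simp add: norm_rows_sq)

lemma inner_const_rows: "const_rows x \<bullet> Y = real CARD('m) * (x \<bullet> row_avg Y)" for Y :: "'a::real_inner^'m::finite"
  by (simp add: inner_vec_def row_avg_def inner_sum_right)

text \<open>Pythagoras: constant rows are orthogonal to matrices with average zero.\<close>

lemma norm_sq_avg_perp: "(norm X)\<^sup>2 = real CARD('m) * (norm (row_avg X))\<^sup>2 + (norm (perp X))\<^sup>2"
  for X :: "'a::real_inner^'m::finite"
proof -
  have X: "X = const_rows (row_avg X) + perp X" by (simp add: perp_def)
  have 0: "const_rows (row_avg X) \<bullet> perp X = 0" by (simp add: inner_const_rows)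
  have "(norm X)\<^sup>2 = (const_rows (row_avg X) + perp X) \<bullet> (const_rows (row_avg X) + perp X)"
    using X by (metis power2_norm_eq_inner)
  also have "\<dots> = (norm (const_rows (row_avg X) :: 'a^'m))\<^sup>2 + (norm (perp X))\<^sup>2"
    using 0 by (simp add: power2_norm_eq_inner inner_add_left inner_add_right inner_commute)
  finally show ?thesis by (simp add: norm_const_rows_sq)
qed

text \<open>The row average is the best approximation by constant rows. Hence consensus errors can
  be bounded by comparison with any convenient constant.\<close>

lemma norm_perp_le_norm_diff: "norm (perp X) \<le> norm (X - const_rows c)" for X :: "'a::real_inner^'m::finite"
proof -
  have "perp (X - const_rows c) = perp X" by (simp add: perp_diff)
  then have "(norm (perp X))\<^sup>2 \<le> (norm (X - const_rows c))\<^sup>2"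
    using norm_sq_avg_perp[of "X - const_rows c"] by simp
  then show ?thesis by (rule power2_le_imp_le) simp
qed

lemma norm_row_avg_sq_le: "real CARD('m) * (norm (row_avg X))\<^sup>2 \<le> (norm X)\<^sup>2" for X :: "'a::real_inner^'m::finite"
  using norm_sq_avg_perp[of X] by simp

lemma norm_perp_le: "norm (perp X) \<le> norm X" for X :: "'a::real_inner^'m::finite"
  using norm_perp_le_norm_diff[of X 0] by (simp add: const_rows_def zero_vec_def[symmetric])

lemma matrix_mult_row: "(A ** X) $ i = (\<Sum>k\<in>UNIV. A $ i $ k *\<^sub>R X $ k)"
  for A :: "real^'m^'n" and X :: "real^'p^'m"
  by (simp add: matrix_matrix_mult_def vec_eq_iff)

lemma matrix_diff_mult: "(A - B) ** X = A ** X - B ** X" for A B :: "real^'m^'n" and X :: "real^'p^'m"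
  by (simp add: matrix_mult_row vec_eq_iff sum_subtractf algebra_simps)

lemma matrix_mult_diff: "A ** (X - Y) = A ** X - A ** Y" for A :: "real^'m^'n" and X :: "real^'p^'m"
  by (simp add: matrix_mult_row vec_eq_iff sum_subtractf algebra_simps)

lemma matrix_mult_add: "A ** (X + Y) = A ** X + A ** Y" for A :: "real^'m^'n" and X :: "real^'p^'m"
  by (simp add: matrix_mult_row vec_eq_iff sum.distrib algebra_simps)

lemma matrix_mult_scaleR: "A ** (c *\<^sub>R X) = c *\<^sub>R (A ** X)" for A :: "real^'m^'n" and X :: "real^'p^'m"
  by (simp add: matrix_mult_row vec_eq_iff sum_distrib_left ac_simps)

text \<open>Left multiplication acts column by column, and the Frobenius norm can be summed over
  columns as well as over rows.\<close>

lemma norm_matrix_mult_le: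
  fixes A :: "real^'m::finite^'n::finite" and X :: "real^'p::finite^'m"
  shows "norm (A ** X) \<le> onorm (\<lambda>v. A *v v) * norm X"
proof -
  have sq: "(norm Z)\<^sup>2 = (\<Sum>j\<in>UNIV. (norm (column j Z))\<^sup>2)" for Z :: "real^'p^'k::finite"
    unfolding norm_rows_sq by (subst sum.swap) (simp add: column_def)
  have col: "column j (A ** X) = A *v column j X" for j
    by (simp add: column_def matrix_matrix_mult_def matrix_vector_mult_def)
  have on: "0 \<le> onorm (\<lambda>v. A *v v)" by (rule onorm_pos_le) (simp add: matrix_vector_mul_bounded_linear)
  have "(norm (A ** X))\<^sup>2 = (\<Sum>j\<in>UNIV. (norm (A *v column j X))\<^sup>2)" by (simp add: sq col)
  also have "\<dots> \<le> (\<Sum>j\<in>UNIV. (onorm (\<lambda>v. A *v v) * norm (column j X))\<^sup>2)"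
    by (intro sum_mono power_mono onorm) (simp_all add: matrix_vector_mul_bounded_linear)
  also have "\<dots> = (onorm (\<lambda>v. A *v v) * norm X)\<^sup>2"
    by (simp add: power_mult_distrib sq[of X] sum_distrib_left)
  finally show ?thesis by (rule power2_le_imp_le) (simp add: on)
qed

lemma inner_matrix_mult: "U \<bullet> (A ** Y) = (transpose A ** U) \<bullet> Y"
  for A :: "real^'m::finite^'n::finite" and Y :: "real^'p::finite^'m"
proof -
  have "U \<bullet> (A ** Y) = (\<Sum>i\<in>UNIV. \<Sum>k\<in>UNIV. A $ i $ k * (U $ i \<bullet> Y $ k))"
    by (simp add: inner_vec_def[of U] matrix_mult_row inner_sum_right)
  also have "\<dots> = (\<Sum>k\<in>UNIV. \<Sum>i\<in>UNIV. A $ i $ k * (U $ i \<bullet> Y $ k))" by (rule sum.swap)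
  also have "\<dots> = (transpose A ** U) \<bullet> Y"
    unfolding inner_vec_def[of "transpose A ** U"] matrix_mult_row by (simp add: inner_sum_left transpose_def)
  finally show ?thesis .
qed

lemma norm_transpose_mult_le:
  fixes A :: "real^'m::finite^'n::finite" and U :: "real^'p::finite^'n"
  assumes "onorm (\<lambda>v. A *v v) \<le> c"
  shows "norm (transpose A ** U) \<le> c * norm U"
proof -
  let ?V = "transpose A ** U"
  have c: "0 \<le> c" using onorm_pos_le[of "\<lambda>v. A *v v"] assms by (simp add: matrix_vector_mul_bounded_linear)
  have "norm ?V * norm ?V = U \<bullet> (A ** ?V)"
    by (simp add: inner_matrix_mult power2_eq_square[symmetric] power2_norm_eq_inner)
  also have "\<dots> \<le> norm U * norm (A ** ?V)" by (rule norm_cauchy_schwarz)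
  also have "\<dots> \<le> norm U * (c * norm ?V)"
    by (intro mult_left_mono order_trans[OF norm_matrix_mult_le] mult_right_mono assms) auto
  finally have "norm ?V * norm ?V \<le> (c * norm U) * norm ?V" by (simp add: ac_simps)
  then show ?thesis using c by (cases "norm ?V = 0") auto
qed

section \<open>The mixing matrix\<close>

locale mixing =
  fixes W :: "real^'m::finite^'m" and \<rho> :: real
  assumes W_null: "{v. (W - mat 1) *v v = 0} = span {(1 :: real^'m)}"
    and W_ones: "transpose W *v (1 :: real^'m) = 1"
    and rho_def: "\<rho> = onorm (\<lambda>v. (W - (\<chi> i j. 1 / real CARD('m))) *v v)"
    and rho_less: "\<rho> < 1"
    and W_norm: "onorm (\<lambda>v. (W - mat 1) *v v) \<le> 2"
begin

lemma rho_nonneg: "0 \<le> \<rho>"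
  unfolding rho_def by (rule onorm_pos_le) (simp add: matrix_vector_mul_bounded_linear)

lemma W_row_sum: "(\<Sum>k\<in>UNIV. W $ i $ k) = 1"
proof -
  have "(1 :: real^'m) \<in> {v. (W - mat 1) *v v = 0}" unfolding W_null by (simp add: span_base)
  then have "W *v 1 = 1" by (simp add: matrix_vector_mult_diff_rdistrib)
  then show ?thesis by (simp add: matrix_vector_mult_def vec_eq_iff)
qed

lemma W_col_sum: "(\<Sum>i\<in>UNIV. W $ i $ k) = 1"
  using W_ones by (simp add: matrix_vector_mult_def vec_eq_iff transpose_def)

lemma W_const_rows [simp]: "W ** (const_rows x :: real^'p::finite^'m) = const_rows x"
  by (simp add: vec_eq_iff matrix_mult_row scaleR_left.sum[symmetric] W_row_sum sum_distrib_right[symmetric])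

lemma row_avg_W [simp]: "row_avg (W ** X) = row_avg (X :: real^'p::finite^'m)"
proof -
  have "(\<Sum>i\<in>UNIV. (W ** X) $ i) = (\<Sum>k\<in>UNIV. \<Sum>i\<in>UNIV. W $ i $ k *\<^sub>R X $ k)"
    unfolding matrix_mult_row by (rule sum.swap)
  also have "\<dots> = (\<Sum>k\<in>UNIV. X $ k)"
    by (simp add: scaleR_left.sum[symmetric] W_col_sum)
  finally show ?thesis by (simp add: row_avg_def)
qed

text \<open>The averaging matrix annihilates matrices with average zero, so there \<open>W\<close>
  acts as the matrix whose norm is \<open>\<rho>\<close>; and \<open>W\<close> commutes with taking
  the perpendicular part.\<close>

lemma norm_perp_W_le: "norm (perp (W ** X)) \<le> \<rho> * norm (perp (X :: real^'p::finite^'m))"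
proof -
  let ?J = "(\<chi> i j. 1 / real CARD('m)) :: real^'m^'m"
  have "?J ** perp X = const_rows (row_avg (perp X))"
    by (simp add: vec_eq_iff matrix_mult_row row_avg_def sum_distrib_left)
  then have "(W - ?J) ** perp X = W ** perp X"
    by (simp add: matrix_diff_mult const_rows_def vec_eq_iff)
  also have "\<dots> = perp (W ** X)"
    by (simp add: perp_def matrix_mult_diff)
  finally show ?thesis using norm_matrix_mult_le[of "W - ?J" "perp X"] by (simp add: rho_def)
qed

lemma norm_W_minus_id_le: "norm ((W - mat 1) ** X) \<le> 2 * norm (X :: real^'p::finite^'m)"
  by (rule order_trans[OF norm_matrix_mult_le mult_right_mono[OF W_norm]]) simp

lemma norm_W_minus_id_transpose_le: "norm (transpose (W - mat 1) ** X) \<le> 2 * norm (X :: real^'p::finite^'m)"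
  by (rule norm_transpose_mult_le[OF W_norm])

end

section \<open>The inner maximization\<close>

locale minimax = mixing W \<rho> for W :: "real^'m::finite^'m" and \<rho> +
  fixes f :: "'m \<Rightarrow> real^'p::finite \<Rightarrow> real^'q::finite \<Rightarrow> real"
    and h :: "real^'q \<Rightarrow> ereal" and \<mu> L :: real and y0 :: "real^'q"
  assumes h_cc: "closed_convex_fun h" and mu_pos: "\<mu> > 0"
    and f_sc: "\<And>i x. strongly_concave \<mu> (f i x)"
    and f_smooth: "\<And>i. smooth_fun L (\<lambda>(x, y). f i x y)"
    and y0_dom: "y0 \<in> eff_dom h"
begin

definition gf where "gf i x y = grad (\<lambda>(x, y). f i x y) (x, y)"
definition \<kappa> where "\<kappa> = L / \<mu>"
definition hr where "hr y = real_of_ereal (h y)"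

lemma L_nonneg: "0 \<le> L" using smooth_nonneg[OF f_smooth] .

lemma mm_pos: "real CARD('m) > 0" by simp

lemma gf_lipschitz: "norm (gf i x y - gf i x' y') \<le> L * norm ((x, y) - (x', y'))"
  unfolding gf_def by (rule smooth_grad_lipschitz[OF f_smooth])

lemma f_quad: "\<bar>f i x' y' - f i x y - gf i x y \<bullet> ((x', y') - (x, y))\<bar> \<le> L / 2 * (norm ((x', y') - (x, y)))\<^sup>2"
  using smooth_quadratic_bound[OF f_smooth, of i "(x', y')" "(x, y)"] by (simp add: gf_def)

lemma f_quad_x: "\<bar>f i x' y - f i x y - fst (gf i x y) \<bullet> (x' - x)\<bar> \<le> L / 2 * (norm (x' - x))\<^sup>2"
  using f_quad[of i x' y x y] by (simp add: inner_prod_def norm_Pair)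

lemma f_quad_y: "\<bar>f i x y' - f i x y - snd (gf i x y) \<bullet> (y' - y)\<bar> \<le> L / 2 * (norm (y' - y))\<^sup>2"
  using f_quad[of i x y' x y] by (simp add: inner_prod_def norm_Pair)

lemma f_GDERIV_x: "GDERIV (\<lambda>x. f i x y) x :> fst (gf i x y)"
  by (rule GDERIV_of_quadratic_bound[OF f_quad_x])

lemma f_GDERIV_y: "GDERIV (f i x) y :> snd (gf i x y)"
  by (rule GDERIV_of_quadratic_bound[OF f_quad_y])

lemma f_cont_y: "continuous_on UNIV (f i x)"
proof -
  have "f i x differentiable (at y)" for y
    using f_GDERIV_y[of i x y] unfolding gderiv_def differentiable_def by blast
  then show ?thesis
    by (simp add: continuous_at_imp_continuous_on differentiable_imp_continuous_within)
qed

lemma f_upper: "f i x z \<le> f i x y + snd (gf i x y) \<bullet> (z - y) - \<mu> / 2 * (norm (z - y))\<^sup>2"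
  by (rule strongly_concave_upper[OF f_sc f_GDERIV_y])

text \<open>Along a unit vector the lower quadratic model given by smoothness lies below the upper
  one given by strong concavity.\<close>

lemma mu_le_L: "\<mu> \<le> L"
proof -
  fix i :: 'm and x :: "real^'p"
  obtain e :: "real^'q" where e: "e \<in> Basis" using nonempty_Basis by blast
  have "f i x 0 + snd (gf i x 0) \<bullet> e - L / 2 * (norm e)\<^sup>2 \<le> f i x e"
    using f_quad_y[of i x e 0] unfolding abs_le_iff by simp
  moreover have "f i x e \<le> f i x 0 + snd (gf i x 0) \<bullet> e - \<mu> / 2 * (norm e)\<^sup>2"
    using f_upper[of i x e 0] by simp
  ultimately show ?thesis using norm_Basis[OF e] by simp
qed

lemma L_pos: "0 < L" using mu_pos mu_le_L by linarith
lemma kappa_ge1: "1 \<le> \<kappa>" using mu_pos mu_le_L by (simp add: \<kappa>_def)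

lemma norm_fst_gf_diff: "norm (fst (gf i x y) - fst (gf i x y')) \<le> L * norm (y - y')"
proof -
  have "norm (fst (gf i x y - gf i x y')) \<le> norm (gf i x y - gf i x y')"
    by (metis norm_fst_le prod.collapse)
  also have "\<dots> \<le> L * norm ((x, y) - (x, y'))" by (rule gf_lipschitz)
  finally show ?thesis by (simp add: norm_Pair)
qed

text \<open>A second difference bounded without second derivatives: the mean value theorem in
  \<open>x\<close> is applied to the difference of \<open>f\<close> at \<open>y'\<close> and
  \<open>y\<close>, whose gradient is at most \<open>L * norm (y' - y)\<close>.\<close>

lemma f_mixed: "\<bar>f i x' y' - f i x y' - f i x' y + f i x y\<bar> \<le> L * norm (x' - x) * norm (y' - y)"
proof -
  have "GDERIV (\<lambda>x. f i x y' - f i x y) z :> fst (gf i z y') - fst (gf i z y)" for z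
    by (intro GDERIV_diff f_GDERIV_x)
  then obtain t where "f i (x + (x' - x)) y' - f i (x + (x' - x)) y - (f i x y' - f i x y)
      = (x' - x) \<bullet> (fst (gf i (x + t *\<^sub>R (x' - x)) y') - fst (gf i (x + t *\<^sub>R (x' - x)) y))"
    using mean_value_line[of "\<lambda>x. f i x y' - f i x y" "\<lambda>z. fst (gf i z y') - fst (gf i z y)" x "x' - x"] by metis
  then have e: "f i x' y' - f i x y' - f i x' y + f i x y
      = (x' - x) \<bullet> (fst (gf i (x + t *\<^sub>R (x' - x)) y') - fst (gf i (x + t *\<^sub>R (x' - x)) y))" by simp
  have "\<bar>(x' - x) \<bullet> (fst (gf i z y') - fst (gf i z y))\<bar> \<le> norm (x' - x) * (L * norm (y' - y))" for z
    by (rule order_trans[OF Cauchy_Schwarz_ineq2]) (intro mult_left_mono norm_fst_gf_diff norm_ge_zero)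
  then show ?thesis unfolding e by (simp only: mult.assoc mult.left_commute[of L])
qed

section \<open>Maximizers row by row and the values of the inner problem\<close>

definition ystar where
  "ystar i x c = (SOME p. p \<in> eff_dom h \<and> (\<forall>z\<in>eff_dom h.
     hr p - (f i x p - c \<bullet> p) + \<mu> / 2 * (norm (z - p))\<^sup>2 \<le> hr z - (f i x z - c \<bullet> z)))"

lemma ystar_ex: "\<exists>p. p \<in> eff_dom h \<and> (\<forall>z\<in>eff_dom h.
     hr p - (f i x p - c \<bullet> p) + \<mu> / 2 * (norm (z - p))\<^sup>2 \<le> hr z - (f i x z - c \<bullet> z))"
proof -
  let ?\<psi> = "\<lambda>y. f i x y - c \<bullet> y"
  have sc: "strongly_concave \<mu> ?\<psi>"
    using f_sc[of i x] by (simp add: strongly_concave_def inner_add_right algebra_simps)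
  have cont: "continuous_on UNIV ?\<psi>" by (intro continuous_intros f_cont_y)
  have ub: "?\<psi> z \<le> f i x 0 + (snd (gf i x 0) - c) \<bullet> z - \<mu> / 2 * (norm z)\<^sup>2" for z
    using f_upper[of i x z 0] by (simp add: inner_diff_left)
  show ?thesis unfolding hr_def by (rule strongly_concave_max_exists[OF h_cc y0_dom mu_pos sc cont ub])
qed

lemma ystar_dom: "ystar i x c \<in> eff_dom h"
  and ystar_max: "z \<in> eff_dom h \<Longrightarrow> f i x z - c \<bullet> z - hr z + \<mu> / 2 * (norm (z - ystar i x c))\<^sup>2
     \<le> f i x (ystar i x c) - c \<bullet> ystar i x c - hr (ystar i x c)"
  using someI_ex[OF ystar_ex[of i x c]] unfolding ystar_def[symmetric] by (auto simp: algebra_simps)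

definition domY :: "(real^'q^'m) set" where "domY = {Y. \<forall>i. Y $ i \<in> eff_dom h}"
text \<open>\<open>H\<close> is \<open>m \<Phi>\<close> on the set \<open>domY\<close> where it is finite; it splits into one strongly concave problem per row,
  with \<open>cm \<Lambda>\<close> holding the linear terms.\<close>

definition cm :: "real^'q^'m \<Rightarrow> real^'q^'m" where "cm \<Lambda> = (L * sqrt (real CARD('m)) / 2) *\<^sub>R (transpose (W - mat 1) ** \<Lambda>)"
definition H :: "real^'p^'m \<Rightarrow> real^'q^'m \<Rightarrow> real^'q^'m \<Rightarrow> real" where
  "H X \<Lambda> Y = (\<Sum>i\<in>UNIV. f i (X $ i) (Y $ i) - hr (Y $ i)) - cm \<Lambda> \<bullet> Y"
definition Ystar :: "real^'p^'m \<Rightarrow> real^'q^'m \<Rightarrow> real^'q^'m" where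
  "Ystar X \<Lambda> = (\<chi> i. ystar i (X $ i) (cm \<Lambda> $ i))"

lemma H_rows: "H X \<Lambda> Y = (\<Sum>i\<in>UNIV. f i (X $ i) (Y $ i) - cm \<Lambda> $ i \<bullet> Y $ i - hr (Y $ i))"
  by (simp add: H_def inner_vec_def sum_subtractf)

lemma Ystar_dom: "Ystar X \<Lambda> \<in> domY"
  by (simp add: Ystar_def domY_def ystar_dom)

lemma Ystar_max:
  assumes "Y \<in> domY"
  shows "H X \<Lambda> Y + \<mu> / 2 * (norm (Y - Ystar X \<Lambda>))\<^sup>2 \<le> H X \<Lambda> (Ystar X \<Lambda>)"
proof -
  have "H X \<Lambda> Y + \<mu> / 2 * (norm (Y - Ystar X \<Lambda>))\<^sup>2
      = (\<Sum>i\<in>UNIV. f i (X $ i) (Y $ i) - cm \<Lambda> $ i \<bullet> Y $ i - hr (Y $ i)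
           + \<mu> / 2 * (norm (Y $ i - Ystar X \<Lambda> $ i))\<^sup>2)"
    by (simp add: H_rows norm_rows_sq sum.distrib sum_distrib_left)
  also have "\<dots> \<le> H X \<Lambda> (Ystar X \<Lambda>)"
    unfolding H_rows Ystar_def using assms
    by (intro sum_mono) (use ystar_max in \<open>simp add: domY_def\<close>)
  finally show ?thesis .
qed

lemma Ystar_max': "Y \<in> domY \<Longrightarrow> H X \<Lambda> Y \<le> H X \<Lambda> (Ystar X \<Lambda>)"
  by (rule order_trans[OF _ Ystar_max]) (use mu_pos in auto)

lemma inner_cm: "cm \<Lambda> \<bullet> Y = L * sqrt (real CARD('m)) / 2 * (\<Lambda> \<bullet> ((W - mat 1) ** Y))"
  by (simp add: cm_def inner_matrix_mult)

text \<open>Passing from \<open>Phi_fun\<close> to \<open>H\<close> multiplies by \<open>m\<close>,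
  which turns the coupling factor of the first into the factor of \<open>cm\<close>.\<close>

lemma L_over_sqrt: "L / (2 * sqrt (real CARD('m))) * a = (L * sqrt (real CARD('m)) / 2 * a) / real CARD('m)"
proof -
  define s where "s = sqrt (real CARD('m))"
  have s: "s > 0" "real CARD('m) = s * s" by (simp_all add: s_def)
  show ?thesis unfolding s_def[symmetric] s(2) using s(1) by (simp add: field_simps)
qed

lemma Phi_dom: "Y \<in> domY \<Longrightarrow> Phi_fun f h W L X \<Lambda> Y = ereal (H X \<Lambda> Y / real CARD('m))"
proof -
  assume Y: "Y \<in> domY"
  have "ereal (f i (X $ i) (Y $ i)) - h (Y $ i) = ereal (f i (X $ i) (Y $ i) - hr (Y $ i))" for i
    using closed_convex_finite[OF h_cc, of "Y $ i"] Y unfolding domY_def hr_def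
    by (metis (mono_tags, lifting) ereal_minus(1) mem_Collect_eq)
  then show ?thesis unfolding Phi_fun_def L_over_sqrt
    by (simp add: H_def inner_cm diff_divide_distrib)
qed

lemma Phi_not_dom: "Y \<notin> domY \<Longrightarrow> Phi_fun f h W L X \<Lambda> Y = -\<infinity>"
proof -
  assume "Y \<notin> domY"
  then obtain i where i: "h (Y $ i) = \<infinity>" by (auto simp: domY_def eff_dom_def)
  define F where "F j = ereal (f j (X $ j) (Y $ j)) - h (Y $ j)" for j
  have h: "h y \<noteq> -\<infinity>" for y using h_cc by (simp add: closed_convex_fun_def)
  \<comment> \<open>No summand is infinite from above, so one summand equal to minus infinity
    decides the extended sum.\<close>
  have "F j \<noteq> \<infinity>" for j unfolding F_def using h[of "Y $ j"] by (cases "h (Y $ j)") auto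
  then have 1: "(\<Sum>j\<in>UNIV - {i}. F j) \<noteq> \<infinity>" by (simp add: sum_Pinfty)
  have "(\<Sum>j\<in>UNIV. F j) = F i + (\<Sum>j\<in>UNIV - {i}. F j)" by (simp add: sum.remove)
  also have "F i = -\<infinity>" by (simp add: F_def i)
  also have "-\<infinity> + (\<Sum>j\<in>UNIV - {i}. F j) = -\<infinity>" using 1 by (cases "\<Sum>j\<in>UNIV - {i}. F j") auto
  finally show ?thesis by (simp add: Phi_fun_def F_def)
qed

lemma Phi_le_star: "Phi_fun f h W L X \<Lambda> Y \<le> ereal (H X \<Lambda> (Ystar X \<Lambda>) / real CARD('m))"
  by (cases "Y \<in> domY") (simp_all add: Phi_dom Phi_not_dom Ystar_max' divide_right_mono)

lemma Q_eq: "Q_fun f h W L X \<Lambda> = ereal (H X \<Lambda> (Ystar X \<Lambda>) / real CARD('m))"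
  unfolding Q_fun_def
proof (rule antisym)
  show "(SUP Y. Phi_fun f h W L X \<Lambda> Y) \<le> ereal (H X \<Lambda> (Ystar X \<Lambda>) / real CARD('m))"
    by (rule SUP_least) (rule Phi_le_star)
  show "ereal (H X \<Lambda> (Ystar X \<Lambda>) / real CARD('m)) \<le> (SUP Y. Phi_fun f h W L X \<Lambda> Y)"
    by (rule SUP_upper2[of "Ystar X \<Lambda>"]) (simp_all add: Phi_dom Ystar_dom)
qed

lemma Y_argmax_eq: "Y_argmax f h W L X \<Lambda> = Ystar X \<Lambda>"
proof -
  let ?A = "is_arg_max (Phi_fun f h W L X \<Lambda>) (\<lambda>_. True)"
  have "?A (Ystar X \<Lambda>)" using Phi_le_star[of X \<Lambda>] by (simp add: is_arg_max_linorder Phi_dom Ystar_dom)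
  then have "?A (Y_argmax f h W L X \<Lambda>)" unfolding Y_argmax_def arg_max_def by (rule someI)
  then have le: "ereal (H X \<Lambda> (Ystar X \<Lambda>) / real CARD('m)) \<le> Phi_fun f h W L X \<Lambda> (Y_argmax f h W L X \<Lambda>)"
    by (simp add: is_arg_max_linorder Phi_dom[OF Ystar_dom, symmetric])
  then have d: "Y_argmax f h W L X \<Lambda> \<in> domY" using Phi_not_dom by fastforce
  from le have "H X \<Lambda> (Ystar X \<Lambda>) \<le> H X \<Lambda> (Y_argmax f h W L X \<Lambda>)"
    by (simp add: Phi_dom[OF d] divide_le_cancel)
  then have "\<mu> / 2 * (norm (Y_argmax f h W L X \<Lambda> - Ystar X \<Lambda>))\<^sup>2 \<le> 0" using Ystar_max[OF d, of X \<Lambda>] by linarith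
  then have "(norm (Y_argmax f h W L X \<Lambda> - Ystar X \<Lambda>))\<^sup>2 \<le> 0" using mu_pos by (simp add: mult_le_0_iff)
  then show ?thesis by simp
qed

section \<open>Danskin's theorem for the maximum function\<close>

definition PP where "PP x \<Lambda> = H (const_rows x) \<Lambda> (Ystar (const_rows x) \<Lambda>) / real CARD('m)"

lemma P_eq: "P_fun f h W L x \<Lambda> = ereal (PP x \<Lambda>)"
  using Q_eq[of "const_rows x" \<Lambda>] by (simp add: P_fun_def Q_fun_def PP_def)

lemma cm_diff: "cm \<Lambda>' - cm \<Lambda> = cm (\<Lambda>' - \<Lambda>)"
  by (simp add: cm_def matrix_mult_diff scaleR_diff_right)

lemma norm_cm_le: "norm (cm \<Lambda>) \<le> L * sqrt (real CARD('m)) * norm \<Lambda>"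
  using mult_left_mono[OF norm_W_minus_id_transpose_le[of \<Lambda>], of "L * sqrt (real CARD('m)) / 2"] L_nonneg
  by (simp add: cm_def)

lemma H_diff: "H X' \<Lambda>' Y - H X \<Lambda> Y = (\<Sum>i\<in>UNIV. f i (X' $ i) (Y $ i) - f i (X $ i) (Y $ i)) - cm (\<Lambda>' - \<Lambda>) \<bullet> Y"
  by (simp add: H_def sum_subtractf cm_diff[symmetric] inner_diff_left)

text \<open>The mixed difference yields both the Lipschitz bound for the maximizer and, without second-order
  terms, the drift of the duality gap.\<close>

lemma H_mixed: "\<bar>(H X' \<Lambda>' Y' - H X \<Lambda> Y') - (H X' \<Lambda>' Y - H X \<Lambda> Y)\<bar>
   \<le> L * norm (Y' - Y) * (norm (X' - X) + sqrt (real CARD('m)) * norm (\<Lambda>' - \<Lambda>))"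
proof -
  have "\<bar>(H X' \<Lambda>' Y' - H X \<Lambda> Y') - (H X' \<Lambda>' Y - H X \<Lambda> Y)\<bar>
    = \<bar>(\<Sum>i\<in>UNIV. f i (X' $ i) (Y' $ i) - f i (X $ i) (Y' $ i) - f i (X' $ i) (Y $ i) + f i (X $ i) (Y $ i))
        - cm (\<Lambda>' - \<Lambda>) \<bullet> (Y' - Y)\<bar>"
    unfolding H_diff by (simp add: sum_subtractf sum.distrib inner_diff_right)
  also have "\<dots> \<le> (\<Sum>i\<in>UNIV. L * norm ((X' - X) $ i) * norm ((Y' - Y) $ i)) + norm (cm (\<Lambda>' - \<Lambda>)) * norm (Y' - Y)"
    by (rule order_trans[OF abs_triangle_ineq4], rule add_mono[OF order_trans[OF sum_abs sum_mono] Cauchy_Schwarz_ineq2])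
       (simp add: f_mixed)
  also have "(\<Sum>i\<in>UNIV. L * norm ((X' - X) $ i) * norm ((Y' - Y) $ i)) \<le> L * (norm (X' - X) * norm (Y' - Y))"
    using mult_left_mono[OF L2_set_mult_ineq[of "\<lambda>i. norm ((X' - X) $ i)" "\<lambda>i. norm ((Y' - Y) $ i)" UNIV] L_nonneg]
    by (simp add: norm_vec_def sum_distrib_left mult.assoc)
  also have "norm (cm (\<Lambda>' - \<Lambda>)) * norm (Y' - Y) \<le> (L * sqrt (real CARD('m)) * norm (\<Lambda>' - \<Lambda>)) * norm (Y' - Y)"
    by (intro mult_right_mono norm_cm_le) simp
  finally show ?thesis by (simp add: algebra_simps)
qed

text \<open>Each maximizer is tested in the growth inequality of the other; the values of
  \<open>H\<close> then combine to its mixed difference, and \<open>H_mixed\<close> leaves one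
  factor of the distance to cancel.\<close>

lemma Ystar_lipschitz:
  "norm (Ystar X' \<Lambda>' - Ystar X \<Lambda>) \<le> \<kappa> * (norm (X' - X) + sqrt (real CARD('m)) * norm (\<Lambda>' - \<Lambda>))"
proof -
  let ?Y = "Ystar X \<Lambda>" and ?Y' = "Ystar X' \<Lambda>'"
  have "H X \<Lambda> ?Y' + \<mu> / 2 * (norm (?Y' - ?Y))\<^sup>2 \<le> H X \<Lambda> ?Y" by (rule Ystar_max[OF Ystar_dom])
  moreover have "H X' \<Lambda>' ?Y + \<mu> / 2 * (norm (?Y - ?Y'))\<^sup>2 \<le> H X' \<Lambda>' ?Y'" by (rule Ystar_max[OF Ystar_dom])
  ultimately have "\<mu> * (norm (?Y' - ?Y))\<^sup>2 \<le> (H X' \<Lambda>' ?Y' - H X \<Lambda> ?Y') - (H X' \<Lambda>' ?Y - H X \<Lambda> ?Y)"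
    by (simp add: norm_minus_commute)
  also have "\<dots> \<le> L * norm (?Y' - ?Y) * (norm (X' - X) + sqrt (real CARD('m)) * norm (\<Lambda>' - \<Lambda>))"
    by (rule order_trans[OF abs_ge_self H_mixed])
  finally have "norm (?Y' - ?Y) * (\<mu> * norm (?Y' - ?Y)) \<le> norm (?Y' - ?Y) * (L * (norm (X' - X) + sqrt (real CARD('m)) * norm (\<Lambda>' - \<Lambda>)))"
    by (simp add: power2_eq_square ac_simps)
  then have "\<mu> * norm (?Y' - ?Y) \<le> L * (norm (X' - X) + sqrt (real CARD('m)) * norm (\<Lambda>' - \<Lambda>))"
    using L_nonneg by (cases "norm (?Y' - ?Y) = 0") auto
  then show ?thesis using mu_pos by (simp add: \<kappa>_def field_simps)
qed

text \<open>\<open>gP\<close> and \<open>gL\<close> are the partial gradients of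
  \<open>Phi_fun\<close> taken at the maximizer, the candidates supplied by Danskin's
  theorem.\<close>

definition gP where "gP x \<Lambda> = row_avg (\<chi> i. fst (gf i x (Ystar (const_rows x) \<Lambda> $ i)))"
definition gL where "gL x \<Lambda> = - (L / (2 * sqrt (real CARD('m)))) *\<^sub>R ((W - mat 1) ** Ystar (const_rows x) \<Lambda>)"

lemma norm_const_rows: "norm (const_rows x :: 'a::real_normed_vector^'m) = sqrt (real CARD('m)) * norm x"
  by (rule power2_eq_imp_eq) (simp_all add: power_mult_distrib norm_const_rows_sq)

lemma const_rows_diff: "const_rows x - const_rows y = const_rows (x - y)"
  by (simp add: vec_eq_iff)

text \<open>With \<open>Y\<close> frozen, \<open>H\<close> is affine in \<Lambda>, so the
  linearization error comes from the \<open>x\<close> variable alone.\<close>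

lemma H_linearize:
  fixes x x' \<Lambda> \<Lambda>' defines "Y \<equiv> Ystar (const_rows x) \<Lambda>"
  shows "\<bar>H (const_rows x') \<Lambda>' Y - H (const_rows x) \<Lambda> Y - real CARD('m) * (gP x \<Lambda> \<bullet> (x' - x) + gL x \<Lambda> \<bullet> (\<Lambda>' - \<Lambda>))\<bar>
     \<le> real CARD('m) * (L / 2 * (norm (x' - x))\<^sup>2)"
proof -
  have 1: "cm (\<Lambda>' - \<Lambda>) \<bullet> Y = - (real CARD('m) * (gL x \<Lambda> \<bullet> (\<Lambda>' - \<Lambda>)))"
    using L_over_sqrt[of "(\<Lambda>' - \<Lambda>) \<bullet> ((W - mat 1) ** Y)"]
    by (simp add: inner_cm gL_def Y_def inner_commute field_simps)
  have 2: "real CARD('m) * (gP x \<Lambda> \<bullet> (x' - x)) = (\<Sum>i\<in>UNIV. fst (gf i x (Y $ i)) \<bullet> (x' - x))"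
    by (simp add: gP_def Y_def row_avg_def inner_sum_left)
  have "\<bar>H (const_rows x') \<Lambda>' Y - H (const_rows x) \<Lambda> Y - real CARD('m) * (gP x \<Lambda> \<bullet> (x' - x) + gL x \<Lambda> \<bullet> (\<Lambda>' - \<Lambda>))\<bar>
    = \<bar>\<Sum>i\<in>UNIV. f i x' (Y $ i) - f i x (Y $ i) - fst (gf i x (Y $ i)) \<bullet> (x' - x)\<bar>"
    by (simp add: H_diff 1 2 distrib_left sum_subtractf)
  also have "\<dots> \<le> (\<Sum>i\<in>(UNIV::'m set). L / 2 * (norm (x' - x))\<^sup>2)"
    by (rule order_trans[OF sum_abs sum_mono]) (rule f_quad_x)
  finally show ?thesis by simp
qed

lemma PP_lower: "PP x \<Lambda> + gP x \<Lambda> \<bullet> (x' - x) + gL x \<Lambda> \<bullet> (\<Lambda>' - \<Lambda>) - L / 2 * (norm (x' - x))\<^sup>2 \<le> PP x' \<Lambda>'"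
proof -
  let ?Y = "Ystar (const_rows x) \<Lambda>"
  have "H (const_rows x') \<Lambda>' ?Y \<le> real CARD('m) * PP x' \<Lambda>'" using Ystar_max'[OF Ystar_dom] by (simp add: PP_def)
  moreover have "H (const_rows x) \<Lambda> ?Y = real CARD('m) * PP x \<Lambda>" by (simp add: PP_def)
  ultimately have "real CARD('m) * (PP x \<Lambda> + gP x \<Lambda> \<bullet> (x' - x) + gL x \<Lambda> \<bullet> (\<Lambda>' - \<Lambda>) - L / 2 * (norm (x' - x))\<^sup>2) \<le> real CARD('m) * PP x' \<Lambda>'"
    using H_linearize[of x' \<Lambda>' x \<Lambda>] unfolding abs_le_iff distrib_left right_diff_distrib by linarith
  then show ?thesis using mm_pos by (simp only: mult_le_cancel_left_pos)
qed

text \<open>The new maximizer is only a competitor at the old point. Exchanging it for the old one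
  in the increment of \<open>H\<close> costs a mixed difference, and the Lipschitz bound turns this
  into \<open>L * \<kappa>\<close> times a squared sum, hence \<open>2 * L * \<kappa>\<close>. The
  linearization error adds the remaining \<open>1 / 2\<close>.\<close>

lemma PP_upper: "PP x' \<Lambda>' \<le> PP x \<Lambda> + gP x \<Lambda> \<bullet> (x' - x) + gL x \<Lambda> \<bullet> (\<Lambda>' - \<Lambda>)
    + 5 / 2 * L * \<kappa> * ((norm (x' - x))\<^sup>2 + (norm (\<Lambda>' - \<Lambda>))\<^sup>2)"
proof -
  let ?Y = "Ystar (const_rows x) \<Lambda>" and ?Y' = "Ystar (const_rows x') \<Lambda>'"
  let ?a = "norm (x' - x)" and ?b = "norm (\<Lambda>' - \<Lambda>)"
  have "H (const_rows x) \<Lambda> ?Y' \<le> H (const_rows x) \<Lambda> ?Y" by (rule Ystar_max'[OF Ystar_dom])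
  then have 1: "real CARD('m) * PP x' \<Lambda>' - real CARD('m) * PP x \<Lambda> \<le> H (const_rows x') \<Lambda>' ?Y' - H (const_rows x) \<Lambda> ?Y'"
    by (simp add: PP_def)
  have 2: "norm (?Y' - ?Y) \<le> \<kappa> * (sqrt (real CARD('m)) * (?a + ?b))"
    using Ystar_lipschitz[of "const_rows x'" \<Lambda>' "const_rows x" \<Lambda>]
    by (simp add: const_rows_diff norm_const_rows distrib_left)
  have "(H (const_rows x') \<Lambda>' ?Y' - H (const_rows x) \<Lambda> ?Y') - (H (const_rows x') \<Lambda>' ?Y - H (const_rows x) \<Lambda> ?Y)
     \<le> L * norm (?Y' - ?Y) * (sqrt (real CARD('m)) * (?a + ?b))"
    using H_mixed[of "const_rows x'" \<Lambda>' ?Y' "const_rows x" \<Lambda> ?Y]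
    by (simp add: const_rows_diff norm_const_rows distrib_left abs_le_iff)
  also have "\<dots> \<le> L * (\<kappa> * (sqrt (real CARD('m)) * (?a + ?b))) * (sqrt (real CARD('m)) * (?a + ?b))"
    using L_nonneg by (intro mult_right_mono mult_left_mono 2) auto
  also have "\<dots> = (sqrt (real CARD('m)) * sqrt (real CARD('m))) * (L * \<kappa> * (?a + ?b)\<^sup>2)"
    by (simp only: power2_eq_square ac_simps)
  also have "\<dots> = real CARD('m) * (L * \<kappa> * (?a + ?b)\<^sup>2)" by simp
  also have "\<dots> \<le> real CARD('m) * (L * \<kappa> * (2 * (?a\<^sup>2 + ?b\<^sup>2)))"
    using L_nonneg kappa_ge1 sum_squares_ge_zero[of "?a - ?b" 0]
    by (intro mult_left_mono) (auto simp: power2_eq_square algebra_simps)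
  finally have 3: "(H (const_rows x') \<Lambda>' ?Y' - H (const_rows x) \<Lambda> ?Y') - (H (const_rows x') \<Lambda>' ?Y - H (const_rows x) \<Lambda> ?Y)
     \<le> real CARD('m) * (L * \<kappa> * (2 * (?a\<^sup>2 + ?b\<^sup>2)))" .
  have "real CARD('m) * (L / 2 * ?a\<^sup>2) \<le> real CARD('m) * (1 / 2 * L * \<kappa> * (?a\<^sup>2 + ?b\<^sup>2))"
  proof (rule mult_left_mono)
    have "L * ?a\<^sup>2 \<le> L * \<kappa> * (?a\<^sup>2 + ?b\<^sup>2)"
      using L_nonneg kappa_ge1 by (intro mult_mono) (auto simp: mult_le_cancel_left1)
    then show "L / 2 * ?a\<^sup>2 \<le> 1 / 2 * L * \<kappa> * (?a\<^sup>2 + ?b\<^sup>2)" by simp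
  qed simp
  then have "real CARD('m) * PP x' \<Lambda>' \<le> real CARD('m) * (PP x \<Lambda> + gP x \<Lambda> \<bullet> (x' - x) + gL x \<Lambda> \<bullet> (\<Lambda>' - \<Lambda>)
      + (L * \<kappa> * (2 * (?a\<^sup>2 + ?b\<^sup>2)) + 1 / 2 * L * \<kappa> * (?a\<^sup>2 + ?b\<^sup>2)))"
    using H_linearize[of x' \<Lambda>' x \<Lambda>] 1 3 unfolding abs_le_iff distrib_left by linarith
  then show ?thesis unfolding mult_le_cancel_left_pos[OF mm_pos] by (simp add: algebra_simps)
qed

lemma grad_x_P_eq: "grad_x_P f h W L x \<Lambda> = gP x \<Lambda>"
  unfolding grad_x_P_def P_eq real_of_ereal.simps
proof (rule grad_eqI, rule GDERIV_of_quadratic_bound)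
  fix z
  have "L / 2 * (norm (z - x))\<^sup>2 \<le> 5 / 2 * L * \<kappa> * (norm (z - x))\<^sup>2"
    using L_nonneg kappa_ge1 mult_mono[of 1 "5 * \<kappa>" L L]
    by (intro mult_right_mono) (auto simp: ac_simps)
  then show "\<bar>PP z \<Lambda> - PP x \<Lambda> - gP x \<Lambda> \<bullet> (z - x)\<bar> \<le> (5 / 2 * L * \<kappa>) * (norm (z - x))\<^sup>2"
    using PP_lower[of x \<Lambda> z \<Lambda>] PP_upper[of z \<Lambda> x \<Lambda>]
    by (intro abs_leI) simp_all
qed

lemma grad_\<Lambda>_P_eq: "grad_\<Lambda>_P f h W L x \<Lambda> = gL x \<Lambda>"
  unfolding grad_\<Lambda>_P_def P_eq real_of_ereal.simps
proof (rule grad_eqI, rule GDERIV_of_quadratic_bound)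
  fix U
  have "0 \<le> 5 / 2 * L * \<kappa> * (norm (U - \<Lambda>))\<^sup>2" using L_nonneg kappa_ge1 by simp
  then show "\<bar>PP x U - PP x \<Lambda> - gL x \<Lambda> \<bullet> (U - \<Lambda>)\<bar> \<le> (5 / 2 * L * \<kappa>) * (norm (U - \<Lambda>))\<^sup>2"
    using PP_lower[of x \<Lambda> x U] PP_upper[of x U x \<Lambda>]
    by (intro abs_leI) simp_all
qed

section \<open>Measurability of gradients and maximizers\<close>

lemma gf_measurable [measurable (raw)]:
  assumes [measurable]: "u \<in> borel_measurable M" "v \<in> borel_measurable M"
  shows "(\<lambda>\<omega>. gf i (u \<omega>) (v \<omega>)) \<in> borel_measurable M"
proof -
  have "L-lipschitz_on UNIV (\<lambda>z. gf i (fst z) (snd z))"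
    using gf_lipschitz L_nonneg by (intro lipschitz_onI) (auto simp: dist_norm)
  then have "(\<lambda>z. gf i (fst z) (snd z)) \<in> borel_measurable borel"
    by (intro borel_measurable_continuous_onI lipschitz_on_continuous_on)
  then have "(\<lambda>\<omega>. (\<lambda>z. gf i (fst z) (snd z)) (u \<omega>, v \<omega>)) \<in> borel_measurable M"
    by (rule measurable_compose[rotated]) measurable
  then show ?thesis by simp
qed

lemma Ystar_measurable [measurable (raw)]:
  assumes [measurable]: "u \<in> borel_measurable M" "v \<in> borel_measurable M"
  shows "(\<lambda>\<omega>. Ystar (u \<omega>) (v \<omega>)) \<in> borel_measurable M"
proof -
  have "(\<kappa> * (1 + sqrt (real CARD('m))))-lipschitz_on UNIV (\<lambda>z. Ystar (fst z) (snd z))"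
  proof (rule lipschitz_onI)
    fix z z' :: "(real^'p^'m) \<times> (real^'q^'m)"
    have "norm (Ystar (fst z) (snd z) - Ystar (fst z') (snd z'))
       \<le> \<kappa> * (norm (fst (z - z')) + sqrt (real CARD('m)) * norm (snd (z - z')))"
      using Ystar_lipschitz[of "fst z" "snd z" "fst z'" "snd z'"] by simp
    also have "\<dots> \<le> \<kappa> * (norm (z - z') + sqrt (real CARD('m)) * norm (z - z'))"
      using kappa_ge1 norm_fst_le[of "fst (z - z')" "snd (z - z')"] norm_snd_le[of "snd (z - z')" "fst (z - z')"]
      unfolding prod.collapse by (intro mult_left_mono add_mono) auto
    finally show "dist (Ystar (fst z) (snd z)) (Ystar (fst z') (snd z')) \<le> \<kappa> * (1 + sqrt (real CARD('m))) * dist z z'"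
      by (simp add: dist_norm algebra_simps)
  qed (use kappa_ge1 in simp)
  then have "(\<lambda>z. Ystar (fst z) (snd z)) \<in> borel_measurable borel"
    by (intro borel_measurable_continuous_onI lipschitz_on_continuous_on)
  then have "(\<lambda>\<omega>. (\<lambda>z. Ystar (fst z) (snd z)) (u \<omega>, v \<omega>)) \<in> borel_measurable M"
    by (rule measurable_compose[rotated]) measurable
  then show ?thesis by simp
qed

end

section \<open>One step of the algorithm\<close>

lemma norm_fst_le': "norm (fst w) \<le> norm w" and norm_snd_le': "norm (snd w) \<le> norm w"
  by (cases w, simp add: norm_fst_le norm_snd_le)+

lemma inner_avg_perp: "X \<bullet> Y = real CARD('m) * (row_avg X \<bullet> row_avg Y) + perp X \<bullet> perp Y"
  for X Y :: "'a::real_inner^'m::finite"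
proof -
  have X: "X = const_rows (row_avg X) + perp X" and Y: "Y = const_rows (row_avg Y) + perp Y"
    by (simp_all add: perp_def)
  have "X \<bullet> Y = (const_rows (row_avg X) + perp X) \<bullet> (const_rows (row_avg Y) + perp Y)"
    using X Y by simp
  also have "\<dots> = real CARD('m) * (row_avg X \<bullet> row_avg Y) + perp X \<bullet> perp Y"
    by (simp add: inner_add_left inner_const_rows inner_add_right inner_commute[of "perp X" "const_rows _"])
  finally show ?thesis .
qed

text \<open>Convexity of the square for the weights \<open>\<rho>\<close> and
  \<open>1 - \<rho>\<close> at the points \<open>a\<close> and
  \<open>b / (1 - \<rho>)\<close>.\<close>

lemma convex_combination_sq:
  fixes a b :: real
  assumes "0 \<le> \<rho>" "\<rho> < 1"
  shows "(\<rho> * a + b)\<^sup>2 \<le> \<rho> * a\<^sup>2 + b\<^sup>2 / (1 - \<rho>)"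
proof -
  have "0 \<le> \<rho> * ((1 - \<rho>) * a - b)\<^sup>2" using assms by simp
  also have "\<dots> = (1 - \<rho>) * \<rho> * a\<^sup>2 + b\<^sup>2 - (1 - \<rho>) * (\<rho> * a + b)\<^sup>2"
    by (simp add: power2_eq_square algebra_simps)
  finally show ?thesis using assms by (simp add: field_simps)
qed

lemma young_inner:
  fixes a b :: "'a::real_inner"
  assumes "c > 0"
  shows "a \<bullet> b \<le> c / 2 * (norm a)\<^sup>2 + 1 / (2 * c) * (norm b)\<^sup>2"
proof -
  have "0 \<le> (norm (c *\<^sub>R a - b))\<^sup>2" by simp
  also have "\<dots> = c\<^sup>2 * (norm a)\<^sup>2 - 2 * c * (a \<bullet> b) + (norm b)\<^sup>2"
    unfolding power2_norm_eq_inner by (simp add: inner_diff_left inner_diff_right inner_commute power2_eq_square)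
  finally have "2 * c * (a \<bullet> b) \<le> c\<^sup>2 * (norm a)\<^sup>2 + (norm b)\<^sup>2" by simp
  also have "\<dots> = 2 * c * (c / 2 * (norm a)\<^sup>2 + 1 / (2 * c) * (norm b)\<^sup>2)"
    using assms by (simp add: power2_eq_square field_simps)
  finally have "2 * c * (a \<bullet> b) \<le> 2 * c * (c / 2 * (norm a)\<^sup>2 + 1 / (2 * c) * (norm b)\<^sup>2)" .
  then show ?thesis using assms by simp
qed

lemma young_norm_add:
  fixes a b :: "'a::real_inner"
  assumes "c > 0"
  shows "(norm (a + b))\<^sup>2 \<le> (1 + c) * (norm a)\<^sup>2 + (1 + 1 / c) * (norm b)\<^sup>2"
proof -
  have "(norm (a + b))\<^sup>2 = (norm a)\<^sup>2 + 2 * (a \<bullet> b) + (norm b)\<^sup>2"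
    unfolding power2_norm_eq_inner by (simp add: inner_add_left inner_add_right inner_commute)
  then show ?thesis using young_inner[OF assms, of a b] by (simp add: algebra_simps)
qed

lemma norm_add_sq_le: "(norm (a + b))\<^sup>2 \<le> 2 * (norm a)\<^sup>2 + 2 * (norm b)\<^sup>2" for a b :: "'a::real_inner"
  using young_norm_add[of 1 a b] by simp

lemma norm_diff_sq_le: "(norm (a - b))\<^sup>2 \<le> 2 * (norm a)\<^sup>2 + 2 * (norm b)\<^sup>2" for a b :: "'a::real_inner"
  using norm_add_sq_le[of a "- b"] by simp

text \<open>Jensen's inequality, read off from convexity of the epigraph because \<open>r\<close>
  may take the value infinity.\<close>

lemma closed_convex_jensen_rows:
  fixes X :: "'a::euclidean_space^'m::finite"
  assumes cc: "closed_convex_fun r" and dom: "\<And>i. X $ i \<in> eff_dom r"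
  shows "row_avg X \<in> eff_dom r"
    and "real CARD('m) * real_of_ereal (r (row_avg X)) \<le> (\<Sum>i\<in>UNIV. real_of_ereal (r (X $ i)))"
proof -
  define E where "E = {(x, s::real). r x \<le> ereal s}"
  have conv: "convex E" using cc by (simp add: closed_convex_fun_def E_def)
  have "(X $ i, real_of_ereal (r (X $ i))) \<in> E" for i
    using closed_convex_finite[OF cc dom[of i]] by (simp add: E_def)
  then have "(\<Sum>i\<in>(UNIV::'m set). (1 / real CARD('m)) *\<^sub>R (X $ i, real_of_ereal (r (X $ i)))) \<in> E"
    by (intro convex_sum conv) auto
  then have "(row_avg X, (\<Sum>i\<in>UNIV. real_of_ereal (r (X $ i))) / real CARD('m)) \<in> E"
    by (simp add: row_avg_def scaleR_sum_right sum_divide_distrib sum_prod del: scaleR_Pair) 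
       (simp add: sum_prod)
  then have *: "r (row_avg X) \<le> ereal ((\<Sum>i\<in>UNIV. real_of_ereal (r (X $ i))) / real CARD('m))" by (simp add: E_def)
  then show d: "row_avg X \<in> eff_dom r" by (auto simp: eff_dom_def)
  have "real_of_ereal (r (row_avg X)) \<le> (\<Sum>i\<in>UNIV. real_of_ereal (r (X $ i))) / real CARD('m)"
    using * closed_convex_finite[OF cc d] by (metis ereal_less_eq(3))
  then show "real CARD('m) * real_of_ereal (r (row_avg X)) \<le> (\<Sum>i\<in>UNIV. real_of_ereal (r (X $ i)))"
    by (simp add: field_simps)
qed

lemma norm_x_part_le: "norm (x_part D) \<le> norm D" and norm_y_part_le: "norm (y_part D) \<le> norm D"
  for D :: "((real^'p::finite) \<times> (real^'q::finite))^'m::finite"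
proof -
  have "(norm (x_part D))\<^sup>2 \<le> (norm D)\<^sup>2" "(norm (y_part D))\<^sup>2 \<le> (norm D)\<^sup>2"
    unfolding norm_rows_sq[where 'm='m and 'a="real^'p"] norm_rows_sq[where 'm='m and 'a="real^'q"]
      norm_rows_sq[of D] x_part_def y_part_def
    by (auto intro!: sum_mono power_mono norm_fst_le' norm_snd_le')
  then show "norm (x_part D) \<le> norm D" "norm (y_part D) \<le> norm D"
    by (simp_all add: power2_le_iff_abs_le)
qed

lemma x_part_diff: "x_part (A - B) = x_part A - x_part B"
  by (simp add: x_part_def vec_eq_iff)

section \<open>Step sizes and the objective\<close>

locale vrlm = minimax W \<rho> f h \<mu> L y0
  for W :: "real^'m::finite^'m" and \<rho> and f :: "'m \<Rightarrow> real^'p::finite \<Rightarrow> real^'q::finite \<Rightarrow> real" and h :: "real^'q::finite \<Rightarrow> ereal" and \<mu> L y0 +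
  fixes g :: "real^'p::finite \<Rightarrow> ereal" and phi_star \<beta> \<eta>x \<eta>y \<eta>L :: real and x0 :: "real^'p"
  assumes g_cc: "closed_convex_fun g"
    and phi_lb: "\<And>x U. ereal phi_star \<le> phi_fun f g h W L x U"
    and x0_dom: "x0 \<in> eff_dom g"
    and beta: "0 < \<beta>" "\<beta> < 1"
    and eta_y: "\<eta>y = sqrt \<beta> / (4 * sqrt 2 * L)"
    and eta_x: "\<eta>x = min
        (\<kappa> * (1 - \<rho>)\<^sup>2 / (40 * L * (24 * \<kappa>\<^sup>2 + 8 * \<kappa> + 5)))
        (sqrt \<beta> / (48 * (L + 1) * (24 * \<kappa>\<^sup>2 + 7 * \<kappa> + 4)))"
    and eta_L: "\<eta>L = min
        ((1 - \<rho>)\<^sup>2 / (4 * L * (20 * \<kappa> + 3)))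
        (sqrt \<beta> / (4 * (L + 1) * (52 * \<kappa>\<^sup>2 + \<kappa> + 1)))"
begin

lemma eta_pos: "\<eta>x > 0" "\<eta>y > 0" "\<eta>L > 0"
proof -
  have "24 * \<kappa>\<^sup>2 + 8 * \<kappa> + 5 > 0" "24 * \<kappa>\<^sup>2 + 7 * \<kappa> + 4 > 0" "52 * \<kappa>\<^sup>2 + \<kappa> + 1 > 0" "20 * \<kappa> + 3 > 0"
    using kappa_ge1 by (auto intro!: add_nonneg_pos add_nonneg_nonneg)
  then show "\<eta>x > 0" "\<eta>y > 0" "\<eta>L > 0"
    unfolding eta_x eta_y eta_L using L_pos kappa_ge1 rho_less beta
    by (auto intro!: divide_pos_pos mult_pos_pos)
qed

lemma eta_y_L: "\<eta>y * L \<le> 1 / 5"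
proof -
  have "sqrt \<beta> \<le> 1" using beta by simp
  \<comment> \<open>This is exactly what makes \<open>1 / (4 * sqrt 2)\<close> at most
    \<open>1 / 5\<close>.\<close>
  moreover have "sqrt 2 \<ge> 5 / 4" by (rule real_le_rsqrt) (simp add: power2_eq_square)
  ultimately have "sqrt \<beta> * 5 \<le> 4 * sqrt 2" by linarith
  then show ?thesis using L_pos by (simp add: eta_y field_simps)
qed

definition gr where "gr x = real_of_ereal (g x)"

lemma phi_eq: "x \<in> eff_dom g \<Longrightarrow> phi_fun f g h W L x \<Lambda> = ereal (PP x \<Lambda> + gr x)"
  using closed_convex_finite[OF g_cc] by (metis P_eq phi_fun_def gr_def plus_ereal.simps(1))

lemma phi_star_le: "x \<in> eff_dom g \<Longrightarrow> phi_star \<le> PP x \<Lambda> + gr x"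
  using phi_lb[of x \<Lambda>] by (simp add: phi_eq)

end

section \<open>One-step estimates along a fixed path\<close>

locale vrlm_path = vrlm W \<rho> f h \<mu> L y0 g phi_star \<beta> \<eta>x \<eta>y \<eta>L x0
  for W :: "real^'m::finite^'m" and \<rho> and f :: "'m \<Rightarrow> real^'p::finite \<Rightarrow> real^'q::finite \<Rightarrow> real" and h :: "real^'q::finite \<Rightarrow> ereal" and \<mu> L y0
    and g :: "real^'p::finite \<Rightarrow> ereal" and phi_star \<beta> \<eta>x \<eta>y \<eta>L x0 +
  fixes X V :: "nat \<Rightarrow> real^'p^'m" and \<Lambda> Y :: "nat \<Rightarrow> real^'q^'m"
    and D :: "nat \<Rightarrow> ((real^'p) \<times> (real^'q))^'m"
  assumes X_0: "X 0 = const_rows x0" and Y_0: "Y 0 = const_rows y0" and \<Lambda>_0: "\<Lambda> 0 = 0"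
    and V_0: "V 0 = x_part (D 0)"
    and V_Suc: "\<And>t. V (Suc t) = W ** (V t + x_part (D (Suc t)) - x_part (D t))"
    and \<Lambda>_Suc: "\<And>t. \<Lambda> (Suc t) =
        \<Lambda> t + (L * \<eta>L / (2 * sqrt (real CARD('m)))) *\<^sub>R ((W - mat 1) ** Y t)"
    and X_Suc: "\<And>t. X (Suc t) = prox_rows (\<lambda>v. ereal \<eta>x * g v) (W ** X t - \<eta>x *\<^sub>R V t)"
    and Y_Suc: "\<And>t. Y (Suc t) = prox_rows (\<lambda>v. ereal \<eta>y * h v)
          (Y t + \<eta>y *\<^sub>R
            (y_part (D t) - (L * sqrt (real CARD('m)) / 2) *\<^sub>R (transpose (W - mat 1) ** \<Lambda> t)))"
begin

text \<open>\<open>Yt\<close> is the paper's \<open>Y\<close> with a tilde, \<open>Yc\<close> the maximizer at the averaged point, and \<open>del\<close> is \<open>m\<close> times the gap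
  written \<open>\<delta>\<close> with a hat there.\<close>

definition "R t = D t - grad_F f (X t) (Y t)"
definition "xb t = row_avg (X t)"
definition "Yc t = Ystar (const_rows (xb t)) (\<Lambda> t)"
definition "Yt t = Ystar (X t) (\<Lambda> t)"
definition "ph t = PP (xb t) (\<Lambda> t) + gr (xb t)"
definition "del t = H (X t) (\<Lambda> t) (Yt t) - H (X t) (\<Lambda> t) (Y t)"
definition "ysq t = (norm (Yt t - Y t))\<^sup>2"
definition "esq t = (norm (Yc t - Y t))\<^sup>2"
definition "xsq t = (norm (perp (X t)))\<^sup>2"
definition "vsq t = (norm (perp (V t)))\<^sup>2"
definition "rsq t = (norm (R t))\<^sup>2"
definition "psq t = (norm (gL (xb t) (\<Lambda> t)))\<^sup>2"
definition "gvsq t = (norm (gP (xb t) (\<Lambda> t) - row_avg (V t)))\<^sup>2"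
definition "gmsq t = (norm ((1 / \<eta>x) *\<^sub>R (xb t - prox (\<lambda>v. ereal \<eta>x * g v) (xb t - \<eta>x *\<^sub>R gP (xb t) (\<Lambda> t)))))\<^sup>2"
definition "dxb t = (norm (xb (Suc t) - xb t))\<^sup>2"
definition "dL t = (norm (\<Lambda> (Suc t) - \<Lambda> t))\<^sup>2"
definition "dX t = (norm (X (Suc t) - X t))\<^sup>2"
definition "dY t = (norm (Y (Suc t) - Y t))\<^sup>2"
definition "dD t = (norm (D (Suc t) - D t))\<^sup>2"

lemma grad_F_nth: "grad_F f A B $ i = gf i (A $ i) (B $ i)"
  by (simp add: grad_F_def gf_def)

lemma X_dom: "X t $ i \<in> eff_dom g"
  by (cases t) (simp_all add: X_0 x0_dom X_Suc prox_rows_def prox_in_dom[OF g_cc x0_dom eta_pos(1)])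

lemma Y_dom: "Y t \<in> domY"
  by (cases t) (simp_all add: domY_def Y_0 y0_dom Y_Suc prox_rows_def prox_in_dom[OF h_cc y0_dom eta_pos(2)])

lemma xb_dom: "xb t \<in> eff_dom g"
  unfolding xb_def by (rule closed_convex_jensen_rows[OF g_cc X_dom])

text \<open>The invariant of gradient tracking: \<open>W\<close> preserves averages, so the
  increments of \<open>D\<close> telescope.\<close>

lemma row_avg_V: "row_avg (V t) = row_avg (x_part (D t))"
  by (induction t) (simp_all add: V_0 V_Suc row_avg_add row_avg_diff)

lemma X_minus_const: "X t - const_rows (xb t) = perp (X t)"
  by (simp add: perp_def xb_def)

lemma WX_minus_const: "W ** X t - const_rows (xb t) = perp (W ** X t)"
  by (simp add: perp_def xb_def)

lemma perp_WX_sq: "(norm (perp (W ** X t)))\<^sup>2 \<le> xsq t"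
proof -
  have "norm (perp (W ** X t)) \<le> 1 * norm (perp (X t))"
    using rho_less by (intro order_trans[OF norm_perp_W_le] mult_right_mono) auto
  then show ?thesis by (simp add: xsq_def power_mono)
qed

text \<open>The cross term between the perpendicular parts of \<open>V t\<close> and \<open>X (Suc t)\<close> is absorbed by the quadratic
  gain of the proximal step.\<close>

lemma g_descent:
  "real CARD('m) * gr (xb (Suc t)) \<le> real CARD('m) * gr (xb t)
     - real CARD('m) * (row_avg (V t) \<bullet> (xb (Suc t) - xb t))
     + \<eta>x / 2 * vsq t + 1 / (2 * \<eta>x) * xsq t - real CARD('m) / \<eta>x * dxb t"
proof -
  let ?m = "real CARD('m)" and ?c = "const_rows (xb t) :: real^'p^'m"
  have row: "gr (X (Suc t) $ i) \<le> gr (xb t) + (- (V t $ i)) \<bullet> (X (Suc t) $ i - xb t)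
     + 1 / (2 * \<eta>x) * ((norm (xb t - (W ** X t) $ i))\<^sup>2 - (norm (xb t - X (Suc t) $ i))\<^sup>2
         - (norm (X (Suc t) $ i - (W ** X t) $ i))\<^sup>2)" for i
    unfolding gr_def
    by (rule prox_step[OF g_cc eta_pos(1) xb_dom]) (simp add: X_Suc prox_rows_def)
  have "?m * gr (xb (Suc t)) \<le> (\<Sum>i\<in>UNIV. gr (X (Suc t) $ i))"
    unfolding xb_def gr_def by (rule closed_convex_jensen_rows[OF g_cc X_dom])
  also have "\<dots> \<le> (\<Sum>i\<in>UNIV. gr (xb t) + (- (V t $ i)) \<bullet> (X (Suc t) $ i - xb t)
     + 1 / (2 * \<eta>x) * ((norm (xb t - (W ** X t) $ i))\<^sup>2 - (norm (xb t - X (Suc t) $ i))\<^sup>2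
         - (norm (X (Suc t) $ i - (W ** X t) $ i))\<^sup>2))"
    by (rule sum_mono) (rule row)
  also have "\<dots> = ?m * gr (xb t) - V t \<bullet> (X (Suc t) - ?c)
     + 1 / (2 * \<eta>x) * ((norm (W ** X t - ?c))\<^sup>2 - (norm (X (Suc t) - ?c))\<^sup>2
         - (norm (X (Suc t) - W ** X t))\<^sup>2)"
    unfolding sum.distrib sum_distrib_left[symmetric] sum_subtractf
      norm_rows_sq[where 'm='m and 'a="real^'p"] inner_vec_def[of "V t"]
    by (simp add: sum_negf norm_minus_commute)
  finally have 1: "?m * gr (xb (Suc t)) \<le> \<dots>" .
  have 2: "(norm (W ** X t - ?c))\<^sup>2 \<le> xsq t" unfolding WX_minus_const by (rule perp_WX_sq)
  have 3: "(norm (X (Suc t) - ?c))\<^sup>2 = ?m * dxb t + (norm (perp (X (Suc t))))\<^sup>2"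
    unfolding norm_sq_avg_perp[of "X (Suc t) - ?c"] by (simp add: perp_diff row_avg_diff dxb_def xb_def)
  \<comment> \<open>The displacement of the average occurs in this square and in the previous one,
    which doubles \<open>1 / (2 * \<eta>x)\<close> to \<open>1 / \<eta>x\<close>.\<close>
  have 4: "(norm (X (Suc t) - W ** X t))\<^sup>2 \<ge> ?m * dxb t"
    using norm_row_avg_sq_le[of "X (Suc t) - W ** X t"] by (simp add: row_avg_diff dxb_def xb_def)
  have 5: "V t \<bullet> (X (Suc t) - ?c) = ?m * (row_avg (V t) \<bullet> (xb (Suc t) - xb t)) + perp (V t) \<bullet> perp (X (Suc t))"
    unfolding inner_avg_perp[of "V t"] by (simp add: perp_diff row_avg_diff xb_def)
  have 6: "- (perp (V t) \<bullet> perp (X (Suc t))) \<le> \<eta>x / 2 * vsq t + 1 / (2 * \<eta>x) * (norm (perp (X (Suc t))))\<^sup>2"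
    using young_inner[OF eta_pos(1), of "perp (V t)" "- perp (X (Suc t))"] by (simp add: vsq_def)
  have "1 / (2 * \<eta>x) * ((norm (W ** X t - ?c))\<^sup>2 - (norm (X (Suc t) - ?c))\<^sup>2 - (norm (X (Suc t) - W ** X t))\<^sup>2)
     \<le> 1 / (2 * \<eta>x) * (xsq t - (norm (perp (X (Suc t))))\<^sup>2 - 2 * (?m * dxb t))"
    using eta_pos(1) 2 3 4 by (intro mult_left_mono) (linarith, simp)
  also have "\<dots> = 1 / (2 * \<eta>x) * xsq t - 1 / (2 * \<eta>x) * (norm (perp (X (Suc t))))\<^sup>2 - ?m / \<eta>x * dxb t"
    using eta_pos(1) by (simp add: field_simps)
  finally show ?thesis using 1 5 6 by linarith
qed

text \<open>Polarization instead of Young's inequality keeps the full gradient norm \<open>psq\<close>.\<close>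

lemma gL_descent: "gL (xb t) (\<Lambda> t) \<bullet> (\<Lambda> (Suc t) - \<Lambda> t)
    \<le> - \<eta>L / 2 * psq t - 1 / (2 * \<eta>L) * dL t + \<eta>L / 2 * (L\<^sup>2 / real CARD('m) * esq t)"
proof -
  define c where "c = L / (2 * sqrt (real CARD('m)))"
  define G where "G = - c *\<^sub>R ((W - mat 1) ** Y t)"
  let ?p = "gL (xb t) (\<Lambda> t)"
  have d: "\<Lambda> (Suc t) - \<Lambda> t = - \<eta>L *\<^sub>R G"
    by (simp add: \<Lambda>_Suc G_def c_def)
  have dl: "dL t = \<eta>L\<^sup>2 * (norm G)\<^sup>2" unfolding dL_def d by (simp add: power_mult_distrib)
  have "?p - G = - c *\<^sub>R ((W - mat 1) ** (Yc t - Y t))"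
    by (simp add: gL_def G_def c_def Yc_def matrix_mult_diff scaleR_diff_right)
  then have "norm (?p - G) = c * norm ((W - mat 1) ** (Yc t - Y t))" using L_nonneg by (simp add: c_def)
  also have "\<dots> \<le> c * (2 * norm (Yc t - Y t))"
    using L_nonneg by (intro mult_left_mono norm_W_minus_id_le) (simp add: c_def)
  finally have "(norm (?p - G))\<^sup>2 \<le> (c * (2 * norm (Yc t - Y t)))\<^sup>2" by (rule power_mono) simp
  also have "\<dots> = L\<^sup>2 / real CARD('m) * esq t"
    by (simp add: c_def esq_def power_mult_distrib power_divide)
  finally have 1: "(norm (?p - G))\<^sup>2 \<le> L\<^sup>2 / real CARD('m) * esq t" .
  have "(norm (?p - G))\<^sup>2 = (norm ?p)\<^sup>2 - 2 * (?p \<bullet> G) + (norm G)\<^sup>2"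
    unfolding power2_norm_eq_inner by (simp add: inner_diff_left inner_diff_right inner_commute)
  then have q: "?p \<bullet> G = ((norm ?p)\<^sup>2 + (norm G)\<^sup>2 - (norm (?p - G))\<^sup>2) / 2" by simp
  have "?p \<bullet> (\<Lambda> (Suc t) - \<Lambda> t) = - \<eta>L / 2 * psq t - \<eta>L / 2 * (norm G)\<^sup>2 + \<eta>L / 2 * (norm (?p - G))\<^sup>2"
    unfolding d inner_scaleR_right q by (simp add: psq_def field_simps)
  also have "\<eta>L / 2 * (norm G)\<^sup>2 = 1 / (2 * \<eta>L) * dL t"
    using eta_pos(3) by (simp add: dl power2_eq_square)
  finally show ?thesis using mult_left_mono[OF 1, of "\<eta>L / 2"] eta_pos(3) by simp
qed

text \<open>Half of the gain \<open>1 / \<eta>x\<close> from \<open>g_descent\<close> pays for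
  replacing the tracked direction by the true gradient; the curvature of \<open>PP\<close> is
  charged to the other half.\<close>

lemma phi_descent:
  "real CARD('m) * (ph (Suc t) - ph t) \<le>
     - real CARD('m) * (1 / (2 * \<eta>x) - 5 / 2 * L * \<kappa>) * dxb t
     - real CARD('m) * (1 / (2 * \<eta>L) - 5 / 2 * L * \<kappa>) * dL t
     - real CARD('m) * (\<eta>L / 2) * psq t + \<eta>L * L\<^sup>2 / 2 * esq t
     + \<eta>x / 2 * (real CARD('m) * gvsq t) + \<eta>x / 2 * vsq t + 1 / (2 * \<eta>x) * xsq t"
proof -
  let ?m = "real CARD('m)"
  let ?dx = "xb (Suc t) - xb t"
  have y: "(gP (xb t) (\<Lambda> t) - row_avg (V t)) \<bullet> ?dx \<le> \<eta>x / 2 * gvsq t + 1 / (2 * \<eta>x) * dxb t"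
    using young_inner[OF eta_pos(1)] by (simp add: gvsq_def dxb_def)
  have "PP (xb (Suc t)) (\<Lambda> (Suc t)) \<le> PP (xb t) (\<Lambda> t) + gP (xb t) (\<Lambda> t) \<bullet> ?dx
     + gL (xb t) (\<Lambda> t) \<bullet> (\<Lambda> (Suc t) - \<Lambda> t) + 5 / 2 * L * \<kappa> * (dxb t + dL t)"
    unfolding dxb_def dL_def by (rule PP_upper)
  then have "PP (xb (Suc t)) (\<Lambda> (Suc t)) - PP (xb t) (\<Lambda> t)
     \<le> row_avg (V t) \<bullet> ?dx + (\<eta>x / 2 * gvsq t + 1 / (2 * \<eta>x) * dxb t)
       + (- \<eta>L / 2 * psq t - 1 / (2 * \<eta>L) * dL t + \<eta>L / 2 * (L\<^sup>2 / ?m * esq t))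
       + 5 / 2 * L * \<kappa> * (dxb t + dL t)" (is "_ \<le> ?r")
    using y gL_descent[of t] by (simp add: inner_diff_left)
  then have "?m * (PP (xb (Suc t)) (\<Lambda> (Suc t)) - PP (xb t) (\<Lambda> t)) \<le> ?m * ?r"
    by (rule mult_left_mono) simp
  also have "?m * ?r = ?m * (row_avg (V t) \<bullet> ?dx) + \<eta>x / 2 * (?m * gvsq t) + ?m / (2 * \<eta>x) * dxb t
       - ?m * (\<eta>L / 2) * psq t - ?m / (2 * \<eta>L) * dL t + \<eta>L * L\<^sup>2 / 2 * esq t
       + ?m * (5 / 2 * L * \<kappa>) * dxb t + ?m * (5 / 2 * L * \<kappa>) * dL t"
    by (simp add: algebra_simps)
  finally have 1: "?m * (PP (xb (Suc t)) (\<Lambda> (Suc t)) - PP (xb t) (\<Lambda> t)) \<le> \<dots>" .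
  have "?m / \<eta>x * dxb t = 2 * (?m / (2 * \<eta>x) * dxb t)" by simp
  moreover have "- ?m * (1 / (2 * \<eta>x) - 5 / 2 * L * \<kappa>) * dxb t = ?m * (5 / 2 * L * \<kappa>) * dxb t - ?m / (2 * \<eta>x) * dxb t"
    "- ?m * (1 / (2 * \<eta>L) - 5 / 2 * L * \<kappa>) * dL t = ?m * (5 / 2 * L * \<kappa>) * dL t - ?m / (2 * \<eta>L) * dL t"
    by (simp_all add: algebra_simps)
  moreover have "?m * (ph (Suc t) - ph t) = ?m * (PP (xb (Suc t)) (\<Lambda> (Suc t)) - PP (xb t) (\<Lambda> t))
      + ?m * gr (xb (Suc t)) - ?m * gr (xb t)" by (simp add: ph_def algebra_simps)
  ultimately show ?thesis using 1 g_descent[of t] by linarith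
qed

text \<open>By the tracking invariant the direction error is an average over agents of two
  contributions: the gradient error \<open>R\<close>, and the change of the gradients between
  \<open>(X, Y)\<close> and the averaged point with its maximizer.\<close>

lemma gv_bound: "real CARD('m) * gvsq t \<le> 2 * L\<^sup>2 * (xsq t + esq t) + 2 * rsq t"
proof -
  define A :: "real^'p^'m" where "A = (\<chi> i. fst (gf i (xb t) (Yc t $ i)) - fst (gf i (X t $ i) (Y t $ i)))"
  have "x_part (D t) = x_part (R t) + (\<chi> i. fst (gf i (X t $ i) (Y t $ i)))"
    by (simp add: R_def x_part_def vec_eq_iff grad_F_nth)
  then have "gP (xb t) (\<Lambda> t) - row_avg (V t) = row_avg (A - x_part (R t))"
    by (simp add: row_avg_V gP_def A_def Yc_def[symmetric] row_avg_diff[symmetric] vec_eq_iff row_avg_add)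
       (simp add: row_avg_def sum_subtractf algebra_simps flip: scaleR_diff_right scaleR_add_right)
  then have "real CARD('m) * gvsq t \<le> (norm (A - x_part (R t)))\<^sup>2"
    by (simp add: gvsq_def norm_row_avg_sq_le)
  also have "\<dots> \<le> 2 * (norm A)\<^sup>2 + 2 * (norm (x_part (R t)))\<^sup>2" by (rule norm_diff_sq_le)
  also have "(norm (x_part (R t)))\<^sup>2 \<le> rsq t" unfolding rsq_def by (intro power_mono norm_x_part_le) simp
  also have "(norm A)\<^sup>2 \<le> L\<^sup>2 * (xsq t + esq t)"
  proof -
    have "(norm A)\<^sup>2 = (\<Sum>i\<in>UNIV. (norm (A $ i))\<^sup>2)" by (rule norm_rows_sq)
    also have "\<dots> \<le> (\<Sum>i\<in>UNIV. L\<^sup>2 * ((norm (perp (X t) $ i))\<^sup>2 + (norm ((Yc t - Y t) $ i))\<^sup>2))"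
    proof (rule sum_mono)
      fix i
      have "norm (A $ i) = norm (fst (gf i (xb t) (Yc t $ i) - gf i (X t $ i) (Y t $ i)))" by (simp add: A_def)
      also have "\<dots> \<le> norm (gf i (xb t) (Yc t $ i) - gf i (X t $ i) (Y t $ i))"
        by (rule norm_fst_le')
      also have "\<dots> \<le> L * norm ((xb t, Yc t $ i) - (X t $ i, Y t $ i))" by (rule gf_lipschitz)
      finally have "(norm (A $ i))\<^sup>2 \<le> (L * norm ((xb t, Yc t $ i) - (X t $ i, Y t $ i)))\<^sup>2"
        by (rule power_mono) simp
      also have "\<dots> = L\<^sup>2 * ((norm (xb t - X t $ i))\<^sup>2 + (norm (Yc t $ i - Y t $ i))\<^sup>2)"
        by (simp add: power_mult_distrib norm_Pair)
      also have "norm (xb t - X t $ i) = norm (perp (X t) $ i)"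
        by (simp add: perp_def xb_def norm_minus_commute)
      finally show "(norm (A $ i))\<^sup>2 \<le> L\<^sup>2 * ((norm (perp (X t) $ i))\<^sup>2 + (norm ((Yc t - Y t) $ i))\<^sup>2)" by simp
    qed
    also have "\<dots> = L\<^sup>2 * (xsq t + esq t)"
      by (simp add: xsq_def esq_def norm_rows_sq sum.distrib sum_distrib_left distrib_left)
    finally show ?thesis .
  qed
  finally show ?thesis by simp
qed

lemma e_bound: "esq t \<le> 2 * \<kappa>\<^sup>2 * xsq t + 2 * ysq t"
proof -
  have "esq t = (norm ((Yc t - Yt t) + (Yt t - Y t)))\<^sup>2" by (simp add: esq_def)
  also have "\<dots> \<le> 2 * (norm (Yc t - Yt t))\<^sup>2 + 2 * (norm (Yt t - Y t))\<^sup>2" by (rule norm_add_sq_le)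
  also have "norm (Yc t - Yt t) \<le> \<kappa> * norm (perp (X t))"
    using Ystar_lipschitz[of "const_rows (xb t)" "\<Lambda> t" "X t" "\<Lambda> t"]
    by (simp add: Yc_def Yt_def X_minus_const[symmetric] norm_minus_commute)
  then have "(norm (Yc t - Yt t))\<^sup>2 \<le> (\<kappa> * norm (perp (X t)))\<^sup>2" by (rule power_mono) simp
  finally show ?thesis by (simp add: power_mult_distrib xsq_def ysq_def)
qed

text \<open>The comparison with one proximal point shared by all rows serves both the consensus of
  \<open>X\<close> and the stationarity measure.\<close>

lemma prox_rows_const_le:
  "norm (prox_rows (\<lambda>v. ereal \<eta>x * g v) U - const_rows (prox (\<lambda>v. ereal \<eta>x * g v) u)) \<le> norm (U - const_rows u)"
  for U :: "real^'p^'m"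
proof (rule power2_le_imp_le)
  show "(norm (prox_rows (\<lambda>v. ereal \<eta>x * g v) U - const_rows (prox (\<lambda>v. ereal \<eta>x * g v) u)))\<^sup>2 \<le> (norm (U - const_rows u))\<^sup>2"
    unfolding norm_rows_sq[where 'm='m and 'a="real^'p"]
    by (intro sum_mono power_mono) (simp_all add: prox_rows_def prox_nonexpansive[OF g_cc x0_dom eta_pos(1)])
qed simp

text \<open>The proximal map does not commute with averaging. The next iterate is therefore compared
  with the proximal point of the average, and nonexpansiveness reduces the claim to the
  perpendicular part before the proximal step.\<close>

lemma x_consensus: "xsq (Suc t) \<le> \<rho> * xsq t + \<eta>x\<^sup>2 / (1 - \<rho>) * vsq t"
proof -
  define U where "U = W ** X t - \<eta>x *\<^sub>R V t"
  have "norm (perp (X (Suc t))) \<le> norm (U - const_rows (row_avg U))"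
    unfolding X_Suc U_def[symmetric]
    by (rule order_trans[OF norm_perp_le_norm_diff prox_rows_const_le])
  also have "U - const_rows (row_avg U) = perp (W ** X t) - \<eta>x *\<^sub>R perp (V t)"
    by (simp add: U_def perp_def[symmetric] perp_diff perp_scaleR)
  also have "norm \<dots> \<le> \<rho> * norm (perp (X t)) + \<eta>x * norm (perp (V t))"
    using eta_pos(1) norm_perp_W_le[of "X t"] norm_triangle_ineq4[of "perp (W ** X t)" "\<eta>x *\<^sub>R perp (V t)"] by simp
  finally have "xsq (Suc t) \<le> (\<rho> * norm (perp (X t)) + \<eta>x * norm (perp (V t)))\<^sup>2"
    unfolding xsq_def by (rule power_mono) simp
  also have "\<dots> \<le> \<rho> * (norm (perp (X t)))\<^sup>2 + (\<eta>x * norm (perp (V t)))\<^sup>2 / (1 - \<rho>)"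
    by (rule convex_combination_sq[OF rho_nonneg rho_less])
  finally show ?thesis by (simp add: xsq_def vsq_def power_mult_distrib)
qed

lemma v_consensus: "vsq (Suc t) \<le> \<rho> * vsq t + dD t / (1 - \<rho>)"
proof -
  let ?A = "x_part (D (Suc t) - D t)"
  have "norm (perp (V (Suc t))) = norm (perp (W ** (V t + ?A)))"
    by (simp add: V_Suc x_part_diff add_diff_eq)
  also have "\<dots> \<le> \<rho> * norm (perp (V t + ?A))" by (rule norm_perp_W_le)
  also have "\<dots> \<le> \<rho> * (norm (perp (V t)) + norm ?A)"
    using norm_triangle_ineq[of "perp (V t)" "perp ?A"] norm_perp_le[of ?A]
    by (intro mult_left_mono rho_nonneg) (simp add: perp_add)
  also have "\<dots> \<le> \<rho> * norm (perp (V t)) + norm (D (Suc t) - D t)"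
    using mult_mono[of \<rho> 1 "norm ?A" "norm (D (Suc t) - D t)"] rho_less norm_x_part_le[of "D (Suc t) - D t"]
    by (simp add: distrib_left)
  finally have "vsq (Suc t) \<le> (\<rho> * norm (perp (V t)) + norm (D (Suc t) - D t))\<^sup>2"
    unfolding vsq_def by (rule power_mono) simp
  also have "\<dots> \<le> \<rho> * (norm (perp (V t)))\<^sup>2 + (norm (D (Suc t) - D t))\<^sup>2 / (1 - \<rho>)"
    by (rule convex_combination_sq[OF rho_nonneg rho_less])
  finally show ?thesis by (simp add: vsq_def dD_def)
qed

text \<open>In each row the three-point inequality meets the smooth lower model of \<open>f\<close>
  at the new point and the strongly concave upper model at \<open>Z\<close>. The comparison point
  stays free: the maximizer gives the contraction of \<open>ysq\<close>, and \<open>Y t\<close>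
  itself gives the decrease of the gap.\<close>

lemma Y_step:
  assumes Z: "Z \<in> domY"
  shows "H (X t) (\<Lambda> t) Z - y_part (R t) \<bullet> (Y (Suc t) - Z) + (1 / (2 * \<eta>y) - L / 2) * dY t
     + 1 / (2 * \<eta>y) * (norm (Z - Y (Suc t)))\<^sup>2 - (1 / (2 * \<eta>y) - \<mu> / 2) * (norm (Z - Y t))\<^sup>2
     \<le> H (X t) (\<Lambda> t) (Y (Suc t))"
proof -
  define c where "c = cm (\<Lambda> t)"
  define G where "G i = snd (gf i (X t $ i) (Y t $ i))" for i
  have row: "(f i (X t $ i) (Z $ i) - c $ i \<bullet> Z $ i - hr (Z $ i)) - y_part (R t) $ i \<bullet> (Y (Suc t) - Z) $ i
     + (1 / (2 * \<eta>y) - L / 2) * (norm ((Y (Suc t) - Y t) $ i))\<^sup>2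
     + 1 / (2 * \<eta>y) * (norm ((Z - Y (Suc t)) $ i))\<^sup>2 - (1 / (2 * \<eta>y) - \<mu> / 2) * (norm ((Z - Y t) $ i))\<^sup>2
     \<le> f i (X t $ i) (Y (Suc t) $ i) - c $ i \<bullet> Y (Suc t) $ i - hr (Y (Suc t) $ i)" for i
  proof -
    let ?y = "Y t $ i" and ?y' = "Y (Suc t) $ i" and ?z = "Z $ i"
    define v where "v = snd (D t $ i) - c $ i"
    have "real_of_ereal (h ?y') \<le> real_of_ereal (h ?z) + v \<bullet> (?y' - ?z)
     + 1 / (2 * \<eta>y) * ((norm (?z - ?y))\<^sup>2 - (norm (?z - ?y'))\<^sup>2 - (norm (?y' - ?y))\<^sup>2)"
      using Z by (intro prox_step[OF h_cc eta_pos(2)]) (simp_all add: domY_def Y_Suc prox_rows_def y_part_def v_def c_def cm_def)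
    moreover have "v = G i + y_part (R t) $ i - c $ i"
      by (simp add: v_def G_def R_def y_part_def grad_F_nth)
    ultimately have "hr ?y' \<le> hr ?z + G i \<bullet> (?y' - ?z) + y_part (R t) $ i \<bullet> (?y' - ?z) - c $ i \<bullet> (?y' - ?z)
     + 1 / (2 * \<eta>y) * ((norm (?z - ?y))\<^sup>2 - (norm (?z - ?y'))\<^sup>2 - (norm (?y' - ?y))\<^sup>2)"
      by (simp add: hr_def inner_add_left inner_diff_left)
    moreover have "f i (X t $ i) ?y + G i \<bullet> (?y' - ?y) - L / 2 * (norm (?y' - ?y))\<^sup>2 \<le> f i (X t $ i) ?y'"
      using f_quad_y[of i "X t $ i" ?y' ?y] unfolding abs_le_iff G_def by simp
    moreover have "f i (X t $ i) ?z \<le> f i (X t $ i) ?y + G i \<bullet> (?z - ?y) - \<mu> / 2 * (norm (?z - ?y))\<^sup>2"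
      unfolding G_def by (rule f_upper)
    moreover have "G i \<bullet> (?y' - ?z) = G i \<bullet> (?y' - ?y) - G i \<bullet> (?z - ?y)" by (simp add: inner_diff_right)
    ultimately show ?thesis
      unfolding inner_diff_right vector_minus_component left_diff_distrib right_diff_distrib by linarith
  qed
  have "H (X t) (\<Lambda> t) Z - y_part (R t) \<bullet> (Y (Suc t) - Z) + (1 / (2 * \<eta>y) - L / 2) * dY t
     + 1 / (2 * \<eta>y) * (norm (Z - Y (Suc t)))\<^sup>2 - (1 / (2 * \<eta>y) - \<mu> / 2) * (norm (Z - Y t))\<^sup>2
    = (\<Sum>i\<in>UNIV. (f i (X t $ i) (Z $ i) - c $ i \<bullet> Z $ i - hr (Z $ i)) - y_part (R t) $ i \<bullet> (Y (Suc t) - Z) $ i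
     + (1 / (2 * \<eta>y) - L / 2) * (norm ((Y (Suc t) - Y t) $ i))\<^sup>2
     + 1 / (2 * \<eta>y) * (norm ((Z - Y (Suc t)) $ i))\<^sup>2 - (1 / (2 * \<eta>y) - \<mu> / 2) * (norm ((Z - Y t) $ i))\<^sup>2)"
    unfolding H_rows dY_def norm_rows_sq inner_vec_def[of "y_part (R t)"] c_def[symmetric]
    by (simp only: sum.distrib sum_subtractf sum_distrib_left)
  also have "\<dots> \<le> H (X t) (\<Lambda> t) (Y (Suc t))"
    unfolding H_rows c_def[symmetric] by (rule sum_mono) (rule row)
  finally show ?thesis .
qed

lemma R_inner_le: "c > 0 \<Longrightarrow> y_part (R t) \<bullet> Z \<le> c / 2 * rsq t + 1 / (2 * c) * (norm Z)\<^sup>2"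
  using young_inner[of c "y_part (R t)" Z] norm_y_part_le[of "R t"]
  by (smt (verit) divide_pos_pos mult_left_mono norm_ge_zero power_mono rsq_def)

lemma del_nonneg: "0 \<le> del t"
  using Ystar_max'[OF Y_dom, of "X t" "\<Lambda> t" t] by (simp add: del_def Yt_def)

text \<open>Growth around the maximizer provides \<open>\<mu> / 2\<close> times the squared new
  distance, exactly what Young's inequality with parameter \<open>1 / \<mu>\<close> spends on
  \<open>R\<close>. The contraction factor \<open>1 - \<mu> * \<eta>y\<close> thus survives in
  full.\<close>

lemma ysq_half_step: "(norm (Yt t - Y (Suc t)))\<^sup>2 \<le> (1 - \<mu> * \<eta>y) * ysq t + \<eta>y / \<mu> * rsq t"
proof -
  let ?n = "(norm (Yt t - Y (Suc t)))\<^sup>2"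
  have m: "1 / \<mu> > 0" using mu_pos by simp
  have 1: "H (X t) (\<Lambda> t) (Y (Suc t)) + \<mu> / 2 * ?n \<le> H (X t) (\<Lambda> t) (Yt t)"
    using Ystar_max[OF Y_dom, of "X t" "\<Lambda> t" "Suc t"] by (simp add: Yt_def norm_minus_commute)
  have 2: "y_part (R t) \<bullet> (Y (Suc t) - Yt t) \<le> 1 / (2 * \<mu>) * rsq t + \<mu> / 2 * ?n"
    using R_inner_le[OF m, of t "Y (Suc t) - Yt t"] by (simp add: norm_minus_commute)
  have "(1 / (2 * \<eta>y) - L / 2) * dY t \<ge> 0"
    using eta_y_L eta_pos(2) by (intro mult_nonneg_nonneg) (auto simp: dY_def field_simps)
  then have "1 / (2 * \<eta>y) * ?n \<le> (1 / (2 * \<eta>y) - \<mu> / 2) * ysq t + 1 / (2 * \<mu>) * rsq t"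
    using Y_step[of "Yt t" t] 1 2 Ystar_dom[of "X t" "\<Lambda> t"] by (simp add: Yt_def[symmetric] ysq_def[symmetric])
  then have "(2 * \<eta>y) * (1 / (2 * \<eta>y) * ?n) \<le> (2 * \<eta>y) * ((1 / (2 * \<eta>y) - \<mu> / 2) * ysq t + 1 / (2 * \<mu>) * rsq t)"
    using eta_pos(2) by (intro mult_left_mono) auto
  also have "\<dots> = (1 - \<mu> * \<eta>y) * ysq t + \<eta>y / \<mu> * rsq t"
    using eta_pos(2) mu_pos by (simp add: field_simps)
  finally show ?thesis using eta_pos(2) by simp
qed

lemma Ystar_drift: "(norm (Yt (Suc t) - Yt t))\<^sup>2 \<le> 2 * \<kappa>\<^sup>2 * (dX t + real CARD('m) * dL t)"
proof -
  let ?a = "norm (X (Suc t) - X t)" and ?b = "sqrt (real CARD('m)) * norm (\<Lambda> (Suc t) - \<Lambda> t)"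
  have "(norm (Yt (Suc t) - Yt t))\<^sup>2 \<le> (\<kappa> * (?a + ?b))\<^sup>2"
    unfolding Yt_def by (intro power_mono Ystar_lipschitz) simp
  also have "\<dots> = \<kappa>\<^sup>2 * (norm (?a + ?b))\<^sup>2" by (simp add: power_mult_distrib)
  also have "\<dots> \<le> \<kappa>\<^sup>2 * (2 * (norm ?a)\<^sup>2 + 2 * (norm ?b)\<^sup>2)"
    by (intro mult_left_mono norm_add_sq_le) simp
  finally show ?thesis by (simp add: power_mult_distrib dX_def dL_def algebra_simps)
qed

lemma ysq_step:
  assumes c: "c > 0"
  shows "ysq (Suc t) \<le> (1 + c) * ((1 - \<mu> * \<eta>y) * ysq t + \<eta>y / \<mu> * rsq t)
     + (1 + 1 / c) * (2 * \<kappa>\<^sup>2 * (dX t + real CARD('m) * dL t))"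
proof -
  have "ysq (Suc t) = (norm ((Yt t - Y (Suc t)) + (Yt (Suc t) - Yt t)))\<^sup>2" by (simp add: ysq_def)
  also have "\<dots> \<le> (1 + c) * (norm (Yt t - Y (Suc t)))\<^sup>2 + (1 + 1 / c) * (norm (Yt (Suc t) - Yt t))\<^sup>2"
    by (rule young_norm_add[OF c])
  also have "\<dots> \<le> (1 + c) * ((1 - \<mu> * \<eta>y) * ysq t + \<eta>y / \<mu> * rsq t)
     + (1 + 1 / c) * (2 * \<kappa>\<^sup>2 * (dX t + real CARD('m) * dL t))"
    using c by (intro add_mono mult_left_mono ysq_half_step Ystar_drift) auto
  finally show ?thesis .
qed

text \<open>Moving \<open>X\<close> and \<Lambda> changes both terms of the gap; the two changes
  differ only by a mixed difference, a product of the distance to the maximizer and the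
  displacement. \<open>\<theta>\<close> determines how this product is split.\<close>

lemma del_step:
  assumes th: "\<theta> > 0"
  shows "del (Suc t) - del t \<le> - (2 / 5) / \<eta>y * dY t + \<eta>y / 2 * rsq t
    + L * \<theta> * ysq (Suc t) + L / (2 * \<theta>) * (dX t + real CARD('m) * dL t)"
proof -
  let ?a = "norm (X (Suc t) - X t)" and ?b = "sqrt (real CARD('m)) * norm (\<Lambda> (Suc t) - \<Lambda> t)"
  let ?n = "norm (Yt (Suc t) - Y (Suc t))"
  have 1: "H (X t) (\<Lambda> t) (Y t) - y_part (R t) \<bullet> (Y (Suc t) - Y t) + (1 / (2 * \<eta>y) - L / 2) * dY t
     + 1 / (2 * \<eta>y) * dY t \<le> H (X t) (\<Lambda> t) (Y (Suc t))"
    using Y_step[OF Y_dom, of t t] by (simp add: dY_def norm_minus_commute)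
  have 2: "y_part (R t) \<bullet> (Y (Suc t) - Y t) \<le> \<eta>y / 2 * rsq t + 1 / (2 * \<eta>y) * dY t"
    unfolding dY_def by (rule R_inner_le[OF eta_pos(2)])
  \<comment> \<open>As \<open>\<eta>y * L\<close> is at most \<open>1 / 5\<close>, the loss
    \<open>L / 2\<close> is at most \<open>(1 / 10) / \<eta>y\<close>.\<close>
  have "(2 / 5) / \<eta>y \<le> 1 / (2 * \<eta>y) - L / 2" using eta_y_L eta_pos(2) by (simp add: field_simps)
  then have "(2 / 5) / \<eta>y * dY t \<le> (1 / (2 * \<eta>y) - L / 2) * dY t"
    by (rule mult_right_mono) (simp add: dY_def)
  then have 3: "H (X t) (\<Lambda> t) (Y t) - H (X t) (\<Lambda> t) (Y (Suc t)) \<le> \<eta>y / 2 * rsq t - (2 / 5) / \<eta>y * dY t"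
    using 1 2 by linarith
  \<comment> \<open>The new maximizer is a mere competitor for the old data.\<close>
  have 4: "H (X t) (\<Lambda> t) (Yt (Suc t)) \<le> H (X t) (\<Lambda> t) (Yt t)"
    unfolding Yt_def[of t] by (rule Ystar_max') (simp add: Yt_def Ystar_dom)
  have 5: "(H (X (Suc t)) (\<Lambda> (Suc t)) (Yt (Suc t)) - H (X t) (\<Lambda> t) (Yt (Suc t)))
     - (H (X (Suc t)) (\<Lambda> (Suc t)) (Y (Suc t)) - H (X t) (\<Lambda> t) (Y (Suc t))) \<le> L * ?n * (?a + ?b)"
    by (rule order_trans[OF abs_ge_self H_mixed])
  have "?n * (?a + ?b) \<le> \<theta> * ?n\<^sup>2 + 1 / (2 * \<theta>) * (?a\<^sup>2 + ?b\<^sup>2)"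
    using young_inner[OF th, of ?n ?a] young_inner[OF th, of ?n ?b] by (simp add: distrib_left power_mult_distrib)
  then have "L * (?n * (?a + ?b)) \<le> L * (\<theta> * ?n\<^sup>2 + 1 / (2 * \<theta>) * (?a\<^sup>2 + ?b\<^sup>2))"
    by (rule mult_left_mono[OF _ L_nonneg])
  also have "\<dots> = L * \<theta> * ysq (Suc t) + L / (2 * \<theta>) * (dX t + real CARD('m) * dL t)"
    by (simp add: ysq_def dX_def dL_def power_mult_distrib distrib_left)
  finally show ?thesis using 3 4 5 unfolding del_def by (simp add: mult.assoc)
qed

text \<open>The perpendicular part of the displacement is bounded by the consensus errors at its two
  ends, the later one again through \<open>x_consensus\<close>.\<close>

lemma dX_bound: "dX t \<le> real CARD('m) * dxb t + 4 * xsq t + 2 * \<eta>x\<^sup>2 / (1 - \<rho>) * vsq t"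
proof -
  have "dX t = real CARD('m) * dxb t + (norm (perp (X (Suc t)) - perp (X t)))\<^sup>2"
    unfolding dX_def norm_sq_avg_perp[of "X (Suc t) - X t"] by (simp add: dxb_def xb_def row_avg_diff perp_diff)
  also have "\<dots> \<le> real CARD('m) * dxb t + (2 * xsq (Suc t) + 2 * xsq t)"
    unfolding xsq_def by (intro add_left_mono norm_diff_sq_le)
  also have "\<dots> \<le> real CARD('m) * dxb t + (2 * (\<rho> * xsq t + \<eta>x\<^sup>2 / (1 - \<rho>) * vsq t) + 2 * xsq t)"
    using x_consensus[of t] by simp
  also have "\<rho> * xsq t \<le> 1 * xsq t" using rho_less by (intro mult_right_mono) (auto simp: xsq_def)
  finally show ?thesis by simp
qed

text \<open>The exact proximal point \<open>xh\<close> is compared with the average of the actual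
  next iterate; the rest of the way is the actual displacement.\<close>

lemma gm_bound: "real CARD('m) * gmsq t \<le> 2 * real CARD('m) / \<eta>x\<^sup>2 * dxb t + 2 * (real CARD('m) * gvsq t)
    + 4 / \<eta>x\<^sup>2 * xsq t + 4 * vsq t"
proof -
  let ?m = "real CARD('m)"
  define u where "u = xb t - \<eta>x *\<^sub>R gP (xb t) (\<Lambda> t)"
  define xh where "xh = prox (\<lambda>v. ereal \<eta>x * g v) u"
  define U where "U = W ** X t - \<eta>x *\<^sub>R V t"
  have "?m * (norm (xb (Suc t) - xh))\<^sup>2 \<le> (norm (X (Suc t) - const_rows xh))\<^sup>2"
    using norm_row_avg_sq_le[of "X (Suc t) - const_rows xh"] by (simp add: row_avg_diff xb_def)
  also have "\<dots> \<le> (norm (U - const_rows u))\<^sup>2"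
    unfolding X_Suc U_def[symmetric] xh_def by (intro power_mono prox_rows_const_le) simp
  also have "\<dots> = ?m * (norm (\<eta>x *\<^sub>R (gP (xb t) (\<Lambda> t) - row_avg (V t))))\<^sup>2
      + (norm (perp (W ** X t) - \<eta>x *\<^sub>R perp (V t)))\<^sup>2"
    unfolding norm_sq_avg_perp[of "U - const_rows u"]
    by (simp add: U_def u_def perp_diff perp_scaleR row_avg_diff row_avg_scaleR xb_def[symmetric] scaleR_diff_right)
  also have "\<dots> \<le> ?m * (norm (\<eta>x *\<^sub>R (gP (xb t) (\<Lambda> t) - row_avg (V t))))\<^sup>2
      + (2 * xsq t + 2 * (norm (\<eta>x *\<^sub>R perp (V t)))\<^sup>2)"
    using norm_diff_sq_le[of "perp (W ** X t)" "\<eta>x *\<^sub>R perp (V t)"] perp_WX_sq[of t] by simp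
  also have "\<dots> = \<eta>x\<^sup>2 * (?m * gvsq t) + 2 * xsq t + 2 * \<eta>x\<^sup>2 * vsq t"
    by (simp add: power_mult_distrib gvsq_def vsq_def)
  finally have 1: "?m * (norm (xb (Suc t) - xh))\<^sup>2 \<le> \<dots>" .
  have "gmsq t = (norm (xb t - xh))\<^sup>2 / \<eta>x\<^sup>2"
    by (simp add: gmsq_def xh_def u_def power_mult_distrib power_divide)
  moreover have "(norm (xb t - xh))\<^sup>2 \<le> 2 * dxb t + 2 * (norm (xb (Suc t) - xh))\<^sup>2"
    using norm_diff_sq_le[of "xb (Suc t) - xh" "xb (Suc t) - xb t"] by (simp add: dxb_def)
  ultimately have "\<eta>x\<^sup>2 * (?m * gmsq t) \<le> ?m * (2 * dxb t + 2 * (norm (xb (Suc t) - xh))\<^sup>2)"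
    using eta_pos(1) by simp
  also have "\<dots> \<le> 2 * ?m * dxb t + 2 * (\<eta>x\<^sup>2 * (?m * gvsq t) + 2 * xsq t + 2 * \<eta>x\<^sup>2 * vsq t)"
    using 1 by (simp add: algebra_simps)
  also have "\<dots> = \<eta>x\<^sup>2 * (2 * ?m / \<eta>x\<^sup>2 * dxb t + 2 * (?m * gvsq t) + 4 / \<eta>x\<^sup>2 * xsq t + 4 * vsq t)"
    using eta_pos(1) by (simp add: field_simps)
  finally show ?thesis using eta_pos(1) by simp
qed

end

section \<open>The Lyapunov function\<close>

text \<open>The weighted sum of all one-step estimates, linear in the squared quantities once their
  coefficients are abstracted; the step sizes then only have to satisfy \<open>c1\<close> to
  \<open>c6\<close>. In the application \<open>a\<close>, \<open>l\<close>, \<open>p\<close>,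
  \<open>G\<close>, \<open>M\<close> are \<open>m\<close> times \<open>dxb\<close>,
  \<open>dL\<close>, \<open>psq\<close>, \<open>gvsq\<close>, \<open>gmsq\<close>; \<open>x\<close>,
  \<open>v\<close>, \<open>y\<close>, \<open>r\<close>, \<open>e\<close> are the other squares;
  \<open>n\<close> and \<open>i\<close> are \<open>\<eta>x\<close> and its inverse, \<open>j\<close>
  the inverse of \<open>\<eta>L\<close>; \<open>K\<close> is
  \<open>\<kappa>\<^sup>2 * L * cU\<close>.\<close>

lemma lyapunov_arith:
  fixes a l p x v y r dX dY dD G M e :: real
  assumes nn: "0 \<le> a" "0 \<le> l" "0 \<le> x" "0 \<le> v" "0 \<le> y" "0 \<le> r" "0 \<le> dX" "0 \<le> dY" "0 \<le> G" "0 \<le> e"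
    and cn: "0 \<le> n" "0 \<le> nl" "0 \<le> eL" "0 \<le> K" "0 \<le> Zr"
    and F1: "Dph \<le> - (i / 2 - 5 / 2 * Lk) * a - (j / 2 - 5 / 2 * Lk) * l - nL / 2 * p
                + eL / 2 * e + n / 2 * G + n / 2 * v + i / 2 * x"
    and F2: "n * G \<le> 2 * nl * (x + e) + 2 * n * r"
    and F3: "e \<le> 2 * k2 * x + 2 * y"
    and F4: "q * (x' - x) \<le> - 2 * i * x + qv * v"
    and F5: "vv * (v' - v) \<le> - v0 * v + B0 * dD"
    and F6: "(w + z) * y' \<le> w * y - 2 / 5 * Zy * y + 5 / 4 * Zr * r + 5 * K * (dX + l)"
    and F7: "dd * Dd \<le> - (6 / 5) * LU * dY + 3 / 2 * Zr * r + z * y' + 30 * K * (dX + l)"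
    and F8: "dX \<le> a + 4 * x + xv * v"
    and F9: "n / 50 * M \<le> i / 25 * a + n / 25 * G + 4 / 50 * i * x + 4 / 50 * n * v"
    and c1: "576 * K \<le> i" "Lk \<le> K" "LU \<le> K" "40 * K \<le> j / 2" "0 \<le> LU"
    and c3: "nl * k2 \<le> K" "eL * k2 \<le> K" "nl \<le> K"
    and c4: "54 / 25 * nl + eL \<le> 2 / 5 * Zy"
    and c5: "n \<le> Zr"
    and c6: "n / 2 + 4 / 50 * n + 37 * K * xv + qv \<le> v0"
  shows "Dph + dd * Dd + w * (y' - y) + vv * (v' - v) + q * (x' - x)
      + (n / 50 * M + nl / 50 * x + nL / 2 * p) + 23 / 20 * LU * (dX + dY) \<le> 56 / 5 * Zr * r + B0 * dD"
proof -
  \<comment> \<open>\<open>27 / 25\<close> collects \<open>n / 2\<close> from \<open>F1\<close> and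
    \<open>n / 25\<close> from \<open>F9\<close>, doubled by \<open>F2\<close>.\<close>
  have s1: "(27/25 * nl + eL / 2) * e \<le> (27/25 * nl + eL / 2) * (2 * k2 * x + 2 * y)"
    using cn F3 by (intro mult_left_mono) auto
  \<comment> \<open>\<open>35 * K\<close> adds the \<open>5 * K\<close> of \<open>F6\<close> to the
    \<open>30 * K\<close> of \<open>F7\<close>; \<open>LU\<close> is at most \<open>K\<close>, which
    explains \<open>37\<close>.\<close>
  have s2: "(35 * K + 23 / 20 * LU) * dX \<le> 37 * K * (a + 4 * x + xv * v)"
    using c1 cn nn F8 by (intro mult_mono) auto
  \<comment> \<open>From here, one inequality per quantity: the total coefficients of
    \<open>a\<close>, \<open>l\<close>, \<open>x\<close>, \<open>v\<close> and \<open>y\<close> are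
    nonpositive, that of \<open>r\<close> stays within the allowed price, and \<open>dY\<close> is
    paid by the gap.\<close>
  have a: "(- (i / 2 - 5 / 2 * Lk) + i / 25 + 37 * K) * a \<le> 0 * a"
    using c1 cn nn by (intro mult_right_mono) linarith+
  have l: "(- (j / 2 - 5 / 2 * Lk) + 35 * K) * l \<le> 0 * l"
    using c1 cn nn by (intro mult_right_mono) linarith+
  have x: "(i / 2 + 27/25 * nl + 2 * (27/25 * (nl * k2)) + eL * k2 + 148 * K - 2 * i + 4 / 50 * i + nl / 50) * x \<le> 0 * x"
    using c1 c3 cn nn by (intro mult_right_mono) linarith+
  have v: "(n / 2 + 4 / 50 * n + 37 * K * xv + qv - v0) * v \<le> 0 * v"
    using c6 nn by (intro mult_right_mono) linarith+
  have y: "(54 / 25 * nl + eL - 2 / 5 * Zy) * y \<le> 0 * y"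
    using c4 nn by (intro mult_right_mono) linarith+
  have r: "(27/25 * n + 5/4 * Zr + 3 / 2 * Zr) * r \<le> 56 / 5 * Zr * r"
    using c5 nn cn by (intro mult_right_mono) linarith+
  have dY: "23 / 20 * LU * dY \<le> 6 / 5 * LU * dY"
    using c1 nn by (intro mult_right_mono) linarith+
  have "Dph + n / 50 * M \<le> - (i / 2 - 5 / 2 * Lk) * a + i / 25 * a - (j / 2 - 5 / 2 * Lk) * l - nL / 2 * p
      + (27/25 * nl + eL / 2) * e + 27/25 * (nl * x) + 27/25 * (n * r) + (n / 2 + 4 / 50 * n) * v + (i / 2 + 4 / 50 * i) * x"
    using F1 F9 F2 by (simp add: algebra_simps add_divide_distrib)
  also have "\<dots> \<le> - (i / 2 - 5 / 2 * Lk) * a + i / 25 * a - (j / 2 - 5 / 2 * Lk) * l - nL / 2 * p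
      + (27/25 * nl + eL / 2) * (2 * k2 * x + 2 * y) + 27/25 * (nl * x) + 27/25 * (n * r) + (n / 2 + 4 / 50 * n) * v + (i / 2 + 4 / 50 * i) * x"
    using s1 by simp
  finally have h1: "Dph + n / 50 * M \<le> \<dots>" .
  have h2: "dd * Dd + w * (y' - y) \<le> - (6 / 5) * LU * dY + (11 / 4) * (Zr * r) - 2 / 5 * Zy * y + 35 * K * dX + 35 * K * l"
    using F6 F7 by (simp add: algebra_simps add_divide_distrib)
  have h3: "35 * K * dX + 23 / 20 * LU * (dX + dY) \<le> 37 * K * a + 148 * K * x + 37 * K * xv * v + 6 / 5 * LU * dY"
    using s2 dY by (simp add: algebra_simps add_divide_distrib)
  have h4: "Dph + n / 50 * M + (dd * Dd + w * (y' - y)) + vv * (v' - v) + q * (x' - x) + 23 / 20 * LU * (dX + dY)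
     + nl / 50 * x + nL / 2 * p
    \<le> (- (i / 2 - 5 / 2 * Lk) + i / 25 + 37 * K) * a + (- (j / 2 - 5 / 2 * Lk) + 35 * K) * l
      + (i / 2 + 27/25 * nl + 2 * (27/25 * (nl * k2)) + eL * k2 + 148 * K - 2 * i + 4 / 50 * i + nl / 50) * x
      + (n / 2 + 4 / 50 * n + 37 * K * xv + qv - v0) * v + (54 / 25 * nl + eL - 2 / 5 * Zy) * y
      + (27/25 * n + 5/4 * Zr + 3 / 2 * Zr) * r + B0 * dD"
    using add_mono[OF add_mono[OF add_mono[OF h1 h2] h3] add_mono[OF F4 F5]] by (simp add: algebra_simps add_divide_distrib)
  then show ?thesis using a l x v y r by (simp add: algebra_simps add_divide_distrib)
qed

section \<open>Numerical consequences of the step sizes\<close>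

context vrlm
begin

text \<open>Up to the factors depending only on \<open>m\<close>, \<open>L\<close>, \<open>\<kappa>\<close>, \<open>\<rho>\<close> and \<open>\<beta>\<close>, the coefficients of the squared norms of \<open>R\<close>
  and of \<open>Y\<close> minus its maximizer in \<open>C\<^sub>0\<close> are multiples of \<open>cU\<close>.\<close>

definition "cA = (1 + 1 / L) / sqrt \<beta>"
definition "cB = 1 / (\<kappa> * (1 - \<rho>)\<^sup>2)"
definition "cU = cA + cB / 2"
definition "vs = \<eta>y * L"

lemma sb: "0 < sqrt \<beta>" "sqrt \<beta> < 1" using beta by simp_all

lemma cA_ge: "1 / sqrt \<beta> \<le> cA" "1 \<le> cA" "0 < cA"
proof -
  show 1: "1 / sqrt \<beta> \<le> cA" unfolding cA_def using L_pos sb by (intro divide_right_mono) auto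
  have "1 \<le> 1 / sqrt \<beta>" using sb by simp
  then show "1 \<le> cA" "0 < cA" using 1 by linarith+
qed

lemma cB_pos: "0 < cB" using kappa_ge1 rho_less by (simp add: cB_def)

lemma cU_ge: "1 \<le> cU" "cA \<le> cU" "cB \<le> 2 * cU" using cA_ge cB_pos by (simp_all add: cU_def)

lemma L_cA: "L * cA = (L + 1) / sqrt \<beta>"
  using L_pos sb by (simp add: cA_def field_simps)

text \<open>The minimum turns into two lower bounds on the inverse: the branch with the spectral gap
  is a multiple of \<open>L * cB\<close>, the branch with \<open>sqrt \<beta>\<close> a multiple of
  \<open>L * cA\<close>.\<close>

lemma inv_eta_x:
  "40 * L * (24 * \<kappa>\<^sup>2 + 8 * \<kappa> + 5) * cB \<le> 1 / \<eta>x" "48 * (24 * \<kappa>\<^sup>2 + 7 * \<kappa> + 4) * (L * cA) \<le> 1 / \<eta>x"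
proof -
  have p: "24 * \<kappa>\<^sup>2 + 8 * \<kappa> + 5 > 0" "24 * \<kappa>\<^sup>2 + 7 * \<kappa> + 4 > 0"
    using kappa_ge1 by (auto intro!: add_nonneg_pos add_nonneg_nonneg)
  have "1 / (\<kappa> * (1 - \<rho>)\<^sup>2 / (40 * L * (24 * \<kappa>\<^sup>2 + 8 * \<kappa> + 5))) \<le> 1 / \<eta>x"
    by (intro divide_left_mono) (use p eta_pos L_pos kappa_ge1 rho_less in \<open>auto simp: eta_x intro!: mult_pos_pos divide_pos_pos\<close>)
  then show "40 * L * (24 * \<kappa>\<^sup>2 + 8 * \<kappa> + 5) * cB \<le> 1 / \<eta>x" by (simp add: cB_def)
  have "1 / (sqrt \<beta> / (48 * (L + 1) * (24 * \<kappa>\<^sup>2 + 7 * \<kappa> + 4))) \<le> 1 / \<eta>x"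
    by (intro divide_left_mono) (use p eta_pos L_pos sb in \<open>auto simp: eta_x intro!: mult_pos_pos divide_pos_pos\<close>)
  then show "48 * (24 * \<kappa>\<^sup>2 + 7 * \<kappa> + 4) * (L * cA) \<le> 1 / \<eta>x"
    unfolding L_cA by (simp only: divide_divide_eq_right times_divide_eq_right times_divide_eq_left mult_1 ac_simps)
qed

lemma inv_eta_L:
  "4 * L * (20 * \<kappa> + 3) * (\<kappa> * cB) \<le> 1 / \<eta>L" "4 * (52 * \<kappa>\<^sup>2 + \<kappa> + 1) * (L * cA) \<le> 1 / \<eta>L"
proof -
  have p: "20 * \<kappa> + 3 > 0" "52 * \<kappa>\<^sup>2 + \<kappa> + 1 > 0"
    using kappa_ge1 by (auto intro!: add_nonneg_pos add_nonneg_nonneg)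
  have "1 / ((1 - \<rho>)\<^sup>2 / (4 * L * (20 * \<kappa> + 3))) \<le> 1 / \<eta>L"
    by (intro divide_left_mono) (use p eta_pos L_pos rho_less in \<open>auto simp: eta_L intro!: mult_pos_pos divide_pos_pos\<close>)
  moreover have "\<kappa> * cB = 1 / (1 - \<rho>)\<^sup>2" using kappa_ge1 by (simp add: cB_def)
  ultimately show "4 * L * (20 * \<kappa> + 3) * (\<kappa> * cB) \<le> 1 / \<eta>L" by simp
  have "1 / (sqrt \<beta> / (4 * (L + 1) * (52 * \<kappa>\<^sup>2 + \<kappa> + 1))) \<le> 1 / \<eta>L"
    by (intro divide_left_mono) (use p eta_pos L_pos sb in \<open>auto simp: eta_L intro!: mult_pos_pos divide_pos_pos\<close>)
  then show "4 * (52 * \<kappa>\<^sup>2 + \<kappa> + 1) * (L * cA) \<le> 1 / \<eta>L"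
    unfolding L_cA by (simp only: divide_divide_eq_right times_divide_eq_right times_divide_eq_left mult_1 ac_simps)
qed

text \<open>The average of the two branches: \<open>576\<close> is half of \<open>48 * 24\<close>,
  and half of \<open>40 * 24\<close> more than covers the share \<open>cB / 2\<close> in
  \<open>cU\<close>.\<close>

lemma eta_x_U: "576 * (\<kappa>\<^sup>2 * L * cU) \<le> 1 / \<eta>x"
proof -
  have "(L * cB) * (960 * \<kappa>\<^sup>2) \<le> (L * cB) * (40 * (24 * \<kappa>\<^sup>2 + 8 * \<kappa> + 5))"
    using kappa_ge1 L_pos cB_pos by (intro mult_left_mono) auto
  moreover have "(L * cA) * (1152 * \<kappa>\<^sup>2) \<le> (L * cA) * (48 * (24 * \<kappa>\<^sup>2 + 7 * \<kappa> + 4))"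
    using kappa_ge1 L_pos cA_ge by (intro mult_left_mono) auto
  moreover have "0 \<le> \<kappa>\<^sup>2 * (L * cB)" using L_pos cB_pos by simp
  ultimately show ?thesis using inv_eta_x unfolding cU_def by (simp add: algebra_simps)
qed

lemma eta_L_U: "40 * (\<kappa>\<^sup>2 * L * cU) \<le> 1 / \<eta>L / 2"
proof -
  have "(L * cB) * (20 * \<kappa>\<^sup>2) \<le> (L * cB) * ((20 * \<kappa> + 3) * \<kappa>)"
    using kappa_ge1 L_pos cB_pos by (intro mult_left_mono) (auto simp: power2_eq_square algebra_simps)
  moreover have "(L * cA) * (40 * \<kappa>\<^sup>2) \<le> (L * cA) * (52 * \<kappa>\<^sup>2 + \<kappa> + 1)"
  proof (intro mult_left_mono)
    have "0 \<le> 12 * \<kappa>\<^sup>2 + \<kappa> + 1" using kappa_ge1 by (intro add_nonneg_nonneg) auto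
    then show "40 * \<kappa>\<^sup>2 \<le> 52 * \<kappa>\<^sup>2 + \<kappa> + 1" by simp
  qed (use L_pos cA_ge in simp)
  ultimately show ?thesis using inv_eta_L unfolding cU_def by (simp add: algebra_simps)
qed

lemma eta_x_rho: "960 * \<kappa> * L * \<eta>x \<le> (1 - \<rho>)\<^sup>2"
proof -
  have "(L * cB) * (960 * \<kappa>\<^sup>2) \<le> (L * cB) * (40 * (24 * \<kappa>\<^sup>2 + 8 * \<kappa> + 5))"
    using kappa_ge1 L_pos cB_pos by (intro mult_left_mono) auto
  then have "960 * \<kappa>\<^sup>2 * L * cB \<le> 1 / \<eta>x" using inv_eta_x(1) by (simp add: ac_simps)
  moreover have "960 * \<kappa>\<^sup>2 * L * cB = 960 * \<kappa> * L / (1 - \<rho>)\<^sup>2"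
    using kappa_ge1 by (simp add: cB_def power2_eq_square)
  ultimately have "960 * \<kappa> * L / (1 - \<rho>)\<^sup>2 \<le> 1 / \<eta>x" by simp
  then show ?thesis using eta_pos rho_less by (simp add: field_simps)
qed

text \<open>Since \<open>cA\<close> is at least \<open>1 / sqrt \<beta>\<close>,
  \<open>\<beta> * cA\<^sup>2\<close> is at least \<open>1\<close>. This converts step size bounds
  by \<open>1 / cA\<close> into bounds by \<open>\<beta> * cU\<close>, the scale of the gain in
  \<open>ysq\<close>.\<close>

lemma beta_U: "1 / cA \<le> \<beta> * cU"
proof -
  have "1 = (sqrt \<beta> * (1 / sqrt \<beta>))\<^sup>2" using sb by simp
  also have "\<dots> \<le> (sqrt \<beta> * cA)\<^sup>2" using sb cA_ge by (intro power_mono mult_left_mono) auto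
  also have "\<dots> = \<beta> * cA * cA" using beta by (simp add: power2_eq_square power_mult_distrib)
  also have "\<dots> \<le> \<beta> * cU * cA" using beta cU_ge cA_ge by (intro mult_right_mono mult_left_mono) auto
  finally show ?thesis using cA_ge by (simp add: field_simps)
qed

lemma eta_x_beta: "1152 * \<kappa>\<^sup>2 * L * \<eta>x \<le> \<beta> * cU"
proof -
  have "(L * cA) * (1152 * \<kappa>\<^sup>2) \<le> (L * cA) * (48 * (24 * \<kappa>\<^sup>2 + 7 * \<kappa> + 4))"
    using kappa_ge1 L_pos cA_ge by (intro mult_left_mono) auto
  then have "(L * cA) * (1152 * \<kappa>\<^sup>2) \<le> 1 / \<eta>x" using inv_eta_x(2) by (simp add: ac_simps)
  then have "1152 * \<kappa>\<^sup>2 * L * \<eta>x \<le> 1 / cA" using eta_pos cA_ge by (simp add: field_simps)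
  then show ?thesis using beta_U by linarith
qed

lemma eta_L_beta: "208 * \<kappa>\<^sup>2 * L * \<eta>L \<le> \<beta> * cU"
proof -
  have "(L * cA) * (208 * \<kappa>\<^sup>2) \<le> (L * cA) * (4 * (52 * \<kappa>\<^sup>2 + \<kappa> + 1))"
    using kappa_ge1 L_pos cA_ge by (intro mult_left_mono) auto
  then have "(L * cA) * (208 * \<kappa>\<^sup>2) \<le> 1 / \<eta>L" using inv_eta_L(2) by (simp add: ac_simps)
  then have "208 * \<kappa>\<^sup>2 * L * \<eta>L \<le> 1 / cA" using eta_pos cA_ge by (simp add: field_simps)
  then show ?thesis using beta_U by linarith
qed

text \<open>\<open>vs\<close> is the step size in \<open>Y\<close> in units of \<open>1 / L\<close>.
  The equation for \<open>\<beta>\<close> expresses the constant \<open>4 * sqrt 2\<close> and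
  trades the factors \<open>vs\<^sup>2\<close> of the Lyapunov step for the \<open>\<beta>\<close>
  of STORM.\<close>

lemma vs: "0 < vs" "vs \<le> 1 / 5" "\<beta> = 32 * vs\<^sup>2" "\<mu> * \<eta>y = vs / \<kappa>" "\<eta>y / \<mu> = vs * \<kappa> / L\<^sup>2"
proof -
  show "0 < vs" using eta_pos L_pos by (simp add: vs_def)
  show "vs \<le> 1 / 5" using eta_y_L by (simp add: vs_def)
  have "vs = sqrt \<beta> / (4 * sqrt 2)" unfolding vs_def unfolding eta_y using L_pos by simp
  then show "\<beta> = 32 * vs\<^sup>2" using beta by (simp add: power_divide power_mult_distrib)
  show "\<mu> * \<eta>y = vs / \<kappa>" "\<eta>y / \<mu> = vs * \<kappa> / L\<^sup>2"
    using L_pos mu_pos by (simp_all add: vs_def \<kappa>_def power2_eq_square)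
qed

text \<open>The weights stay below the coefficients that \<open>C\<^sub>0\<close> allows (see \<open>initial_budget\<close>); \<open>wx\<close> is free because the
  initial iterates are in consensus.\<close>

definition "wd = 3 * vs * cU"
definition "wy = 11 / 10 * vs * L * cU / \<kappa>"
definition "wv = (1 - \<rho>) * cB / (40 * L)"
definition "wx = 2 / (\<eta>x * (1 - \<rho>))"

lemma weights_nonneg: "0 \<le> wd" "0 \<le> wy" "0 \<le> wv" "0 \<le> wx"
  using vs(1) cU_ge L_pos kappa_ge1 rho_less cB_pos eta_pos
  by (simp_all add: wd_def wy_def wv_def wx_def)

end

section \<open>Weighted one-step estimates\<close>

context vrlm_path
begin

lemma seq_nonneg: "0 \<le> ysq t" "0 \<le> esq t" "0 \<le> xsq t" "0 \<le> vsq t" "0 \<le> rsq t" "0 \<le> psq t"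
  "0 \<le> gvsq t" "0 \<le> gmsq t" "0 \<le> dxb t" "0 \<le> dL t" "0 \<le> dX t" "0 \<le> dY t" "0 \<le> dD t"
  by (simp_all add: ysq_def esq_def xsq_def vsq_def rsq_def psq_def gvsq_def gmsq_def dxb_def dL_def dX_def dY_def dD_def)

text \<open>The weight added to \<open>wy\<close> on the left is a reserve: it pays for the term in
  \<open>ysq (Suc t)\<close> created by \<open>del_weighted_step\<close>.\<close>

lemma ysq_weighted_step:
  "(wy + 3 / 20 * (vs\<^sup>2 * L * cU / \<kappa>\<^sup>2)) * ysq (Suc t)
    \<le> wy * ysq t - 2 / 5 * (vs\<^sup>2 * L * cU / \<kappa>\<^sup>2) * ysq t + 5 / 4 * (vs\<^sup>2 * cU / L) * rsq t
      + 5 * (\<kappa>\<^sup>2 * L * cU) * (dX t + real CARD('m) * dL t)"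
proof -
  \<comment> \<open>The contraction rate \<open>\<mu> * \<eta>y\<close>. Young's inequality with
    \<open>\<epsilon> / 2\<close> gives up half of it to the drift of the maximizer.\<close>
  define \<epsilon> where "\<epsilon> = vs / \<kappa>"
  define Wt where "Wt = wy + 3 / 20 * (vs\<^sup>2 * L * cU / \<kappa>\<^sup>2)"
  have k: "1 \<le> \<kappa>" by (rule kappa_ge1)
  have eps: "0 < \<epsilon>" "\<epsilon> \<le> 1 / 5"
  proof -
    show "0 < \<epsilon>" using vs(1) k by (simp add: \<epsilon>_def)
    have "vs \<le> 1 / 5 * \<kappa>" using vs(2) k by linarith
    then show "\<epsilon> \<le> 1 / 5" using k by (simp add: \<epsilon>_def field_simps)
  qed
  have Wt: "Wt = (vs * L * cU / \<kappa>) * (11 / 10 + 3 / 20 * \<epsilon>)"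
    using k by (simp add: Wt_def wy_def \<epsilon>_def power2_eq_square field_simps)
  have b0: "0 \<le> vs * L * cU / \<kappa>" using vs(1) L_pos cU_ge k by simp
  have Wt0: "0 \<le> Wt" unfolding Wt using eps by (intro mult_nonneg_nonneg b0) simp
  have "11 / 10 + 3 / 20 * \<epsilon> \<le> 113 / 100" using eps by simp
  then have Wt1: "Wt \<le> (vs * L * cU / \<kappa>) * (113 / 100)" unfolding Wt by (rule mult_left_mono) (rule b0)
  have "ysq (Suc t) \<le> (1 + \<epsilon> / 2) * ((1 - \<epsilon>) * ysq t + vs * \<kappa> / L\<^sup>2 * rsq t)
     + (1 + 1 / (\<epsilon> / 2)) * (2 * \<kappa>\<^sup>2 * (dX t + real CARD('m) * dL t))"
    using ysq_step[of "\<epsilon> / 2" t] eps by (simp add: vs(4,5) \<epsilon>_def)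
  then have "Wt * ysq (Suc t) \<le> Wt * ((1 + \<epsilon> / 2) * ((1 - \<epsilon>) * ysq t + vs * \<kappa> / L\<^sup>2 * rsq t)
     + (1 + 1 / (\<epsilon> / 2)) * (2 * \<kappa>\<^sup>2 * (dX t + real CARD('m) * dL t)))"
    using Wt0 by (rule mult_left_mono)
  also have "\<dots> = (Wt * ((1 + \<epsilon> / 2) * (1 - \<epsilon>))) * ysq t + (Wt * (1 + \<epsilon> / 2) * (vs * \<kappa> / L\<^sup>2)) * rsq t
     + (Wt * (1 + 1 / (\<epsilon> / 2)) * (2 * \<kappa>\<^sup>2)) * (dX t + real CARD('m) * dL t)"
    by (simp only: algebra_simps)
  also have "\<dots> \<le> (wy - 2 / 5 * (vs\<^sup>2 * L * cU / \<kappa>\<^sup>2)) * ysq t + (5 / 4 * (vs\<^sup>2 * cU / L)) * rsq t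
     + (5 * (\<kappa>\<^sup>2 * L * cU)) * (dX t + real CARD('m) * dL t)"
  proof (intro add_mono mult_right_mono)
    have "(1 + \<epsilon> / 2) * (1 - \<epsilon>) \<le> 1 - \<epsilon> / 2" by (simp add: algebra_simps)
    then have "Wt * ((1 + \<epsilon> / 2) * (1 - \<epsilon>)) \<le> Wt * (1 - \<epsilon> / 2)" using Wt0 by (rule mult_left_mono)
    \<comment> \<open>Half of the rate contributes \<open>11 / 20\<close> and the reserve costs
      \<open>3 / 20\<close>, so \<open>2 / 5\<close> remains.\<close>
    also have "\<dots> = wy + (vs * L * cU / \<kappa>) * (3 / 20 * \<epsilon> - 11 / 20 * \<epsilon> - 3 / 40 * \<epsilon>\<^sup>2)"
    proof -
      have "q * (11 / 10 + 3 / 20 * \<epsilon>) * (1 - \<epsilon> / 2) = q * (11 / 10) + q * (3 / 20 * \<epsilon> - 11 / 20 * \<epsilon> - 3 / 40 * \<epsilon>\<^sup>2)" for q :: real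
        by (simp add: power2_eq_square algebra_simps add_divide_distrib diff_divide_distrib)
      moreover have "wy = (vs * L * cU / \<kappa>) * (11 / 10)" by (simp add: wy_def)
      ultimately show ?thesis unfolding Wt by (simp only:)
    qed
    also have "\<dots> \<le> wy + (vs * L * cU / \<kappa>) * (- 2 / 5 * \<epsilon>)"
      using b0 by (intro add_left_mono mult_left_mono) auto
    also have "\<dots> = wy - 2 / 5 * (vs\<^sup>2 * L * cU / \<kappa>\<^sup>2)" by (simp add: \<epsilon>_def power2_eq_square ac_simps)
    finally show "Wt * ((1 + \<epsilon> / 2) * (1 - \<epsilon>)) \<le> wy - 2 / 5 * (vs\<^sup>2 * L * cU / \<kappa>\<^sup>2)" .
    have "Wt * (1 + \<epsilon> / 2) * (vs * \<kappa> / L\<^sup>2) \<le> ((vs * L * cU / \<kappa>) * (113 / 100)) * (11 / 10) * (vs * \<kappa> / L\<^sup>2)"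
      using Wt0 Wt1 eps vs(1) k by (intro mult_right_mono mult_mono) auto
    also have "\<dots> = 1243 / 1000 * (vs\<^sup>2 * cU / L)"
      using k L_pos by (simp add: power2_eq_square field_simps)
    also have "\<dots> \<le> 5 / 4 * (vs\<^sup>2 * cU / L)" using L_pos cU_ge by (intro mult_right_mono) auto
    finally show "Wt * (1 + \<epsilon> / 2) * (vs * \<kappa> / L\<^sup>2) \<le> 5 / 4 * (vs\<^sup>2 * cU / L)" .
    have v5: "vs + 2 * \<kappa> \<le> 11 / 5 * \<kappa>" using vs(2) k by linarith
    have "Wt * (1 + 1 / (\<epsilon> / 2)) * (2 * \<kappa>\<^sup>2) \<le> ((vs * L * cU / \<kappa>) * (113 / 100)) * (1 + 1 / (\<epsilon> / 2)) * (2 * \<kappa>\<^sup>2)"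
      using Wt1 eps by (intro mult_right_mono) auto
    also have "\<dots> = (113 / 50 * (L * cU * \<kappa>)) * (vs + 2 * \<kappa>)"
      using k vs(1) by (simp add: \<epsilon>_def power2_eq_square field_simps)
    also have "\<dots> \<le> (113 / 50 * (L * cU * \<kappa>)) * (11 / 5 * \<kappa>)"
      using k L_pos cU_ge v5 by (intro mult_left_mono) auto
    also have "\<dots> = 1243 / 250 * (\<kappa>\<^sup>2 * L * cU)" by (simp add: power2_eq_square)
    also have "\<dots> \<le> 5 * (\<kappa>\<^sup>2 * L * cU)" using L_pos cU_ge by (intro mult_right_mono) auto
    finally show "Wt * (1 + 1 / (\<epsilon> / 2)) * (2 * \<kappa>\<^sup>2) \<le> 5 * (\<kappa>\<^sup>2 * L * cU)" .
  qed (use seq_nonneg in auto)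
  finally show ?thesis by (simp add: Wt_def algebra_simps)
qed

lemma del_weighted_step:
  "wd * (del (Suc t) - del t) \<le> - (6 / 5) * (L * cU) * dY t + 3 / 2 * (vs\<^sup>2 * cU / L) * rsq t
    + 3 / 20 * (vs\<^sup>2 * L * cU / \<kappa>\<^sup>2) * ysq (Suc t) + 30 * (\<kappa>\<^sup>2 * L * cU) * (dX t + real CARD('m) * dL t)"
proof -
  \<comment> \<open>Chosen so that \<open>wd * (L * \<theta>)\<close> equals the reserve
    \<open>3 / 20\<close> kept in \<open>ysq_weighted_step\<close>.\<close>
  define \<theta> where "\<theta> = vs / (20 * \<kappa>\<^sup>2)"
  have k: "1 \<le> \<kappa>" by (rule kappa_ge1)
  have th: "\<theta> > 0" using vs(1) k by (simp add: \<theta>_def)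
  have "wd * (del (Suc t) - del t) \<le> wd * (- (2 / 5) / \<eta>y * dY t + \<eta>y / 2 * rsq t
    + L * \<theta> * ysq (Suc t) + L / (2 * \<theta>) * (dX t + real CARD('m) * dL t))"
    using del_step[OF th, of t] weights_nonneg(1) by (rule mult_left_mono)
  also have "\<dots> = (wd * (- (2 / 5) / \<eta>y)) * dY t + (wd * (\<eta>y / 2)) * rsq t
    + (wd * (L * \<theta>)) * ysq (Suc t) + (wd * (L / (2 * \<theta>))) * (dX t + real CARD('m) * dL t)"
    by (simp only: distrib_left mult.assoc)
  also have "wd * (- (2 / 5) / \<eta>y) = - (6 / 5) * (L * cU)"
    using eta_pos L_pos by (simp add: wd_def vs_def)
  also have "wd * (\<eta>y / 2) = 3 / 2 * (vs\<^sup>2 * cU / L)"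
    using L_pos by (simp add: wd_def vs_def power2_eq_square)
  also have "wd * (L * \<theta>) = 3 / 20 * (vs\<^sup>2 * L * cU / \<kappa>\<^sup>2)"
    by (simp add: wd_def \<theta>_def power2_eq_square)
  also have "wd * (L / (2 * \<theta>)) = 30 * (\<kappa>\<^sup>2 * L * cU)"
    using vs(1) k by (simp add: wd_def \<theta>_def field_simps)
  finally show ?thesis .
qed

text \<open>With this \<open>wv\<close> the decrease is free of the spectral gap; it has to pay for
  every other occurrence of \<open>vsq\<close>.\<close>

lemma vsq_weighted_step: "wv * (vsq (Suc t) - vsq t) \<le> - (1 / (40 * \<kappa> * L)) * vsq t + cB / (40 * L) * dD t"
proof -
  have "wv * (vsq (Suc t) - vsq t) \<le> wv * (- (1 - \<rho>) * vsq t + dD t / (1 - \<rho>))"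
    using v_consensus[of t] weights_nonneg(3) by (intro mult_left_mono) (auto simp: algebra_simps)
  also have "\<dots> = - (wv * (1 - \<rho>)) * vsq t + wv / (1 - \<rho>) * dD t" by (simp add: algebra_simps)
  also have "wv * (1 - \<rho>) = 1 / (40 * \<kappa> * L)"
  proof -
    define r where "r = 1 - \<rho>"
    have "r > 0" using rho_less by (simp add: r_def)
    then show ?thesis using kappa_ge1 L_pos by (simp add: wv_def cB_def r_def[symmetric] power2_eq_square)
  qed
  also have "wv / (1 - \<rho>) = cB / (40 * L)" using rho_less by (simp add: wv_def)
  finally show ?thesis .
qed

text \<open>\<open>wx\<close> is large enough for a decrease \<open>2 / \<eta>x\<close>, which
  outweighs all consensus errors of \<open>X\<close>; the price on \<open>vsq\<close> is charged to
  the previous estimate.\<close>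

lemma xsq_weighted_step: "wx * (xsq (Suc t) - xsq t) \<le> - 2 * (1 / \<eta>x) * xsq t + 2 * \<eta>x / (1 - \<rho>)\<^sup>2 * vsq t"
proof -
  have "wx * (xsq (Suc t) - xsq t) \<le> wx * (- (1 - \<rho>) * xsq t + \<eta>x\<^sup>2 / (1 - \<rho>) * vsq t)"
    using x_consensus[of t] weights_nonneg(4) by (intro mult_left_mono) (auto simp: algebra_simps)
  also have "\<dots> = - (wx * (1 - \<rho>)) * xsq t + (wx * (\<eta>x\<^sup>2 / (1 - \<rho>))) * vsq t" by (simp add: algebra_simps)
  also have "wx * (1 - \<rho>) = 2 * (1 / \<eta>x)"
  proof -
    define r where "r = 1 - \<rho>"
    have "r > 0" using rho_less by (simp add: r_def)
    then show ?thesis by (simp add: wx_def r_def[symmetric])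
  qed
  also have "wx * (\<eta>x\<^sup>2 / (1 - \<rho>)) = 2 * \<eta>x / (1 - \<rho>)\<^sup>2"
    using eta_pos(1) by (simp add: wx_def power2_eq_square)
  finally show ?thesis by simp
qed

text \<open>The stationarity measures of the claim; inverting their weights later produces the
  factors \<open>50 / \<eta>x\<close> and \<open>2 / \<eta>L\<close>.\<close>

definition "gain t = real CARD('m) * (\<eta>x / 50 * (gmsq t + L\<^sup>2 / real CARD('m) * xsq t) + \<eta>L / 2 * psq t)"
definition "lyap t = real CARD('m) * ph t + wd * del t + wy * ysq t + wv * vsq t + wx * xsq t"

text \<open>The next tracking error and the increment of \<open>D\<close> enter only through
  \<open>F5\<close>, so both are variables here: the true values give the Lyapunov step, zeros give
  the version that does not look at the next \<open>D\<close>.\<close>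

lemma lyapunov_step_aux:
  assumes F5: "wv * (vn - vsq t) \<le> - (1 / (40 * \<kappa> * L)) * vsq t + cB / (40 * L) * dn"
  shows "real CARD('m) * (ph (Suc t) - ph t) + wd * (del (Suc t) - del t) + wy * (ysq (Suc t) - ysq t)
      + wv * (vn - vsq t) + wx * (xsq (Suc t) - xsq t)
      + gain t + 23 / 20 * (L * cU) * (dX t + dY t)
     \<le> 7 * \<beta> * cU / (20 * L) * rsq t + cB / (40 * L) * dn"
proof -
  let ?m = "real CARD('m)" and ?i = "1 / \<eta>x" and ?j = "1 / \<eta>L"
  let ?K = "\<kappa>\<^sup>2 * L * cU"
  have k: "1 \<le> \<kappa>" "1 \<le> \<kappa>\<^sup>2" using kappa_ge1 by (auto simp: one_le_power)
  have bU: "\<beta> * cU \<le> cU" using beta cU_ge by (simp add: mult_left_le_one_le)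
  have LU0: "0 < L * cU" using L_pos cU_ge by simp
  have LUK: "L * cU \<le> ?K" using k(2) LU0 mult_right_mono[of 1 "\<kappa>\<^sup>2" "L * cU"] by (simp add: ac_simps)
  have LkK: "L * \<kappa> \<le> ?K"
  proof -
    have "(L * \<kappa>) * 1 \<le> (L * \<kappa>) * (\<kappa> * cU)"
      using k L_pos cU_ge by (intro mult_left_mono) (auto intro: order_trans[OF _ mult_mono[of 1 \<kappa> 1 cU]])
    then show ?thesis by (simp add: power2_eq_square ac_simps)
  qed
  have nlk: "1152 * (\<eta>x * L\<^sup>2 * \<kappa>\<^sup>2) \<le> L * (\<beta> * cU)"
    using mult_left_mono[OF eta_x_beta, of L] L_pos by (simp add: power2_eq_square ac_simps)
  have elk: "208 * (\<eta>L * L\<^sup>2 * \<kappa>\<^sup>2) \<le> L * (\<beta> * cU)"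
    using mult_left_mono[OF eta_L_beta, of L] L_pos by (simp add: power2_eq_square ac_simps)
  have LbU: "L * (\<beta> * cU) \<le> ?K"
    using mult_left_mono[OF bU, of L] L_pos LUK by linarith
  have nlk0: "0 \<le> \<eta>x * L\<^sup>2 * \<kappa>\<^sup>2" "0 \<le> \<eta>L * L\<^sup>2 * \<kappa>\<^sup>2" using eta_pos by auto
  have nl1: "\<eta>x * L\<^sup>2 \<le> \<eta>x * L\<^sup>2 * \<kappa>\<^sup>2" 
    using mult_left_mono[OF k(2), of "\<eta>x * L\<^sup>2"] eta_pos by simp
  \<comment> \<open>The gain in \<open>ysq\<close> against its cost through \<open>esq\<close>. As
    \<open>2 / 5 * vs\<^sup>2\<close> is \<open>\<beta> / 80\<close>, both sides compare as
    multiples of \<open>L * \<beta> * cU / \<kappa>\<^sup>2\<close>.\<close>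
  have c4: "54 / 25 * (\<eta>x * L\<^sup>2) + \<eta>L * L\<^sup>2 \<le> 2 / 5 * (vs\<^sup>2 * L * cU / \<kappa>\<^sup>2)"
  proof -
    have "(54 / 25 * (\<eta>x * L\<^sup>2) + \<eta>L * L\<^sup>2) * \<kappa>\<^sup>2 = 54 / 25 * (\<eta>x * L\<^sup>2 * \<kappa>\<^sup>2) + \<eta>L * L\<^sup>2 * \<kappa>\<^sup>2"
      by (simp add: algebra_simps)
    also have "\<dots> \<le> 54 / 25 * (L * (\<beta> * cU) / 1152) + L * (\<beta> * cU) / 208" using nlk elk by linarith
    also have "\<dots> \<le> 1 / 80 * (L * (\<beta> * cU))" using LU0 beta L_pos cU_ge by simp
    also have "\<dots> = 2 / 5 * (vs\<^sup>2 * L * cU)" by (simp add: vs(3))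
    finally show ?thesis using k by (simp add: field_simps)
  qed
  have c5: "\<eta>x \<le> vs\<^sup>2 * cU / L"
  proof -
    have "36 * (L * \<eta>x) \<le> 36 * \<kappa>\<^sup>2 * L * \<eta>x" using k(2) eta_pos L_pos mult_right_mono[of 1 "\<kappa>\<^sup>2" "L * \<eta>x"] by simp
    also have "\<dots> \<le> vs\<^sup>2 * cU"
    proof -
      have "\<beta> * c = 32 * (vs\<^sup>2 * c)" for c using vs(3) by simp
      from this[of cU] show ?thesis using eta_x_beta by linarith
    qed
    finally have "36 * (L * \<eta>x) \<le> vs\<^sup>2 * cU" .
    moreover have "0 \<le> L * \<eta>x" using L_pos eta_pos by simp
    ultimately have "L * \<eta>x \<le> vs\<^sup>2 * cU" by linarith
    then show ?thesis using L_pos by (simp add: field_simps)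
  qed
  \<comment> \<open>All terms are measured in \<open>\<zeta>\<close>, and fewer than
    \<open>24\<close> of them are needed; \<open>24\<close> is the quotient of \<open>960\<close> in
    \<open>eta_x_rho\<close> by \<open>40\<close>.\<close>
  have c6: "\<eta>x / 2 + 4 / 50 * \<eta>x + 37 * ?K * (2 * \<eta>x\<^sup>2 / (1 - \<rho>)) + 2 * \<eta>x / (1 - \<rho>)\<^sup>2 \<le> 1 / (40 * \<kappa> * L)"
  proof -
    define \<zeta> where "\<zeta> = \<eta>x / (1 - \<rho>)\<^sup>2"
    have r: "0 < 1 - \<rho>" "1 - \<rho> \<le> 1" using rho_less rho_nonneg by auto
    have r2: "(1 - \<rho>)\<^sup>2 \<le> 1 - \<rho>" "(1 - \<rho>)\<^sup>2 \<le> 1" "0 < (1 - \<rho>)\<^sup>2"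
      using r by (auto simp: power2_eq_square mult_left_le mult_le_one)
    have z0: "0 \<le> \<zeta>" using eta_pos by (simp add: \<zeta>_def)
    have e1: "\<eta>x \<le> \<zeta>" unfolding \<zeta>_def using r2 eta_pos by (simp add: field_simps mult_left_le)
    have e2: "\<eta>x / (1 - \<rho>) \<le> \<zeta>" unfolding \<zeta>_def
      by (rule divide_left_mono[OF r2(1) _ mult_pos_pos[OF r(1) r2(3)]]) (use eta_pos in simp)
    have e3: "576 * (?K * \<eta>x) \<le> 1" using eta_x_U eta_pos by (simp add: field_simps)
    have "37 * ?K * (2 * \<eta>x\<^sup>2 / (1 - \<rho>)) = 74 * (?K * \<eta>x) * (\<eta>x / (1 - \<rho>))" by (simp add: power2_eq_square)
    also have "\<dots> \<le> 1 * \<zeta>"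
      using e3 e2 z0 eta_pos r LU0 by (intro mult_mono) auto
    finally have e4: "37 * ?K * (2 * \<eta>x\<^sup>2 / (1 - \<rho>)) \<le> \<zeta>" by simp
    have "24 * \<zeta> \<le> 1 / (40 * \<kappa> * L)"
      using eta_x_rho r2 k L_pos by (simp add: \<zeta>_def field_simps)
    then show ?thesis using e1 e4 z0 by (simp add: \<zeta>_def)
  qed
  have F9: "\<eta>x / 50 * (?m * gmsq t) \<le> ?i / 25 * (?m * dxb t) + \<eta>x / 25 * (?m * gvsq t) + 4 / 50 * ?i * xsq t + 4 / 50 * \<eta>x * vsq t"
  proof -
    have "\<eta>x / 50 * (?m * gmsq t) \<le> \<eta>x / 50 * (2 * ?m / \<eta>x\<^sup>2 * dxb t + 2 * (?m * gvsq t) + 4 / \<eta>x\<^sup>2 * xsq t + 4 * vsq t)"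
      using gm_bound eta_pos by (intro mult_left_mono) auto
    also have "\<dots> = ?i / 25 * (?m * dxb t) + \<eta>x / 25 * (?m * gvsq t) + 4 / 50 * ?i * xsq t + 4 / 50 * \<eta>x * vsq t"
      using eta_pos by (simp add: power2_eq_square field_simps)
    finally show ?thesis .
  qed
  have F1: "?m * (ph (Suc t) - ph t) \<le> - (?i / 2 - 5 / 2 * (L * \<kappa>)) * (?m * dxb t) - (?j / 2 - 5 / 2 * (L * \<kappa>)) * (?m * dL t)
       - \<eta>L / 2 * (?m * psq t) + (\<eta>L * L\<^sup>2) / 2 * esq t + \<eta>x / 2 * (?m * gvsq t) + \<eta>x / 2 * vsq t + ?i / 2 * xsq t"
    using phi_descent[of t] by (simp add: algebra_simps)
  have F2: "\<eta>x * (?m * gvsq t) \<le> 2 * (\<eta>x * L\<^sup>2) * (xsq t + esq t) + 2 * \<eta>x * rsq t"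
    using mult_left_mono[OF gv_bound, of \<eta>x t] eta_pos by (simp add: algebra_simps)
  have F8: "dX t \<le> ?m * dxb t + 4 * xsq t + (2 * \<eta>x\<^sup>2 / (1 - \<rho>)) * vsq t"
    using dX_bound[of t] by simp
  have "?m * (ph (Suc t) - ph t) + wd * (del (Suc t) - del t) + wy * (ysq (Suc t) - ysq t)
      + wv * (vn - vsq t) + wx * (xsq (Suc t) - xsq t)
      + (\<eta>x / 50 * (?m * gmsq t) + (\<eta>x * L\<^sup>2) / 50 * xsq t + \<eta>L / 2 * (?m * psq t)) + 23 / 20 * (L * cU) * (dX t + dY t)
     \<le> 56 / 5 * (vs\<^sup>2 * cU / L) * rsq t + cB / (40 * L) * dn"
  proof (rule lyapunov_arith[OF _ _ _ _ _ _ _ _ _ _ _ _ _ _ _ F1 F2 e_bound xsq_weighted_step F5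
       ysq_weighted_step del_weighted_step F8 F9 eta_x_U LkK LUK eta_L_U _ _ _ _ c4 c5 c6])
    show "\<eta>x * L\<^sup>2 * \<kappa>\<^sup>2 \<le> ?K" "\<eta>L * L\<^sup>2 * \<kappa>\<^sup>2 \<le> ?K" "\<eta>x * L\<^sup>2 \<le> ?K"
      using nlk elk LbU nlk0 nl1 by linarith+
    show "0 \<le> \<kappa>\<^sup>2 * L * cU" "0 \<le> L * cU" "0 \<le> vs\<^sup>2 * cU / L" using L_pos cU_ge by auto
  qed (use seq_nonneg eta_pos in auto)
  \<comment> \<open>\<open>56 / 5\<close> divided by the \<open>32\<close> in
    \<open>\<beta> = 32 * vs\<^sup>2\<close>.\<close>
  moreover have "56 / 5 * (vs\<^sup>2 * cU / L) = 7 * \<beta> * cU / (20 * L)" by (simp add: vs(3))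
  moreover have "gain t = \<eta>x / 50 * (?m * gmsq t) + (\<eta>x * L\<^sup>2) / 50 * xsq t + \<eta>L / 2 * (?m * psq t)"
    by (simp add: gain_def algebra_simps)
  ultimately show ?thesis by (simp only:)
qed

lemma lyapunov_step:
  "lyap (Suc t) - lyap t + gain t + 23 / 20 * (L * cU) * (dX t + dY t)
     \<le> 7 * \<beta> * cU / (20 * L) * rsq t + cB / (40 * L) * dD t"
proof -
  have "lyap (Suc t) - lyap t = real CARD('m) * (ph (Suc t) - ph t) + wd * (del (Suc t) - del t) + wy * (ysq (Suc t) - ysq t)
      + wv * (vsq (Suc t) - vsq t) + wx * (xsq (Suc t) - xsq t)"
    by (simp add: lyap_def algebra_simps)
  with lyapunov_step_aux[OF vsq_weighted_step] show ?thesis by (simp only:)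
qed

section \<open>Summation along a path\<close>

lemma gain_nonneg: "0 \<le> gain t"
  unfolding gain_def using seq_nonneg eta_pos by (intro mult_nonneg_nonneg add_nonneg_nonneg) auto

lemma phi_star_le_ph: "real CARD('m) * phi_star \<le> real CARD('m) * ph n"
  using phi_star_le[OF xb_dom] by (simp add: ph_def)

text \<open>The initial Lyapunov value above its lower bound; there is no consensus term because all
  agents start at the same point.\<close>

definition "psi0 = real CARD('m) * (ph 0 - phi_star) + wd * del 0 + wy * ysq 0 + wv * vsq 0"

lemma lyap_sum:
  "lyap n - lyap 0 + (\<Sum>t<n. gain t) + 23 / 20 * (L * cU) * (\<Sum>t<n. dX t + dY t)
    \<le> 7 * \<beta> * cU / (20 * L) * (\<Sum>t<n. rsq t) + cB / (40 * L) * (\<Sum>t<n. dD t)"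
proof (induction n)
  case (Suc n)
  then show ?case using lyapunov_step[of n] by (simp add: algebra_simps add_divide_distrib)
qed simp

lemma lyap_0: "lyap 0 = psi0 + real CARD('m) * phi_star"
  by (simp add: lyap_def psi0_def xsq_def X_0 algebra_simps)

lemma pathwise_bound:
  "(\<Sum>t<n. gain t) + 23 / 20 * (L * cU) * (\<Sum>t<n. dX t + dY t)
    \<le> psi0 + 7 * \<beta> * cU / (20 * L) * (\<Sum>t<n. rsq t) + cB / (40 * L) * (\<Sum>t<n. dD t)"
proof -
  have "0 \<le> wd * del n" "0 \<le> wy * ysq n" "0 \<le> wv * vsq n" "0 \<le> wx * xsq n"
    using weights_nonneg seq_nonneg del_nonneg by auto
  then have "real CARD('m) * phi_star \<le> lyap n" using phi_star_le_ph[of n] unfolding lyap_def by linarith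
  then show ?thesis using lyap_sum[of n] lyap_0 by linarith
qed

text \<open>Discarding the tracking term of the last iterate makes the bound on the \<open>n\<close>-th displacement
  independent of \<open>D (Suc n)\<close>; integrability is then obtained by induction.\<close>

lemma pathwise_bound_last:
  "23 / 20 * (L * cU) * (dX n + dY n)
    \<le> psi0 + 7 * \<beta> * cU / (20 * L) * (\<Sum>t<Suc n. rsq t) + cB / (40 * L) * (\<Sum>t<n. dD t)"
proof -
  \<comment> \<open>With the next tracking error and the increment both set to \<open>0\<close>, the
    hypothesis \<open>F5\<close> reduces to this.\<close>
  have "1 / (40 * \<kappa> * L) \<le> wv"
  proof -
    have "(1 - \<rho>)\<^sup>2 \<le> 1 - \<rho>" using rho_less rho_nonneg by (simp add: power2_eq_square mult_left_le)
    then have "(1 - \<rho>)\<^sup>2 * cB \<le> (1 - \<rho>) * cB" using cB_pos by (intro mult_right_mono) auto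
    moreover have "(1 - \<rho>)\<^sup>2 * cB = 1 / \<kappa>" using rho_less by (simp add: cB_def)
    ultimately have "1 / \<kappa> / (40 * L) \<le> (1 - \<rho>) * cB / (40 * L)" using L_pos by (intro divide_right_mono) auto
    then show ?thesis by (simp add: wv_def ac_simps)
  qed
  then have "wv * (0 - vsq n) \<le> - (1 / (40 * \<kappa> * L)) * vsq n + cB / (40 * L) * 0"
    using mult_right_mono[of "1 / (40 * \<kappa> * L)" wv "vsq n"] seq_nonneg by simp
  from lyapunov_step_aux[OF this]
  have 1: "real CARD('m) * (ph (Suc n) - ph n) + wd * (del (Suc n) - del n) + wy * (ysq (Suc n) - ysq n)
      + wv * (0 - vsq n) + wx * (xsq (Suc n) - xsq n)
      + gain n + 23 / 20 * (L * cU) * (dX n + dY n)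
     \<le> 7 * \<beta> * cU / (20 * L) * rsq n + cB / (40 * L) * 0" .
  have "0 \<le> wd * del (Suc n)" "0 \<le> wy * ysq (Suc n)" "0 \<le> wx * xsq (Suc n)" "0 \<le> gain n"
    "0 \<le> (\<Sum>t<n. gain t)" "0 \<le> 23 / 20 * (L * cU) * (\<Sum>t<n. dX t + dY t)"
    using weights_nonneg seq_nonneg del_nonneg gain_nonneg L_pos cU_ge by (auto intro!: sum_nonneg mult_nonneg_nonneg)
  then have "lyap 0 - real CARD('m) * phi_star + 7 * \<beta> * cU / (20 * L) * (\<Sum>t<n. rsq t) + cB / (40 * L) * (\<Sum>t<n. dD t)
      + 7 * \<beta> * cU / (20 * L) * rsq n \<ge> 23 / 20 * (L * cU) * (dX n + dY n)"
    using 1 lyap_sum[of n] phi_star_le_ph[of "Suc n"] unfolding lyap_def[of n] distrib_left right_diff_distrib by linarith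
  then show ?thesis using lyap_0 by (simp add: distrib_left)
qed

end

section \<open>Averages of independent samples\<close>

context prob_space
begin

lemma indep_set_of_indep_var:
  "indep_var S X T Y \<Longrightarrow> indep_set (sets (vimage_algebra (space M) X S)) (sets (vimage_algebra (space M) Y T))"
  by (simp add: indep_var_eq sets_vimage_algebra)

text \<open>The library's \<open>indep_var\<close> forces both variables to take values in the same type, so the product
  formula is stated for variables measurable with respect to independent sub-\<open>\<sigma>\<close>-algebras.\<close>

lemma nn_integral_indep_set:
  assumes ind: "indep_set (sets A) (sets B)" and sp: "space A = space M" "space B = space M"
    and X: "X \<in> A \<rightarrow>\<^sub>M S" and Z: "Z \<in> B \<rightarrow>\<^sub>M N" and H[measurable]: "H \<in> borel_measurable (S \<Otimes>\<^sub>M N)"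
  shows "(\<integral>\<^sup>+\<omega>. H (X \<omega>, Z \<omega>) \<partial>M) = (\<integral>\<^sup>+\<omega>. (\<integral>\<^sup>+\<omega>'. H (X \<omega>', Z \<omega>) \<partial>M) \<partial>M)"
proof -
  have ev: "sets A \<subseteq> events" "sets B \<subseteq> events" using ind by (auto simp: indep_sets2_eq)
  have pre: "X -` C \<inter> space M \<in> sets A" if "C \<in> sets S" for C
    using measurable_sets[OF X that] sp by simp
  have pre2: "Z -` C \<inter> space M \<in> sets B" if "C \<in> sets N" for C
    using measurable_sets[OF Z that] sp by simp
  have [measurable]: "X \<in> M \<rightarrow>\<^sub>M S" using measurable_space[OF X] sp pre ev by (intro measurableI) auto
  have [measurable]: "Z \<in> M \<rightarrow>\<^sub>M N" using measurable_space[OF Z] sp pre2 ev by (intro measurableI) auto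
  interpret X: prob_space "distr M S X" by (rule prob_space_distr) measurable
  interpret Z: prob_space "distr M N Z" by (rule prob_space_distr) measurable
  interpret XZ: pair_prob_space "distr M S X" "distr M N Z" ..
  have prod: "distr M S X \<Otimes>\<^sub>M distr M N Z = distr M (S \<Otimes>\<^sub>M N) (\<lambda>\<omega>. (X \<omega>, Z \<omega>))"
  proof (rule pair_measure_eqI)
    show "sigma_finite_measure (distr M S X)" "sigma_finite_measure (distr M N Z)" ..
    fix C E assume C: "C \<in> sets (distr M S X)" and E: "E \<in> sets (distr M N Z)"
    have "emeasure (distr M (S \<Otimes>\<^sub>M N) (\<lambda>\<omega>. (X \<omega>, Z \<omega>))) (C \<times> E)
        = emeasure M ((\<lambda>\<omega>. (X \<omega>, Z \<omega>)) -` (C \<times> E) \<inter> space M)"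
      using C E by (intro emeasure_distr) auto
    also have "(\<lambda>\<omega>. (X \<omega>, Z \<omega>)) -` (C \<times> E) \<inter> space M = (X -` C \<inter> space M) \<inter> (Z -` E \<inter> space M)" by auto
    also have "emeasure M \<dots> = emeasure M (X -` C \<inter> space M) * emeasure M (Z -` E \<inter> space M)"
      using ind pre[of C] pre2[of E] C E
      by (simp add: indep_sets2_eq emeasure_eq_measure measure_nonneg ennreal_mult)
    also have "\<dots> = emeasure (distr M S X) C * emeasure (distr M N Z) E"
      using C E by (simp add: emeasure_distr)
    finally show "emeasure (distr M S X) C * emeasure (distr M N Z) E
        = emeasure (distr M (S \<Otimes>\<^sub>M N) (\<lambda>\<omega>. (X \<omega>, Z \<omega>))) (C \<times> E)" by simp
  qed simp
  have "(\<integral>\<^sup>+\<omega>. H (X \<omega>, Z \<omega>) \<partial>M) = (\<integral>\<^sup>+p. H p \<partial>distr M (S \<Otimes>\<^sub>M N) (\<lambda>\<omega>. (X \<omega>, Z \<omega>)))"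
    by (subst nn_integral_distr) auto
  also have "\<dots> = (\<integral>\<^sup>+p. H p \<partial>(distr M S X \<Otimes>\<^sub>M distr M N Z))" by (simp add: prod)
  also have "\<dots> = (\<integral>\<^sup>+z. (\<integral>\<^sup>+x. H (x, z) \<partial>distr M S X) \<partial>distr M N Z)"
    by (rule XZ.nn_integral_snd[symmetric]) simp
  also have "\<dots> = (\<integral>\<^sup>+z. (\<integral>\<^sup>+\<omega>'. H (X \<omega>', z) \<partial>M) \<partial>distr M N Z)"
    by (intro nn_integral_cong nn_integral_distr) simp_all
  also have "\<dots> = (\<integral>\<^sup>+\<omega>. (\<integral>\<^sup>+\<omega>'. H (X \<omega>', Z \<omega>) \<partial>M) \<partial>M)"
    by (rule nn_integral_distr) simp_all
  finally show ?thesis .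
qed

lemma sq_integrable_imp_integrable:
  fixes F :: "'a \<Rightarrow> 'b::euclidean_space"
  assumes [measurable]: "F \<in> borel_measurable M" and sq: "(\<integral>\<^sup>+\<omega>. ennreal ((norm (F \<omega>))\<^sup>2) \<partial>M) \<le> ennreal c"
  shows "integrable M (\<lambda>\<omega>. (norm (F \<omega>))\<^sup>2)" and "integrable M F"
proof -
  show 1: "integrable M (\<lambda>\<omega>. (norm (F \<omega>))\<^sup>2)"
    using sq by (intro integrableI_bounded) (auto simp: order_le_less_trans[OF _ ennreal_less_top])
  show "integrable M F"
  proof (rule Bochner_Integration.integrable_bound)
    show "integrable M (\<lambda>\<omega>. 1 + (norm (F \<omega>))\<^sup>2)" using 1 by simp
    have "norm (F \<omega>) \<le> 1 + (norm (F \<omega>))\<^sup>2" for \<omega>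
      using zero_le_power2[of "norm (F \<omega>) - 1 / 2"] by (simp add: power2_eq_square algebra_simps)
    then show "AE \<omega> in M. norm (F \<omega>) \<le> norm (1 + (norm (F \<omega>))\<^sup>2)" by auto
  qed simp
qed

lemma nn_integral_norm_sq_le:
  fixes F :: "'a \<Rightarrow> 'b::euclidean_space"
  assumes "integrable M (\<lambda>\<omega>. (norm (F \<omega>))\<^sup>2)"
  shows "(\<integral>\<^sup>+\<omega>. ennreal ((norm (F \<omega>))\<^sup>2) \<partial>M) = ennreal (\<integral>\<omega>. (norm (F \<omega>))\<^sup>2 \<partial>M)"
  by (rule nn_integral_eq_integral[OF assms]) simp

text \<open>The variance is at most the second moment. It turns the mean-square Lipschitz bound into
  one for centered gradient differences.\<close>

lemma nn_integral_centered_le: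
  fixes F :: "'a \<Rightarrow> 'b::euclidean_space"
  assumes F: "has_bochner_integral M F m" and sq: "(\<integral>\<^sup>+\<omega>. ennreal ((norm (F \<omega>))\<^sup>2) \<partial>M) \<le> ennreal c" and c: "0 \<le> c"
  shows "(\<integral>\<^sup>+\<omega>. ennreal ((norm (F \<omega> - m))\<^sup>2) \<partial>M) \<le> ennreal c"
proof -
  have int: "integrable M F" and m: "(\<integral>\<omega>. F \<omega> \<partial>M) = m" using F by (auto simp: has_bochner_integral_iff)
  then have [measurable]: "F \<in> borel_measurable M" by auto
  note sqi = sq_integrable_imp_integrable(1)[OF _ sq, simplified]
  have e: "(norm (F \<omega> - m))\<^sup>2 = (norm (F \<omega>))\<^sup>2 - 2 * (F \<omega> \<bullet> m) + (norm m)\<^sup>2" for \<omega>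
    unfolding power2_norm_eq_inner by (simp add: inner_diff_left inner_diff_right inner_commute)
  have i1: "integrable M (\<lambda>\<omega>. F \<omega> \<bullet> m)" using int by simp
  have "integrable M (\<lambda>\<omega>. (norm (F \<omega> - m))\<^sup>2)" unfolding e using sqi i1 by simp
  then have "(\<integral>\<^sup>+\<omega>. ennreal ((norm (F \<omega> - m))\<^sup>2) \<partial>M) = ennreal (\<integral>\<omega>. (norm (F \<omega> - m))\<^sup>2 \<partial>M)"
    by (rule nn_integral_norm_sq_le)
  also have "(\<integral>\<omega>. (norm (F \<omega> - m))\<^sup>2 \<partial>M) = (\<integral>\<omega>. (norm (F \<omega>))\<^sup>2 \<partial>M) - (norm m)\<^sup>2"
    unfolding e using sqi i1 int m by (simp add: prob_space power2_norm_eq_inner)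
  also have "ennreal \<dots> \<le> ennreal (\<integral>\<omega>. (norm (F \<omega>))\<^sup>2 \<partial>M)" by (intro ennreal_leI) simp
  also have "\<dots> \<le> ennreal c" using sq nn_integral_norm_sq_le[OF sqi] by simp
  finally show ?thesis .
qed

text \<open>The product rule for independent variables is scalar, hence the sum over
  coordinates.\<close>

lemma indep_mean_zero_inner:
  fixes N :: "nat \<Rightarrow> 'a \<Rightarrow> 'b::euclidean_space"
  assumes ind: "indep_vars (\<lambda>_. borel) N I" and kl: "k \<in> I" "l \<in> I" "k \<noteq> l"
    and int: "\<And>k. k \<in> I \<Longrightarrow> integrable M (N k)" and zero: "\<And>k. k \<in> I \<Longrightarrow> (\<integral>\<omega>. N k \<omega> \<partial>M) = 0"
  shows "integrable M (\<lambda>\<omega>. N k \<omega> \<bullet> N l \<omega>)" "(\<integral>\<omega>. N k \<omega> \<bullet> N l \<omega> \<partial>M) = 0"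
proof -
  have b: "integrable M (\<lambda>\<omega>. (N k \<omega> \<bullet> b) * (N l \<omega> \<bullet> b))" "(\<integral>\<omega>. (N k \<omega> \<bullet> b) * (N l \<omega> \<bullet> b) \<partial>M) = 0" for b
  proof -
    have i: "indep_vars (\<lambda>_. borel) (\<lambda>j \<omega>. N j \<omega> \<bullet> b) {k, l}"
      by (rule indep_vars_compose2[where M'="\<lambda>_. borel" and Y="\<lambda>_ x. x \<bullet> b"], rule indep_vars_subset[OF ind]) (use kl in auto)
    have ii: "integrable M (\<lambda>\<omega>. N j \<omega> \<bullet> b)" if "j \<in> {k, l}" for j using int kl that by auto
    have "integrable M (\<lambda>\<omega>. \<Prod>j\<in>{k, l}. N j \<omega> \<bullet> b)" by (rule indep_vars_integrable[OF _ i ii]) auto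
    then show "integrable M (\<lambda>\<omega>. (N k \<omega> \<bullet> b) * (N l \<omega> \<bullet> b))" using kl by simp
    have "(\<integral>\<omega>. (\<Prod>j\<in>{k, l}. N j \<omega> \<bullet> b) \<partial>M) = (\<Prod>j\<in>{k, l}. \<integral>\<omega>. N j \<omega> \<bullet> b \<partial>M)"
      by (rule indep_vars_lebesgue_integral[OF _ i ii]) auto
    then show "(\<integral>\<omega>. (N k \<omega> \<bullet> b) * (N l \<omega> \<bullet> b) \<partial>M) = 0" using kl int zero by simp
  qed
  have e: "N k \<omega> \<bullet> N l \<omega> = (\<Sum>b\<in>Basis. (N k \<omega> \<bullet> b) * (N l \<omega> \<bullet> b))" for \<omega> by (rule euclidean_inner)
  show "integrable M (\<lambda>\<omega>. N k \<omega> \<bullet> N l \<omega>)" "(\<integral>\<omega>. N k \<omega> \<bullet> N l \<omega> \<partial>M) = 0"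
    unfolding e using b by (simp_all add: Bochner_Integration.integral_sum)
qed

text \<open>The terms linear in \<open>N\<close> and the off-diagonal inner products have mean zero.
  Only \<open>n\<close> diagonal terms remain, and division by the square of \<open>n\<close> leaves
  \<open>c / n\<close>.\<close>

lemma nn_integral_norm_add_average_le:
  fixes N :: "nat \<Rightarrow> 'a \<Rightarrow> 'b::euclidean_space"
  assumes ind: "indep_vars (\<lambda>_. borel) N {..<n}" and n: "n \<ge> 1" and c: "0 \<le> c"
    and zero: "\<And>k. k < n \<Longrightarrow> (\<integral>\<omega>. N k \<omega> \<partial>M) = 0"
    and sq: "\<And>k. k < n \<Longrightarrow> (\<integral>\<^sup>+\<omega>. ennreal ((norm (N k \<omega>))\<^sup>2) \<partial>M) \<le> ennreal c"
  shows "(\<integral>\<^sup>+\<omega>. ennreal ((norm (r + (1 / real n) *\<^sub>R (\<Sum>k<n. N k \<omega>)))\<^sup>2) \<partial>M) \<le> ennreal ((norm r)\<^sup>2 + c / real n)"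
proof -
  have meas[measurable]: "N k \<in> borel_measurable M" if "k < n" for k
    using ind that by (auto simp: indep_vars_def)
  have int: "integrable M (N k)" "integrable M (\<lambda>\<omega>. (norm (N k \<omega>))\<^sup>2)" if "k < n" for k
    using sq_integrable_imp_integrable[OF meas[OF that] sq[OF that]] by auto
  have e: "(norm (r + (1 / real n) *\<^sub>R (\<Sum>k<n. N k \<omega>)))\<^sup>2
      = (norm r)\<^sup>2 + (2 / real n) * (\<Sum>k<n. r \<bullet> N k \<omega>) + (1 / real n)\<^sup>2 * (\<Sum>k<n. \<Sum>l<n. N k \<omega> \<bullet> N l \<omega>)" for \<omega>
  proof -
    have "(\<Sum>k<n. N k \<omega>) \<bullet> (\<Sum>k<n. N k \<omega>) = (\<Sum>k<n. \<Sum>l<n. N k \<omega> \<bullet> N l \<omega>)"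
      unfolding inner_sum_left by (simp add: inner_sum_right)
    moreover have "(norm (r + a *\<^sub>R s))\<^sup>2 = (norm r)\<^sup>2 + 2 * a * (r \<bullet> s) + a\<^sup>2 * (s \<bullet> s)" for a s
      unfolding power2_norm_eq_inner by (simp add: inner_add_left inner_add_right inner_commute power2_eq_square)
    ultimately show ?thesis by (simp add: inner_sum_right)
  qed
  have i2: "integrable M (\<lambda>\<omega>. N k \<omega> \<bullet> N l \<omega>)" if "k < n" "l < n" for k l
    using indep_mean_zero_inner(1)[OF ind, of k l] int zero that
    by (cases "k = l") (auto simp: power2_norm_eq_inner[symmetric])
  have i0: "(\<integral>\<omega>. N k \<omega> \<bullet> N l \<omega> \<partial>M) = (if k = l then (\<integral>\<omega>. (norm (N k \<omega>))\<^sup>2 \<partial>M) else 0)" if "k < n" "l < n" for k l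
    using indep_mean_zero_inner(2)[OF ind, of k l] int zero that
    by (auto simp: power2_norm_eq_inner)
  have I: "integrable M (\<lambda>\<omega>. (norm (r + (1 / real n) *\<^sub>R (\<Sum>k<n. N k \<omega>)))\<^sup>2)"
    unfolding e by (intro Bochner_Integration.integrable_add integrable_mult_right Bochner_Integration.integrable_sum
        integrable_inner_right i2) (auto intro: int)
  have "(\<integral>\<omega>. (norm (r + (1 / real n) *\<^sub>R (\<Sum>k<n. N k \<omega>)))\<^sup>2 \<partial>M)
     = (norm r)\<^sup>2 + (2 / real n) * (\<Sum>k<n. r \<bullet> (\<integral>\<omega>. N k \<omega> \<partial>M)) + (1 / real n)\<^sup>2 * (\<Sum>k<n. \<Sum>l<n. \<integral>\<omega>. N k \<omega> \<bullet> N l \<omega> \<partial>M)"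
  proof -
    have j1: "integrable M (\<lambda>\<omega>. \<Sum>k<n. r \<bullet> N k \<omega>)" "integrable M (\<lambda>\<omega>. \<Sum>k<n. \<Sum>l<n. N k \<omega> \<bullet> N l \<omega>)"
      by (intro Bochner_Integration.integrable_sum integrable_inner_right int i2; simp)+
    have j2: "(\<integral>\<omega>. (\<Sum>k<n. r \<bullet> N k \<omega>) \<partial>M) = (\<Sum>k<n. r \<bullet> (\<integral>\<omega>. N k \<omega> \<partial>M))"
      by (subst Bochner_Integration.integral_sum) (auto simp: int)
    have j3: "(\<integral>\<omega>. (\<Sum>k<n. \<Sum>l<n. N k \<omega> \<bullet> N l \<omega>) \<partial>M) = (\<Sum>k<n. \<Sum>l<n. \<integral>\<omega>. N k \<omega> \<bullet> N l \<omega> \<partial>M)"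
      by (subst Bochner_Integration.integral_sum) (auto simp: i2 Bochner_Integration.integral_sum)
    show ?thesis unfolding e using j1 by (simp add: prob_space j2 j3)
  qed
  also have "\<dots> = (norm r)\<^sup>2 + (1 / real n)\<^sup>2 * (\<Sum>k<n. \<integral>\<omega>. (norm (N k \<omega>))\<^sup>2 \<partial>M)"
    by (simp add: zero i0)
  also have "\<dots> \<le> (norm r)\<^sup>2 + (1 / real n)\<^sup>2 * (\<Sum>k<n. c)"
  proof (intro add_left_mono mult_left_mono sum_mono)
    fix k assume "k \<in> {..<n}"
    then show "(\<integral>\<omega>. (norm (N k \<omega>))\<^sup>2 \<partial>M) \<le> c"
      using sq[of k] nn_integral_norm_sq_le[OF int(2), of k] c by simp
  qed simp
  also have "\<dots> = (norm r)\<^sup>2 + c / real n" using n by (simp add: power2_eq_square field_simps)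
  finally have "(\<integral>\<omega>. (norm (r + (1 / real n) *\<^sub>R (\<Sum>k<n. N k \<omega>)))\<^sup>2 \<partial>M) \<le> (norm r)\<^sup>2 + c / real n" .
  then show ?thesis unfolding nn_integral_norm_sq_le[OF I] by (rule ennreal_leI)
qed

end

lemma norm_average_sq_le:
  fixes v :: "nat \<Rightarrow> 'a::real_inner"
  assumes "n \<ge> 1"
  shows "(norm ((1 / real n) *\<^sub>R (\<Sum>k<n. v k)))\<^sup>2 \<le> (1 / real n) * (\<Sum>k<n. (norm (v k))\<^sup>2)"
proof -
  have "(norm (\<Sum>k<n. v k))\<^sup>2 \<le> (\<Sum>k<n. norm (v k))\<^sup>2" by (intro power_mono norm_sum) simp
  also have "\<dots> \<le> (\<Sum>k<n. (norm (v k))\<^sup>2) * (\<Sum>k<n. 1\<^sup>2)"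
    using Cauchy_Schwarz_ineq_sum[of "\<lambda>k. norm (v k)" "\<lambda>_. 1" "{..<n}"] by simp
  finally have "(1 / real n)\<^sup>2 * (norm (\<Sum>k<n. v k))\<^sup>2 \<le> (1 / real n)\<^sup>2 * (real n * (\<Sum>k<n. (norm (v k))\<^sup>2))"
    by (intro mult_left_mono) (auto simp: mult.commute)
  then show ?thesis using assms by (simp add: power_mult_distrib power_divide power2_eq_square)
qed

section \<open>Measurability of matrix operations and proximal maps\<close>

lemma borel_measurable_rows:
  fixes F :: "'a \<Rightarrow> 'b::euclidean_space^'m::finite"
  assumes [measurable]: "\<And>i. (\<lambda>\<omega>. F \<omega> $ i) \<in> borel_measurable A"
  shows "F \<in> borel_measurable A"
proof (subst borel_measurable_euclidean_space, rule ballI)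
  fix b :: "'b^'m" assume "b \<in> Basis"
  then obtain i u where "b = axis i u" by (auto simp: Basis_vec_def)
  then show "(\<lambda>\<omega>. F \<omega> \<bullet> b) \<in> borel_measurable A" by (simp add: inner_axis)
qed

lemma borel_measurable_linear:
  fixes T :: "'b::euclidean_space \<Rightarrow> 'c::euclidean_space"
  assumes "linear T" "u \<in> borel_measurable A"
  shows "(\<lambda>\<omega>. T (u \<omega>)) \<in> borel_measurable A"
  by (rule measurable_compose[OF assms(2) borel_measurable_continuous_onI])
     (simp add: assms(1) linear_continuous_on linear_linear)

lemma borel_measurable_row [measurable (raw)]:
  "u \<in> borel_measurable A \<Longrightarrow> (\<lambda>\<omega>. u \<omega> $ i) \<in> borel_measurable A" for u :: "'a \<Rightarrow> 'b::euclidean_space^'m::finite"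
  by (rule borel_measurable_linear[of "\<lambda>X. X $ i"]) (auto intro!: linearI)

lemma borel_measurable_matrix_mult [measurable (raw)]:
  "u \<in> borel_measurable A \<Longrightarrow> (\<lambda>\<omega>. Q ** u \<omega>) \<in> borel_measurable A"
  for u :: "'a \<Rightarrow> real^'p::finite^'m::finite" and Q :: "real^'m^'n::finite"
  by (rule borel_measurable_linear[of "\<lambda>X. Q ** X"])
     (auto intro!: linearI simp: matrix_mult_add matrix_mult_scaleR)

lemma borel_measurable_row_avg [measurable (raw)]:
  "u \<in> borel_measurable A \<Longrightarrow> (\<lambda>\<omega>. row_avg (u \<omega>)) \<in> borel_measurable A" for u :: "'a \<Rightarrow> 'b::euclidean_space^'m::finite"
  by (rule borel_measurable_linear[of row_avg]) (auto intro!: linearI simp: row_avg_add row_avg_scaleR)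

lemma borel_measurable_perp [measurable (raw)]:
  "u \<in> borel_measurable A \<Longrightarrow> (\<lambda>\<omega>. perp (u \<omega>)) \<in> borel_measurable A" for u :: "'a \<Rightarrow> 'b::euclidean_space^'m::finite"
  by (rule borel_measurable_linear[of perp]) (auto intro!: linearI simp: perp_add perp_scaleR)

lemma borel_measurable_const_rows [measurable (raw)]:
  "u \<in> borel_measurable A \<Longrightarrow> (\<lambda>\<omega>. const_rows (u \<omega>) :: 'b^'m) \<in> borel_measurable A" for u :: "'a \<Rightarrow> 'b::euclidean_space"
  by (rule borel_measurable_rows) simp

lemma borel_measurable_parts [measurable (raw)]:
  fixes u :: "'a \<Rightarrow> ((real^'p::finite) \<times> (real^'q::finite))^'m::finite"
  assumes "u \<in> borel_measurable A"
  shows "(\<lambda>\<omega>. x_part (u \<omega>)) \<in> borel_measurable A" "(\<lambda>\<omega>. y_part (u \<omega>)) \<in> borel_measurable A"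
proof -
  have "linear (x_part :: ((real^'p) \<times> (real^'q))^'m \<Rightarrow> _)" "linear (y_part :: ((real^'p) \<times> (real^'q))^'m \<Rightarrow> _)"
    by (auto intro!: linearI simp: x_part_def y_part_def vec_eq_iff)
  then show "(\<lambda>\<omega>. x_part (u \<omega>)) \<in> borel_measurable A" "(\<lambda>\<omega>. y_part (u \<omega>)) \<in> borel_measurable A"
    using assms by (auto intro: borel_measurable_linear)
qed

lemma borel_measurable_prox [measurable (raw)]:
  fixes r :: "'b::euclidean_space \<Rightarrow> ereal"
  assumes "closed_convex_fun r" "x0 \<in> eff_dom r" "\<eta> > 0" "u \<in> borel_measurable A"
  shows "(\<lambda>\<omega>. prox (\<lambda>v. ereal \<eta> * r v) (u \<omega>)) \<in> borel_measurable A"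
  by (rule measurable_compose[OF assms(4) borel_measurable_continuous_onI[OF continuous_on_prox[OF assms(1-3)]]])

lemma borel_measurable_prox_rows:
  fixes r :: "'b::euclidean_space \<Rightarrow> ereal" and u :: "'a \<Rightarrow> 'b^'m::finite"
  assumes "closed_convex_fun r" "x0 \<in> eff_dom r" "\<eta> > 0" "u \<in> borel_measurable A"
  shows "(\<lambda>\<omega>. prox_rows (\<lambda>v. ereal \<eta> * r v) (u \<omega>)) \<in> borel_measurable A"
  by (rule borel_measurable_rows)
     (simp add: prox_rows_def borel_measurable_prox[OF assms(1-3)] borel_measurable_row[OF assms(4)])

section \<open>The random run\<close>

locale vrlm_random = vrlm W \<rho> f h \<mu> L y0 g phi_star \<beta> \<eta>x \<eta>y \<eta>L x0 + prob_space M
  for W :: "real^'m::finite^'m" and \<rho> and f :: "'m \<Rightarrow> real^'p::finite \<Rightarrow> real^'q::finite \<Rightarrow> real"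
    and h :: "real^'q \<Rightarrow> ereal" and \<mu> L y0
    and g :: "real^'p \<Rightarrow> ereal" and phi_star \<beta> \<eta>x \<eta>y \<eta>L x0 and M :: "'w measure" +
  fixes \<D> :: "'m \<Rightarrow> 's measure"
    and G :: "'m \<Rightarrow> real^'p \<Rightarrow> real^'q \<Rightarrow> 's \<Rightarrow> (real^'p) \<times> (real^'q)"
    and \<sigma> :: real and \<xi> :: "nat \<Rightarrow> 'm \<Rightarrow> nat \<Rightarrow> 'w \<Rightarrow> 's" and S :: "nat \<Rightarrow> nat"
    and X V :: "nat \<Rightarrow> 'w \<Rightarrow> real^'p^'m"
    and \<Lambda> Y :: "nat \<Rightarrow> 'w \<Rightarrow> real^'q^'m"
    and D :: "nat \<Rightarrow> 'w \<Rightarrow> ((real^'p) \<times> (real^'q))^'m"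
  assumes prob_D: "\<And>i. prob_space (\<D> i)"
    and G_measurable: "\<And>i. (\<lambda>((x, y), s). G i x y s) \<in> borel_measurable (borel \<Otimes>\<^sub>M \<D> i)"
    and G_unbiased:
      "\<And>i x y. has_bochner_integral (\<D> i) (G i x y) (grad (\<lambda>(x, y). f i x y) (x, y))"
    and G_variance:
      "\<And>i x y. (\<integral>\<^sup>+s. ennreal ((norm (G i x y s - grad (\<lambda>(x, y). f i x y) (x, y)))\<^sup>2) \<partial>\<D> i)
         \<le> ennreal (\<sigma>\<^sup>2)"
    and G_ms_lipschitz:
      "\<And>i x y x' y'. (\<integral>\<^sup>+s. ennreal ((norm (G i x y s - G i x' y' s))\<^sup>2) \<partial>\<D> i)
         \<le> ennreal (L\<^sup>2 * ((norm (x - x'))\<^sup>2 + (norm (y - y'))\<^sup>2))"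
    and S_pos: "\<And>t. S t \<ge> 1"
    and sample_distr:
      "\<And>t i k. k < S t \<Longrightarrow> \<xi> t i k \<in> measurable M (\<D> i) \<and> distr M (\<D> i) (\<xi> t i k) = \<D> i"
    and sample_indep: "\<And>t i. indep_vars (\<lambda>_. \<D> i) (\<xi> t i) {..<S t}"
    and sample_indep_past:
      "\<And>t i. indep_var
         (sample_space \<D> {(s, j, k). s = t \<and> j = i \<and> k < S s})
           (samples \<xi> {(s, j, k). s = t \<and> j = i \<and> k < S s})
         (sample_space \<D> {(s, j, k). s < t \<and> k < S s})
           (samples \<xi> {(s, j, k). s < t \<and> k < S s})"
    and run: "\<And>\<omega>. \<omega> \<in> space M \<Longrightarrow>
        vrlm_storm G g h W L \<beta> \<eta>x \<eta>y \<eta>L S x0 y0 (\<lambda>t i k. \<xi> t i k \<omega>)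
          (\<lambda>t. X t \<omega>) (\<lambda>t. \<Lambda> t \<omega>) (\<lambda>t. Y t \<omega>) (\<lambda>t. D t \<omega>) (\<lambda>t. V t \<omega>)"
begin

lemma run_eqs:
  assumes "\<omega> \<in> space M"
  shows "X 0 \<omega> = const_rows x0" "Y 0 \<omega> = const_rows y0" "\<Lambda> 0 \<omega> = 0"
    "D 0 \<omega> $ i = batch_grad (G i) (S 0) (\<lambda>k. \<xi> 0 i k \<omega>) (X 0 \<omega> $ i) (Y 0 \<omega> $ i)"
    "V 0 \<omega> = x_part (D 0 \<omega>)"
    "D (Suc t) \<omega> $ i = batch_grad (G i) (S (Suc t)) (\<lambda>k. \<xi> (Suc t) i k \<omega>) (X (Suc t) \<omega> $ i) (Y (Suc t) \<omega> $ i)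
        + (1 - \<beta>) *\<^sub>R (D t \<omega> $ i - batch_grad (G i) (S (Suc t)) (\<lambda>k. \<xi> (Suc t) i k \<omega>) (X t \<omega> $ i) (Y t \<omega> $ i))"
    "V (Suc t) \<omega> = W ** (V t \<omega> + x_part (D (Suc t) \<omega>) - x_part (D t \<omega>))"
    "\<Lambda> (Suc t) \<omega> = \<Lambda> t \<omega> + (L * \<eta>L / (2 * sqrt (real CARD('m)))) *\<^sub>R ((W - mat 1) ** Y t \<omega>)"
    "X (Suc t) \<omega> = prox_rows (\<lambda>v. ereal \<eta>x * g v) (W ** X t \<omega> - \<eta>x *\<^sub>R V t \<omega>)"
    "Y (Suc t) \<omega> = prox_rows (\<lambda>v. ereal \<eta>y * h v) (Y t \<omega> + \<eta>y *\<^sub>R (y_part (D t \<omega>) - cm (\<Lambda> t \<omega>)))"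
  using run[OF assms] unfolding vrlm_storm_def cm_def by blast+

section \<open>Measurability of the iterates\<close>

lemma borel_measurable_eqI:
  "F' \<in> borel_measurable A \<Longrightarrow> (\<And>\<omega>. \<omega> \<in> space A \<Longrightarrow> F \<omega> = F' \<omega>) \<Longrightarrow> F \<in> borel_measurable A"
  by (simp cong: measurable_cong)

lemma path: "\<omega> \<in> space M \<Longrightarrow> vrlm_path W \<rho> f h \<mu> L y0 g phi_star \<beta> \<eta>x \<eta>y \<eta>L x0
    (\<lambda>t. X t \<omega>) (\<lambda>t. V t \<omega>) (\<lambda>t. \<Lambda> t \<omega>) (\<lambda>t. Y t \<omega>) (\<lambda>t. D t \<omega>)"
  using run[of \<omega>] unfolding vrlm_storm_def by unfold_locales auto

lemma G_measurable' [measurable (raw)]: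
  assumes [measurable]: "u \<in> borel_measurable A" "v \<in> borel_measurable A" "w \<in> A \<rightarrow>\<^sub>M \<D> i"
  shows "(\<lambda>\<omega>. G i (u \<omega>) (v \<omega>) (w \<omega>)) \<in> borel_measurable A"
proof -
  have "(\<lambda>\<omega>. ((u \<omega>, v \<omega>), w \<omega>)) \<in> A \<rightarrow>\<^sub>M borel \<Otimes>\<^sub>M \<D> i" by measurable
  from measurable_compose[OF this G_measurable] show ?thesis by simp
qed

lemma batch_grad_measurable:
  assumes [measurable]: "u \<in> borel_measurable A" "v \<in> borel_measurable A"
    and "\<And>k. k < n \<Longrightarrow> (\<lambda>\<omega>. b \<omega> k) \<in> A \<rightarrow>\<^sub>M \<D> i"
  shows "(\<lambda>\<omega>. batch_grad (G i) n (b \<omega>) (u \<omega>) (v \<omega>)) \<in> borel_measurable A"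
  unfolding batch_grad_def using assms(3)
  by (intro borel_measurable_scaleR borel_measurable_sum borel_measurable_const G_measurable') auto

lemma cm_measurable [measurable (raw)]:
  "u \<in> borel_measurable A \<Longrightarrow> (\<lambda>\<omega>. cm (u \<omega>)) \<in> borel_measurable A"
  unfolding cm_def by (intro borel_measurable_scaleR borel_measurable_const borel_measurable_matrix_mult)

text \<open>\<open>A\<close> stands for \<open>M\<close>, for the past of an iteration and for the
  sigma-algebra of all samples. The batch drawn at iteration \<open>t\<close> affects
  \<open>D t\<close> and \<open>V t\<close> but \<open>X\<close>, \<open>Y\<close> and \<Lambda>
  only from \<open>Suc t\<close> on, hence the different index ranges.\<close>

lemma iterates_measurable:
  assumes sp: "space A = space M"
    and xi: "\<And>s i k. s < t \<Longrightarrow> k < S s \<Longrightarrow> \<xi> s i k \<in> A \<rightarrow>\<^sub>M \<D> i"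
  shows "X t \<in> borel_measurable A \<and> Y t \<in> borel_measurable A \<and> \<Lambda> t \<in> borel_measurable A
     \<and> (\<forall>s<t. D s \<in> borel_measurable A \<and> V s \<in> borel_measurable A
          \<and> X s \<in> borel_measurable A \<and> Y s \<in> borel_measurable A)"
  using xi
proof (induction t)
  case 0
  have "X 0 \<in> borel_measurable A"
    by (rule borel_measurable_eqI[where F'="\<lambda>_. const_rows x0"]) (simp_all add: sp run_eqs(1))
  moreover have "Y 0 \<in> borel_measurable A"
    by (rule borel_measurable_eqI[where F'="\<lambda>_. const_rows y0"]) (simp_all add: sp run_eqs(2))
  moreover have "\<Lambda> 0 \<in> borel_measurable A"
    by (rule borel_measurable_eqI[where F'="\<lambda>_. 0"]) (simp_all add: sp run_eqs(3))
  ultimately show ?case by simp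
next
  case (Suc t)
  then have IH: "X t \<in> borel_measurable A" "Y t \<in> borel_measurable A" "\<Lambda> t \<in> borel_measurable A"
      "\<And>s. s < t \<Longrightarrow> D s \<in> borel_measurable A" "\<And>s. s < t \<Longrightarrow> V s \<in> borel_measurable A"
      "\<And>s. s < t \<Longrightarrow> X s \<in> borel_measurable A" "\<And>s. s < t \<Longrightarrow> Y s \<in> borel_measurable A" by auto
  note [measurable] = IH(1-3)
  have xi: "\<And>i k. k < S t \<Longrightarrow> \<xi> t i k \<in> A \<rightarrow>\<^sub>M \<D> i" using Suc.prems by simp
  have bg: "(\<lambda>\<omega>. batch_grad (G i) (S t) (\<lambda>k. \<xi> t i k \<omega>) (u \<omega>) (v \<omega>)) \<in> borel_measurable A"
    if "u \<in> borel_measurable A" "v \<in> borel_measurable A" for i u v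
    by (rule batch_grad_measurable[OF that xi])
  have Dm[measurable]: "D t \<in> borel_measurable A"
  proof (rule borel_measurable_rows)
    fix i
    show "(\<lambda>\<omega>. D t \<omega> $ i) \<in> borel_measurable A"
    proof (cases t)
      case 0
      show ?thesis
        by (rule borel_measurable_eqI[OF bg[of "\<lambda>\<omega>. X t \<omega> $ i" "\<lambda>\<omega>. Y t \<omega> $ i" i]])
           (simp_all add: sp run_eqs(4) 0[symmetric] IH borel_measurable_row, simp add: 0 sp run_eqs(4))
    next
      case (Suc s)
      have [measurable]: "D s \<in> borel_measurable A" using IH(4) Suc by simp
      have XYs: "X s \<in> borel_measurable A" "Y s \<in> borel_measurable A"
        using IH(6,7) Suc by simp_all
      show ?thesis
      proof (rule borel_measurable_eqI)
        show "D t \<omega> $ i = batch_grad (G i) (S t) (\<lambda>k. \<xi> t i k \<omega>) (X t \<omega> $ i) (Y t \<omega> $ i)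
          + (1 - \<beta>) *\<^sub>R (D s \<omega> $ i - batch_grad (G i) (S t) (\<lambda>k. \<xi> t i k \<omega>) (X s \<omega> $ i) (Y s \<omega> $ i))"
          if "\<omega> \<in> space A" for \<omega>
          using that by (simp add: sp Suc run_eqs(6))
      qed (intro borel_measurable_add borel_measurable_scaleR borel_measurable_diff bg borel_measurable_const
          borel_measurable_row IH XYs \<open>D s \<in> borel_measurable A\<close>)
    qed
  qed
  have Vm[measurable]: "V t \<in> borel_measurable A"
  proof (cases t)
    case 0
    show ?thesis
    proof (rule borel_measurable_eqI)
      show "V t \<omega> = x_part (D t \<omega>)" if "\<omega> \<in> space A" for \<omega> using that by (simp add: sp 0 run_eqs(5))
    qed simp
  next
    case (Suc s)
    have [measurable]: "D s \<in> borel_measurable A" "V s \<in> borel_measurable A" using IH(4,5) Suc by simp_all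
    show ?thesis
    proof (rule borel_measurable_eqI)
      show "V t \<omega> = W ** (V s \<omega> + x_part (D t \<omega>) - x_part (D s \<omega>))" if "\<omega> \<in> space A" for \<omega>
        using that by (simp add: sp Suc run_eqs(7))
    qed simp
  qed
  have 1: "\<Lambda> (Suc t) \<in> borel_measurable A"
  proof (rule borel_measurable_eqI)
    show "\<Lambda> (Suc t) \<omega> = \<Lambda> t \<omega> + (L * \<eta>L / (2 * sqrt (real CARD('m)))) *\<^sub>R ((W - mat 1) ** Y t \<omega>)"
      if "\<omega> \<in> space A" for \<omega> using that by (simp add: sp run_eqs(8))
  qed simp
  have 2: "X (Suc t) \<in> borel_measurable A"
  proof (rule borel_measurable_eqI[OF borel_measurable_prox_rows[OF g_cc x0_dom eta_pos(1)]])
    show "X (Suc t) \<omega> = prox_rows (\<lambda>v. ereal \<eta>x * g v) (W ** X t \<omega> - \<eta>x *\<^sub>R V t \<omega>)"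
      if "\<omega> \<in> space A" for \<omega> using that by (simp add: sp run_eqs(9))
  qed simp
  have 3: "Y (Suc t) \<in> borel_measurable A"
  proof (rule borel_measurable_eqI[OF borel_measurable_prox_rows[OF h_cc y0_dom eta_pos(2)]])
    show "Y (Suc t) \<omega> = prox_rows (\<lambda>v. ereal \<eta>y * h v) (Y t \<omega> + \<eta>y *\<^sub>R (y_part (D t \<omega>) - cm (\<Lambda> t \<omega>)))"
      if "\<omega> \<in> space A" for \<omega> using that by (simp add: sp run_eqs(10))
  qed simp
  show ?case using 1 2 3 IH Dm Vm by (auto simp: less_Suc_eq)
qed

lemma iterates_measurable_M [measurable]:
  "X t \<in> borel_measurable M" "Y t \<in> borel_measurable M" "\<Lambda> t \<in> borel_measurable M"
  "D t \<in> borel_measurable M" "V t \<in> borel_measurable M"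
  using iterates_measurable[of M t] iterates_measurable[of M "Suc t"] sample_distr by auto

definition "past t = vimage_algebra (space M) (samples \<xi> {(s, j, k). s < t \<and> k < S s})
    (sample_space \<D> {(s, j, k). s < t \<and> k < S s})"

lemma samples_measurable_vimage:
  fixes J :: "(nat \<times> 'm \<times> nat) set"
  assumes J: "(s, i, k) \<in> J" and rv: "samples \<xi> J \<in> M \<rightarrow>\<^sub>M sample_space \<D> J"
  shows "\<xi> s i k \<in> vimage_algebra (space M) (samples \<xi> J) (sample_space \<D> J) \<rightarrow>\<^sub>M \<D> i"
proof -
  have c: "(\<lambda>b. b (s, i, k)) \<in> sample_space \<D> J \<rightarrow>\<^sub>M \<D> i"
    using measurable_component_singleton[OF J, of "\<lambda>(t, i, k). \<D> i"] by (simp add: sample_space_def)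
  have "samples \<xi> J \<in> vimage_algebra (space M) (samples \<xi> J) (sample_space \<D> J) \<rightarrow>\<^sub>M sample_space \<D> J"
    using measurable_space[OF rv] by (intro measurable_vimage_algebra1) auto
  from measurable_compose[OF this c] show ?thesis using J by (simp add: samples_def)
qed

lemma iterates_past:
  "X t \<in> borel_measurable (past t)" "Y t \<in> borel_measurable (past t)" "\<Lambda> t \<in> borel_measurable (past t)"
  "s < t \<Longrightarrow> X s \<in> borel_measurable (past t)" "s < t \<Longrightarrow> Y s \<in> borel_measurable (past t)"
  "s < t \<Longrightarrow> D s \<in> borel_measurable (past t)"
proof -
  have rv: "samples \<xi> {(s, j, k). s < t \<and> k < S s} \<in> M \<rightarrow>\<^sub>M sample_space \<D> {(s, j, k). s < t \<and> k < S s}"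
    using indep_var_rv2[OF sample_indep_past] .
  have xi: "\<xi> s i k \<in> past t \<rightarrow>\<^sub>M \<D> i" if "s < t" "k < S s" for s i k
    unfolding past_def by (rule samples_measurable_vimage[OF _ rv]) (use that in simp)
  have sp: "space (past t) = space M" by (simp add: past_def)
  from iterates_measurable[OF sp xi]
  show "X t \<in> borel_measurable (past t)" "Y t \<in> borel_measurable (past t)" "\<Lambda> t \<in> borel_measurable (past t)"
    "s < t \<Longrightarrow> D s \<in> borel_measurable (past t)" by auto
  show "s < t \<Longrightarrow> X s \<in> borel_measurable (past t)" "s < t \<Longrightarrow> Y s \<in> borel_measurable (past t)"
    using iterates_measurable[OF sp, of s] xi by auto
qed

section \<open>Second moments of the estimator at frozen iterates\<close>

lemma G_fixed_measurable [measurable]: "G i x y \<in> borel_measurable (\<D> i)"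
  using G_measurable'[of "\<lambda>_. x" "\<D> i" "\<lambda>_. y" "\<lambda>s. s" i] by simp

lemma nn_integral_sample:
  assumes "k < S t" and [measurable]: "F \<in> borel_measurable (\<D> i)"
  shows "(\<integral>\<^sup>+\<omega>. F (\<xi> t i k \<omega>) \<partial>M) = (\<integral>\<^sup>+s. F s \<partial>\<D> i)"
proof -
  have [measurable]: "\<xi> t i k \<in> M \<rightarrow>\<^sub>M \<D> i" and d: "distr M (\<D> i) (\<xi> t i k) = \<D> i" using sample_distr assms(1) by auto
  show ?thesis by (subst d[symmetric], subst nn_integral_distr) auto
qed

lemma expectation_sample:
  fixes F :: "'s \<Rightarrow> 'z::{banach, second_countable_topology}"
  assumes "k < S t" and [measurable]: "F \<in> borel_measurable (\<D> i)"
  shows "(\<integral>\<omega>. F (\<xi> t i k \<omega>) \<partial>M) = (\<integral>s. F s \<partial>\<D> i)"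
proof -
  have [measurable]: "\<xi> t i k \<in> M \<rightarrow>\<^sub>M \<D> i" and d: "distr M (\<D> i) (\<xi> t i k) = \<D> i" using sample_distr assms(1) by auto
  show ?thesis by (subst d[symmetric], subst integral_distr) auto
qed

lemma G_mean: "integrable (\<D> i) (G i x y)" "(\<integral>s. G i x y s \<partial>\<D> i) = gf i x y"
  using G_unbiased[of i x y] by (auto simp: has_bochner_integral_iff gf_def)

lemma G_var: "(\<integral>\<^sup>+s. ennreal ((norm (G i x y s - gf i x y))\<^sup>2) \<partial>\<D> i) \<le> ennreal (\<sigma>\<^sup>2)"
  using G_variance by (simp add: gf_def)

lemma batch_average_le:
  fixes F :: "'s \<Rightarrow> 'z::euclidean_space"
  assumes [measurable]: "F \<in> borel_measurable (\<D> i)" and zero: "(\<integral>s. F s \<partial>\<D> i) = 0"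
    and sq: "(\<integral>\<^sup>+s. ennreal ((norm (F s))\<^sup>2) \<partial>\<D> i) \<le> ennreal c" and c: "0 \<le> c"
  shows "(\<integral>\<^sup>+\<omega>. ennreal ((norm (r + (1 / real (S t)) *\<^sub>R (\<Sum>k<S t. F (\<xi> t i k \<omega>))))\<^sup>2) \<partial>M)
     \<le> ennreal ((norm r)\<^sup>2 + c / real (S t))"
proof (rule nn_integral_norm_add_average_le[OF _ S_pos c])
  show "indep_vars (\<lambda>_. borel) (\<lambda>k \<omega>. F (\<xi> t i k \<omega>)) {..<S t}"
    by (rule indep_vars_compose2[OF sample_indep]) simp
  show "k < S t \<Longrightarrow> (\<integral>\<omega>. F (\<xi> t i k \<omega>) \<partial>M) = 0" for k by (simp add: expectation_sample zero)
  show "k < S t \<Longrightarrow> (\<integral>\<^sup>+\<omega>. ennreal ((norm (F (\<xi> t i k \<omega>)))\<^sup>2) \<partial>M) \<le> ennreal c" for k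
    using sq nn_integral_sample[of k t "\<lambda>s. ennreal ((norm (F s))\<^sup>2)" i] by simp
qed

abbreviation "storm_est i t b x y x' y' d \<equiv>
  batch_grad (G i) (S t) b x' y' + (1 - \<beta>) *\<^sub>R (d - batch_grad (G i) (S t) b x y)"

definition "zdist x y x' y' = (norm (x' - x))\<^sup>2 + (norm (y' - y))\<^sup>2"

lemma batch_error_eq:
  "batch_grad (G i) (S t) b x y - gf i x y = (1 / real (S t)) *\<^sub>R (\<Sum>k<S t. G i x y (b k) - gf i x y)"
  using S_pos[of t] by (simp add: batch_grad_def sum_subtractf sum_constant_scaleR scaleR_diff_right)

text \<open>The new error is \<open>1 - \<beta>\<close> times the old one plus a batch mean of the
  centered variable \<open>F\<close>, so there is no cross term. \<open>F\<close> itself is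
  \<open>1 - \<beta>\<close> times a centered gradient difference, small by mean-square smoothness,
  plus \<open>\<beta>\<close> times the noise at the new point.\<close>

lemma storm_error_fixed:
  "(\<integral>\<^sup>+\<omega>. ennreal ((norm (storm_est i t (\<lambda>k. \<xi> t i k \<omega>) x y x' y' d - gf i x' y'))\<^sup>2) \<partial>M)
     \<le> ennreal ((1 - \<beta>) * (norm (d - gf i x y))\<^sup>2 + 2 * L\<^sup>2 * zdist x y x' y' + 2 * \<beta>\<^sup>2 * \<sigma>\<^sup>2 / real (S t))"
proof -
  let ?n = "real (S t)"
  interpret Di: prob_space "\<D> i" by (rule prob_D)
  define F where "F s = (G i x' y' s - gf i x' y') - (1 - \<beta>) *\<^sub>R (G i x y s - gf i x y)" for s
  define c where "c = 2 * (1 - \<beta>)\<^sup>2 * (L\<^sup>2 * zdist x y x' y') + 2 * \<beta>\<^sup>2 * \<sigma>\<^sup>2"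
  have z0: "0 \<le> L\<^sup>2 * zdist x y x' y'" by (simp add: zdist_def)
  have c0: "0 \<le> c" unfolding c_def using z0 by simp
  have [measurable]: "F \<in> borel_measurable (\<D> i)" unfolding F_def by measurable
  have zero: "(\<integral>s. F s \<partial>\<D> i) = 0"
    unfolding F_def using G_mean[of i x y] G_mean[of i x' y'] by (simp add: Di.prob_space)
  have "(\<integral>\<^sup>+s. ennreal ((norm (G i x' y' s - G i x y s - (gf i x' y' - gf i x y)))\<^sup>2) \<partial>\<D> i)
     \<le> ennreal (L\<^sup>2 * zdist x y x' y')"
    using G_mean[of i x y] G_mean[of i x' y'] G_ms_lipschitz[of i x' y' x y] z0
    by (intro Di.nn_integral_centered_le) (auto simp: has_bochner_integral_iff zdist_def)
  then have le1: "ennreal (2 * (1 - \<beta>)\<^sup>2) * (\<integral>\<^sup>+s. ennreal ((norm (G i x' y' s - G i x y s - (gf i x' y' - gf i x y)))\<^sup>2) \<partial>\<D> i)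
     \<le> ennreal (2 * (1 - \<beta>)\<^sup>2) * ennreal (L\<^sup>2 * zdist x y x' y')" by (rule mult_left_mono) simp
  have le2: "ennreal (2 * \<beta>\<^sup>2) * (\<integral>\<^sup>+s. ennreal ((norm (G i x' y' s - gf i x' y'))\<^sup>2) \<partial>\<D> i)
     \<le> ennreal (2 * \<beta>\<^sup>2) * ennreal (\<sigma>\<^sup>2)" by (rule mult_left_mono[OF G_var]) simp
  have pt: "(norm (F s))\<^sup>2 \<le> 2 * (1 - \<beta>)\<^sup>2 * (norm (G i x' y' s - G i x y s - (gf i x' y' - gf i x y)))\<^sup>2
      + 2 * \<beta>\<^sup>2 * (norm (G i x' y' s - gf i x' y'))\<^sup>2" for s
  proof -
    have "F s = (1 - \<beta>) *\<^sub>R (G i x' y' s - G i x y s - (gf i x' y' - gf i x y)) + \<beta> *\<^sub>R (G i x' y' s - gf i x' y')"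
      by (simp add: F_def algebra_simps)
    then show ?thesis
      using norm_add_sq_le[of "(1 - \<beta>) *\<^sub>R (G i x' y' s - G i x y s - (gf i x' y' - gf i x y))" "\<beta> *\<^sub>R (G i x' y' s - gf i x' y')"]
      by (simp add: power_mult_distrib)
  qed
  have "(\<integral>\<^sup>+s. ennreal ((norm (F s))\<^sup>2) \<partial>\<D> i) \<le> (\<integral>\<^sup>+s.
      ennreal (2 * (1 - \<beta>)\<^sup>2) * ennreal ((norm (G i x' y' s - G i x y s - (gf i x' y' - gf i x y)))\<^sup>2)
      + ennreal (2 * \<beta>\<^sup>2) * ennreal ((norm (G i x' y' s - gf i x' y'))\<^sup>2) \<partial>\<D> i)"
    using pt by (intro nn_integral_mono) (simp add: ennreal_mult[symmetric] ennreal_plus[symmetric] del: ennreal_plus)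
  also have "\<dots> \<le> ennreal (2 * (1 - \<beta>)\<^sup>2) * ennreal (L\<^sup>2 * zdist x y x' y') + ennreal (2 * \<beta>\<^sup>2) * ennreal (\<sigma>\<^sup>2)"
    using le1 le2 by (simp add: nn_integral_add nn_integral_cmult add_mono)
  also have "\<dots> = ennreal c"
    using z0 by (simp add: c_def ennreal_mult[symmetric] ennreal_plus[symmetric] del: ennreal_plus)
  finally have sq: "(\<integral>\<^sup>+s. ennreal ((norm (F s))\<^sup>2) \<partial>\<D> i) \<le> ennreal c" .
  have "storm_est i t b x y x' y' d - gf i x' y'
      = (1 - \<beta>) *\<^sub>R (d - gf i x y) + (1 / ?n) *\<^sub>R (\<Sum>k<S t. F (b k))" for b
  proof -
    have "storm_est i t b x y x' y' d - gf i x' y'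
      = (1 - \<beta>) *\<^sub>R (d - gf i x y) + ((batch_grad (G i) (S t) b x' y' - gf i x' y') - (1 - \<beta>) *\<^sub>R (batch_grad (G i) (S t) b x y - gf i x y))"
      by (simp add: algebra_simps)
    then show ?thesis unfolding batch_error_eq F_def
      by (simp add: sum_subtractf scaleR_diff_right scaleR_sum_right ac_simps)
  qed
  then have "(\<integral>\<^sup>+\<omega>. ennreal ((norm (storm_est i t (\<lambda>k. \<xi> t i k \<omega>) x y x' y' d - gf i x' y'))\<^sup>2) \<partial>M)
     \<le> ennreal ((norm ((1 - \<beta>) *\<^sub>R (d - gf i x y)))\<^sup>2 + c / ?n)"
    using batch_average_le[OF _ zero sq c0, of "(1 - \<beta>) *\<^sub>R (d - gf i x y)" t] by simp
  also have "\<dots> \<le> ennreal ((1 - \<beta>) * (norm (d - gf i x y))\<^sup>2 + 2 * L\<^sup>2 * zdist x y x' y' + 2 * \<beta>\<^sup>2 * \<sigma>\<^sup>2 / ?n)"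
  proof (rule ennreal_leI)
    have b: "(1 - \<beta>)\<^sup>2 \<le> 1 - \<beta>" "(1 - \<beta>)\<^sup>2 \<le> 1" using beta by (auto simp: power2_eq_square mult_left_le mult_le_one)
    have "(norm ((1 - \<beta>) *\<^sub>R (d - gf i x y)))\<^sup>2 = (1 - \<beta>)\<^sup>2 * (norm (d - gf i x y))\<^sup>2" by (simp add: power_mult_distrib)
    also have "\<dots> \<le> (1 - \<beta>) * (norm (d - gf i x y))\<^sup>2" using b by (intro mult_right_mono) auto
    finally have 1: "(norm ((1 - \<beta>) *\<^sub>R (d - gf i x y)))\<^sup>2 \<le> (1 - \<beta>) * (norm (d - gf i x y))\<^sup>2" .
    have n: "?n \<ge> 1" using S_pos[of t] by simp
    have "2 * (1 - \<beta>)\<^sup>2 * (L\<^sup>2 * zdist x y x' y') / ?n \<le> 2 * (1 - \<beta>)\<^sup>2 * (L\<^sup>2 * zdist x y x' y') / 1"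
      using n z0 by (intro divide_left_mono) auto
    also have "\<dots> \<le> 2 * (L\<^sup>2 * zdist x y x' y')" using b z0 mult_right_mono[OF b(2) z0] by simp
    finally have "c / ?n \<le> 2 * L\<^sup>2 * zdist x y x' y' + 2 * \<beta>\<^sup>2 * \<sigma>\<^sup>2 / ?n" by (simp add: c_def add_divide_distrib)
    then show "(norm ((1 - \<beta>) *\<^sub>R (d - gf i x y)))\<^sup>2 + c / ?n
        \<le> (1 - \<beta>) * (norm (d - gf i x y))\<^sup>2 + 2 * L\<^sup>2 * zdist x y x' y' + 2 * \<beta>\<^sup>2 * \<sigma>\<^sup>2 / ?n" using 1 by linarith
  qed
  finally show ?thesis .
qed

lemma initial_error_fixed:
  "(\<integral>\<^sup>+\<omega>. ennreal ((norm (batch_grad (G i) (S t) (\<lambda>k. \<xi> t i k \<omega>) x y - gf i x y))\<^sup>2) \<partial>M) \<le> ennreal (\<sigma>\<^sup>2 / real (S t))"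
proof -
  interpret Di: prob_space "\<D> i" by (rule prob_D)
  have "(\<integral>s. G i x y s - gf i x y \<partial>\<D> i) = 0" using G_mean[of i x y] by (simp add: Di.prob_space)
  from batch_average_le[OF _ this G_var, of 0 t] show ?thesis unfolding batch_error_eq by simp
qed

lemma norm_add3_sq_le: "(norm (a + b + c))\<^sup>2 \<le> 3 * (norm a)\<^sup>2 + 3 * (norm b)\<^sup>2 + 3 * (norm c)\<^sup>2"
  for a b c :: "'z::real_inner"
proof -
  have "(norm (a + b + c))\<^sup>2 \<le> (norm a + norm b + norm c)\<^sup>2"
    by (intro power_mono norm_ge_zero order_trans[OF norm_triangle_ineq] add_right_mono norm_triangle_ineq)
  also have "\<dots> \<le> 3 * (norm a)\<^sup>2 + 3 * (norm b)\<^sup>2 + 3 * (norm c)\<^sup>2"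
    using zero_le_power2[of "norm a - norm b"] zero_le_power2[of "norm b - norm c"] zero_le_power2[of "norm a - norm c"]
    unfolding power2_eq_square by (simp add: algebra_simps)
  finally show ?thesis .
qed

text \<open>The increment consists of the batch difference between the two points,
  \<open>- \<beta>\<close> times the old error, and \<open>\<beta>\<close> times the batch noise at
  the old point. The first part is not centered and is bounded by convexity over the batch, without
  a gain from the batch size.\<close>

lemma storm_increment_fixed:
  "(\<integral>\<^sup>+\<omega>. ennreal ((norm (storm_est i t (\<lambda>k. \<xi> t i k \<omega>) x y x' y' d - d))\<^sup>2) \<partial>M)
     \<le> ennreal (3 * \<beta>\<^sup>2 * (norm (d - gf i x y))\<^sup>2 + 3 * L\<^sup>2 * zdist x y x' y' + 3 * \<beta>\<^sup>2 * \<sigma>\<^sup>2 / real (S t))"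
proof -
  let ?n = "real (S t)"
  let ?g = "\<lambda>\<omega> x y. batch_grad (G i) (S t) (\<lambda>k. \<xi> t i k \<omega>) x y"
  have xi[measurable]: "k < S t \<Longrightarrow> \<xi> t i k \<in> M \<rightarrow>\<^sub>M \<D> i" for k using sample_distr by blast
  have gm[measurable]: "(\<lambda>\<omega>. ?g \<omega> u v) \<in> borel_measurable M" for u v
    by (rule batch_grad_measurable) auto
  have z0: "0 \<le> L\<^sup>2 * zdist x y x' y'" by (simp add: zdist_def)
  have pt: "(norm (?g \<omega> x' y' + (1 - \<beta>) *\<^sub>R (d - ?g \<omega> x y) - d))\<^sup>2
     \<le> 3 * (norm (?g \<omega> x' y' - ?g \<omega> x y))\<^sup>2 + 3 * \<beta>\<^sup>2 * (norm (d - gf i x y))\<^sup>2 + 3 * \<beta>\<^sup>2 * (norm (?g \<omega> x y - gf i x y))\<^sup>2" for \<omega>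
  proof -
    have e: "?g \<omega> x' y' + (1 - \<beta>) *\<^sub>R (d - ?g \<omega> x y) - d
      = (?g \<omega> x' y' - ?g \<omega> x y) + (- \<beta>) *\<^sub>R (d - gf i x y) + \<beta> *\<^sub>R (?g \<omega> x y - gf i x y)"
      by (simp add: algebra_simps)
    show ?thesis unfolding e
      using norm_add3_sq_le[of "?g \<omega> x' y' - ?g \<omega> x y" "(- \<beta>) *\<^sub>R (d - gf i x y)" "\<beta> *\<^sub>R (?g \<omega> x y - gf i x y)"]
      by (simp add: power_mult_distrib)
  qed
  have A: "(\<integral>\<^sup>+\<omega>. ennreal ((norm (?g \<omega> x' y' - ?g \<omega> x y))\<^sup>2) \<partial>M) \<le> ennreal (L\<^sup>2 * zdist x y x' y')"
  proof -
    have "?g \<omega> x' y' - ?g \<omega> x y = (1 / ?n) *\<^sub>R (\<Sum>k<S t. G i x' y' (\<xi> t i k \<omega>) - G i x y (\<xi> t i k \<omega>))" for \<omega>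
      by (simp add: batch_grad_def sum_subtractf scaleR_diff_right)
    then have "(norm (?g \<omega> x' y' - ?g \<omega> x y))\<^sup>2
       \<le> (1 / ?n) * (\<Sum>k<S t. (norm (G i x' y' (\<xi> t i k \<omega>) - G i x y (\<xi> t i k \<omega>)))\<^sup>2)" for \<omega>
      using norm_average_sq_le[OF S_pos] by simp
    then have "(\<integral>\<^sup>+\<omega>. ennreal ((norm (?g \<omega> x' y' - ?g \<omega> x y))\<^sup>2) \<partial>M)
      \<le> (\<integral>\<^sup>+\<omega>. ennreal (1 / ?n) * (\<Sum>k<S t. ennreal ((norm (G i x' y' (\<xi> t i k \<omega>) - G i x y (\<xi> t i k \<omega>)))\<^sup>2)) \<partial>M)"
      by (intro nn_integral_mono) (simp add: sum_ennreal ennreal_mult[symmetric] sum_nonneg ennreal_leI)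
    also have "\<dots> = ennreal (1 / ?n) * (\<Sum>k<S t. (\<integral>\<^sup>+\<omega>. ennreal ((norm (G i x' y' (\<xi> t i k \<omega>) - G i x y (\<xi> t i k \<omega>)))\<^sup>2) \<partial>M))"
    proof -
      have m: "(\<lambda>\<omega>. ennreal ((norm (G i x' y' (\<xi> t i k \<omega>) - G i x y (\<xi> t i k \<omega>)))\<^sup>2)) \<in> borel_measurable M"
        if "k \<in> {..<S t}" for k
      proof -
        have [measurable]: "\<xi> t i k \<in> M \<rightarrow>\<^sub>M \<D> i" using that xi by simp
        show ?thesis by measurable
      qed
      show ?thesis by (simp only: nn_integral_cmult[OF borel_measurable_sum[OF m]] nn_integral_sum[OF m])
    qed
    also have "\<dots> \<le> ennreal (1 / ?n) * (\<Sum>k<S t. ennreal (L\<^sup>2 * zdist x y x' y'))"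
    proof (intro mult_left_mono sum_mono)
      fix k assume "k \<in> {..<S t}"
      then show "(\<integral>\<^sup>+\<omega>. ennreal ((norm (G i x' y' (\<xi> t i k \<omega>) - G i x y (\<xi> t i k \<omega>)))\<^sup>2) \<partial>M) \<le> ennreal (L\<^sup>2 * zdist x y x' y')"
        using G_ms_lipschitz[of i x' y' x y] nn_integral_sample[of k t "\<lambda>s. ennreal ((norm (G i x' y' s - G i x y s))\<^sup>2)" i]
        by (simp add: zdist_def)
    qed simp
    also have "\<dots> = ennreal (1 / ?n * (\<Sum>k<S t. L\<^sup>2 * zdist x y x' y'))"
      using z0 by (simp add: sum_ennreal ennreal_mult[symmetric] sum_nonneg del: sum_constant)
    also have "1 / ?n * (\<Sum>k<S t. L\<^sup>2 * zdist x y x' y') = L\<^sup>2 * zdist x y x' y'" using S_pos[of t] by simp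
    finally show ?thesis .
  qed
  have "(\<integral>\<^sup>+\<omega>. ennreal ((norm (?g \<omega> x' y' + (1 - \<beta>) *\<^sub>R (d - ?g \<omega> x y) - d))\<^sup>2) \<partial>M)
    \<le> (\<integral>\<^sup>+\<omega>. ennreal 3 * ennreal ((norm (?g \<omega> x' y' - ?g \<omega> x y))\<^sup>2) + ennreal (3 * \<beta>\<^sup>2 * (norm (d - gf i x y))\<^sup>2)
        + ennreal (3 * \<beta>\<^sup>2) * ennreal ((norm (?g \<omega> x y - gf i x y))\<^sup>2) \<partial>M)"
    by (intro nn_integral_mono, subst ennreal_mult[symmetric], simp, simp, subst ennreal_mult[symmetric], simp, simp)
       (simp only: ennreal_plus[symmetric] zero_le_power2 mult_nonneg_nonneg add_nonneg_nonneg zero_le_numeral, rule ennreal_leI, rule pt)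
  also have "\<dots> = ennreal 3 * (\<integral>\<^sup>+\<omega>. ennreal ((norm (?g \<omega> x' y' - ?g \<omega> x y))\<^sup>2) \<partial>M) + ennreal (3 * \<beta>\<^sup>2 * (norm (d - gf i x y))\<^sup>2)
        + ennreal (3 * \<beta>\<^sup>2) * (\<integral>\<^sup>+\<omega>. ennreal ((norm (?g \<omega> x y - gf i x y))\<^sup>2) \<partial>M)"
    by (simp add: nn_integral_add nn_integral_cmult emeasure_space_1)
  also have "\<dots> \<le> ennreal 3 * ennreal (L\<^sup>2 * zdist x y x' y') + ennreal (3 * \<beta>\<^sup>2 * (norm (d - gf i x y))\<^sup>2)
        + ennreal (3 * \<beta>\<^sup>2) * ennreal (\<sigma>\<^sup>2 / ?n)"
    by (intro add_mono mult_left_mono A initial_error_fixed order_refl) auto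
  also have "\<dots> = ennreal (3 * (L\<^sup>2 * zdist x y x' y') + 3 * \<beta>\<^sup>2 * (norm (d - gf i x y))\<^sup>2 + 3 * \<beta>\<^sup>2 * (\<sigma>\<^sup>2 / ?n))"
    using z0 by (subst ennreal_mult[symmetric], simp, simp, subst ennreal_mult[symmetric], simp, simp)
       (simp only: ennreal_plus[symmetric] zero_le_power2 mult_nonneg_nonneg add_nonneg_nonneg zero_le_numeral divide_nonneg_nonneg of_nat_0_le_iff)
  finally show ?thesis by (simp add: ac_simps)
qed

text \<open>The new batch of one agent is independent of the past, which determines the old and new
  iterates and the old estimate; a bound for frozen arguments may therefore be integrated. The
  reference \<open>v\<close> is the new gradient for the error and the old estimate for the
  increment.\<close>

lemma condition_on_past:
  fixes t :: nat and i :: 'm and \<Psi> :: "(nat \<Rightarrow> 's) \<Rightarrow> real^'p \<Rightarrow> real^'q \<Rightarrow> real^'p \<Rightarrow> real^'q \<Rightarrow> (real^'p) \<times> (real^'q) \<Rightarrow> real"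
  assumes \<Psi>: "\<Psi> = (\<lambda>b x y x' y' d. (norm (storm_est i (Suc t) b x y x' y' d - v x' y' d))\<^sup>2)"
    and v: "\<And>(A :: ((nat \<times> 'm \<times> nat \<Rightarrow> 's) \<times> (real^'p) \<times> (real^'q) \<times> (real^'p) \<times> (real^'q) \<times> ((real^'p) \<times> (real^'q))) measure) u1 u2 u3. u1 \<in> borel_measurable A \<Longrightarrow> u2 \<in> borel_measurable A \<Longrightarrow> u3 \<in> borel_measurable A \<Longrightarrow>
       (\<lambda>\<omega>. v (u1 \<omega>) (u2 \<omega>) (u3 \<omega>)) \<in> borel_measurable A"
    and bound: "\<And>x y x' y' d. (\<integral>\<^sup>+\<omega>. ennreal (\<Psi> (\<lambda>k. \<xi> (Suc t) i k \<omega>) x y x' y' d) \<partial>M) \<le> ennreal (B x y x' y' d)"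
  shows "(\<integral>\<^sup>+\<omega>. ennreal (\<Psi> (\<lambda>k. \<xi> (Suc t) i k \<omega>) (X t \<omega> $ i) (Y t \<omega> $ i) (X (Suc t) \<omega> $ i) (Y (Suc t) \<omega> $ i) (D t \<omega> $ i)) \<partial>M)
     \<le> (\<integral>\<^sup>+\<omega>. ennreal (B (X t \<omega> $ i) (Y t \<omega> $ i) (X (Suc t) \<omega> $ i) (Y (Suc t) \<omega> $ i) (D t \<omega> $ i)) \<partial>M)"
proof -
  define J where "J = {(s, j, k). s = Suc t \<and> j = i \<and> k < S s}"
  let ?N = "borel \<Otimes>\<^sub>M borel \<Otimes>\<^sub>M borel \<Otimes>\<^sub>M borel \<Otimes>\<^sub>M borel"
  define Z where "Z \<omega> = (X t \<omega> $ i, Y t \<omega> $ i, X (Suc t) \<omega> $ i, Y (Suc t) \<omega> $ i, D t \<omega> $ i)" for \<omega>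
  define H where "H = (\<lambda>(b, z). ennreal (\<Psi> (\<lambda>k. b (Suc t, i, k)) (fst z) (fst (snd z)) (fst (snd (snd z)))
      (fst (snd (snd (snd z)))) (snd (snd (snd (snd z))))))"
  note past_meas = iterates_past(1,2)[of "Suc t"] iterates_past(4-6)[of t "Suc t", OF lessI]
  have Zm: "Z \<in> past (Suc t) \<rightarrow>\<^sub>M ?N"
    unfolding Z_def using past_meas by (intro measurable_Pair borel_measurable_row) auto
  have ind0: "indep_var (sample_space \<D> J) (samples \<xi> J)
       (sample_space \<D> {(s, j, k). s < Suc t \<and> k < S s}) (samples \<xi> {(s, j, k). s < Suc t \<and> k < S s})"
    unfolding J_def by (rule sample_indep_past)
  have rv: "samples \<xi> J \<in> M \<rightarrow>\<^sub>M sample_space \<D> J" using indep_var_rv1[OF ind0] .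
  note ind = indep_set_of_indep_var[OF ind0]
  have Bm: "samples \<xi> J \<in> vimage_algebra (space M) (samples \<xi> J) (sample_space \<D> J) \<rightarrow>\<^sub>M sample_space \<D> J"
    using measurable_space[OF rv] by (intro measurable_vimage_algebra1) auto
  have comp: "(\<lambda>p. fst p (Suc t, i, k)) \<in> sample_space \<D> J \<Otimes>\<^sub>M ?N \<rightarrow>\<^sub>M \<D> i" if "k < S (Suc t)" for k
  proof -
    have "(Suc t, i, k) \<in> J" using that by (simp add: J_def)
    from measurable_component_singleton[OF this, of "\<lambda>(t, i, k). \<D> i"]
    have [measurable]: "(\<lambda>b. b (Suc t, i, k)) \<in> sample_space \<D> J \<rightarrow>\<^sub>M \<D> i" by (simp add: sample_space_def)
    show ?thesis by measurable
  qed
  have pm[measurable]: "(\<lambda>p. fst (snd p)) \<in> borel_measurable (sample_space \<D> J \<Otimes>\<^sub>M ?N)"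
    "(\<lambda>p. fst (snd (snd p))) \<in> borel_measurable (sample_space \<D> J \<Otimes>\<^sub>M ?N)"
    "(\<lambda>p. fst (snd (snd (snd p)))) \<in> borel_measurable (sample_space \<D> J \<Otimes>\<^sub>M ?N)"
    "(\<lambda>p. fst (snd (snd (snd (snd p))))) \<in> borel_measurable (sample_space \<D> J \<Otimes>\<^sub>M ?N)"
    "(\<lambda>p. snd (snd (snd (snd (snd p))))) \<in> borel_measurable (sample_space \<D> J \<Otimes>\<^sub>M ?N)"
    by measurable
  have [measurable]: "(\<lambda>p. batch_grad (G i) (S (Suc t)) (\<lambda>k. fst p (Suc t, i, k)) (fst (snd (snd (snd p)))) (fst (snd (snd (snd (snd p)))))
      + (1 - \<beta>) *\<^sub>R (snd (snd (snd (snd (snd p))))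
        - batch_grad (G i) (S (Suc t)) (\<lambda>k. fst p (Suc t, i, k)) (fst (snd p)) (fst (snd (snd p))))
      - v (fst (snd (snd (snd p)))) (fst (snd (snd (snd (snd p))))) (snd (snd (snd (snd (snd p))))))
      \<in> borel_measurable (sample_space \<D> J \<Otimes>\<^sub>M ?N)"
    by (intro borel_measurable_diff borel_measurable_add borel_measurable_scaleR borel_measurable_const
        batch_grad_measurable v pm comp)
  have [measurable]: "H \<in> borel_measurable (sample_space \<D> J \<Otimes>\<^sub>M ?N)"
    unfolding H_def \<Psi> case_prod_beta by measurable
  have sJ: "samples \<xi> J \<omega> (Suc t, i, k) = \<xi> (Suc t) i k \<omega>" if "k < S (Suc t)" for \<omega> k
    using that by (simp add: samples_def J_def)
  have bg: "batch_grad (G i) (S (Suc t)) (\<lambda>k. samples \<xi> J \<omega> (Suc t, i, k)) x y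
      = batch_grad (G i) (S (Suc t)) (\<lambda>k. \<xi> (Suc t) i k \<omega>) x y" for \<omega> x y
    by (simp add: batch_grad_def sJ)
  have Hs: "H (samples \<xi> J \<omega>, z) = ennreal (\<Psi> (\<lambda>k. \<xi> (Suc t) i k \<omega>) (fst z) (fst (snd z)) (fst (snd (snd z)))
      (fst (snd (snd (snd z)))) (snd (snd (snd (snd z)))))" for \<omega> z
    by (simp add: H_def \<Psi> bg)
  have "(\<integral>\<^sup>+\<omega>. H (samples \<xi> J \<omega>, Z \<omega>) \<partial>M) = (\<integral>\<^sup>+\<omega>. (\<integral>\<^sup>+\<omega>'. H (samples \<xi> J \<omega>', Z \<omega>) \<partial>M) \<partial>M)"
    by (rule nn_integral_indep_set[OF ind _ _ Bm Zm[unfolded past_def]]) simp_all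
  also have "\<dots> \<le> (\<integral>\<^sup>+\<omega>. ennreal (B (X t \<omega> $ i) (Y t \<omega> $ i) (X (Suc t) \<omega> $ i) (Y (Suc t) \<omega> $ i) (D t \<omega> $ i)) \<partial>M)"
    unfolding Hs by (intro nn_integral_mono) (simp add: Z_def bound)
  finally show ?thesis unfolding Hs by (simp add: Z_def)
qed

end

section \<open>Expected decrease and the random iterate\<close>

context vrlm_random
begin

text \<open>The path quantities as random variables, spelled out because \<open>vrlm_path\<close> is
  interpreted separately for each realization.\<close>

definition "rs t \<omega> = (norm (D t \<omega> - grad_F f (X t \<omega>) (Y t \<omega>)))\<^sup>2"
definition "dz t \<omega> = (norm (X (Suc t) \<omega> - X t \<omega>))\<^sup>2 + (norm (Y (Suc t) \<omega> - Y t \<omega>))\<^sup>2"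
definition "ds t \<omega> = (norm (D (Suc t) \<omega> - D t \<omega>))\<^sup>2"
definition "xs t \<omega> = (norm (perp (X t \<omega>)))\<^sup>2"
definition "gm t \<omega> = (norm ((1 / \<eta>x) *\<^sub>R (row_avg (X t \<omega>)
    - prox (\<lambda>v. ereal \<eta>x * g v) (row_avg (X t \<omega>) - \<eta>x *\<^sub>R gP (row_avg (X t \<omega>)) (\<Lambda> t \<omega>)))))\<^sup>2"
definition "ps t \<omega> = (norm (gL (row_avg (X t \<omega>)) (\<Lambda> t \<omega>)))\<^sup>2"
definition "gn t \<omega> = real CARD('m) * (\<eta>x / 50 * (gm t \<omega> + L\<^sup>2 / real CARD('m) * xs t \<omega>) + \<eta>L / 2 * ps t \<omega>)"
definition "v0 \<omega> = (norm (perp (V 0 \<omega>)))\<^sup>2"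
text \<open>The deterministic part of \<open>psi0\<close>; its tracking term depends on the first
  batch.\<close>

definition "psiC = real CARD('m) * (PP x0 0 + gr x0 - phi_star)
   + wd * (H (const_rows x0) 0 (Ystar (const_rows x0) 0) - H (const_rows x0) 0 (const_rows y0))
   + wy * (norm (Ystar (const_rows x0) 0 - const_rows y0))\<^sup>2"

lemma nonneg: "0 \<le> rs t \<omega>" "0 \<le> dz t \<omega>" "0 \<le> ds t \<omega>" "0 \<le> xs t \<omega>" "0 \<le> gm t \<omega>" "0 \<le> ps t \<omega>" "0 \<le> v0 \<omega>" "0 \<le> gn t \<omega>"
proof -
  show "0 \<le> rs t \<omega>" "0 \<le> dz t \<omega>" "0 \<le> ds t \<omega>" "0 \<le> xs t \<omega>" "0 \<le> gm t \<omega>" "0 \<le> ps t \<omega>" "0 \<le> v0 \<omega>"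
    by (simp_all add: rs_def dz_def ds_def xs_def gm_def ps_def v0_def)
  then show "0 \<le> gn t \<omega>" unfolding gn_def using eta_pos by (intro mult_nonneg_nonneg add_nonneg_nonneg) auto
qed

lemma pathwise:
  assumes "\<omega> \<in> space M"
  shows "(\<Sum>t<n. gn t \<omega>) + 23 / 20 * (L * cU) * (\<Sum>t<n. dz t \<omega>)
    \<le> psiC + wv * v0 \<omega> + 7 * \<beta> * cU / (20 * L) * (\<Sum>t<n. rs t \<omega>) + cB / (40 * L) * (\<Sum>t<n. ds t \<omega>)" (is ?A)
   and "23 / 20 * (L * cU) * dz n \<omega>
    \<le> psiC + wv * v0 \<omega> + 7 * \<beta> * cU / (20 * L) * (\<Sum>t<Suc n. rs t \<omega>) + cB / (40 * L) * (\<Sum>t<n. ds t \<omega>)" (is ?B)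
proof -
  interpret P: vrlm_path W \<rho> f h \<mu> L y0 g phi_star \<beta> \<eta>x \<eta>y \<eta>L x0
    "\<lambda>t. X t \<omega>" "\<lambda>t. V t \<omega>" "\<lambda>t. \<Lambda> t \<omega>" "\<lambda>t. Y t \<omega>" "\<lambda>t. D t \<omega>"
    by (rule path[OF assms])
  have 1: "P.rsq t = rs t \<omega>" "P.dX t + P.dY t = dz t \<omega>" "P.dD t = ds t \<omega>" "P.gain t = gn t \<omega>" for t
    by (simp_all add: P.rsq_def P.R_def rs_def P.dX_def P.dY_def dz_def P.dD_def ds_def P.gain_def P.gmsq_def P.xsq_def
       P.psq_def P.xb_def gn_def gm_def xs_def ps_def)
  have 2: "P.psi0 = psiC + wv * v0 \<omega>"
    by (simp add: P.psi0_def psiC_def P.ph_def P.del_def P.ysq_def P.vsq_def P.Yt_def P.xb_def v0_def run_eqs(1-3)[OF assms])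
  show ?A ?B using P.pathwise_bound[of n] P.pathwise_bound_last[of n] unfolding 1 2 by simp_all
qed

lemma grad_F_measurable [measurable (raw)]:
  assumes [measurable]: "u \<in> borel_measurable A" "v \<in> borel_measurable A"
  shows "(\<lambda>\<omega>. grad_F f (u \<omega>) (v \<omega>)) \<in> borel_measurable A"
  by (rule borel_measurable_rows) (simp add: grad_F_def gf_def[symmetric])

lemma gP_measurable [measurable (raw)]:
  assumes [measurable]: "u \<in> borel_measurable A" "v \<in> borel_measurable A"
  shows "(\<lambda>\<omega>. gP (u \<omega>) (v \<omega>)) \<in> borel_measurable A"
  unfolding gP_def
proof (rule borel_measurable_row_avg, rule borel_measurable_rows)
  fix i
  have "(\<lambda>\<omega>. fst (gf i (u \<omega>) (Ystar (const_rows (u \<omega>)) (v \<omega>) $ i))) \<in> borel_measurable A"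
    by (rule borel_measurable_linear[of fst]) (auto intro!: linearI)
  then show "(\<lambda>\<omega>. (\<chi> i. fst (gf i (u \<omega>) (Ystar (const_rows (u \<omega>)) (v \<omega>) $ i))) $ i) \<in> borel_measurable A" by simp
qed

lemma gL_measurable [measurable (raw)]:
  assumes [measurable]: "u \<in> borel_measurable A" "v \<in> borel_measurable A"
  shows "(\<lambda>\<omega>. gL (u \<omega>) (v \<omega>)) \<in> borel_measurable A"
  unfolding gL_def by measurable

lemma stationarity_measurable:
  assumes [measurable]: "X t \<in> borel_measurable A" "\<Lambda> t \<in> borel_measurable A"
  shows "gm t \<in> borel_measurable A" "xs t \<in> borel_measurable A" "ps t \<in> borel_measurable A"
proof -
  note [measurable] = borel_measurable_prox[OF g_cc x0_dom eta_pos(1)]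
  show "gm t \<in> borel_measurable A" "xs t \<in> borel_measurable A" "ps t \<in> borel_measurable A"
    unfolding gm_def xs_def ps_def by measurable
qed

lemma measurable_M [measurable]:
  "rs t \<in> borel_measurable M" "dz t \<in> borel_measurable M" "ds t \<in> borel_measurable M" "gn t \<in> borel_measurable M"
  "v0 \<in> borel_measurable M" "gm t \<in> borel_measurable M" "xs t \<in> borel_measurable M" "ps t \<in> borel_measurable M"
proof -
  show g[measurable]: "gm t \<in> borel_measurable M" "xs t \<in> borel_measurable M" "ps t \<in> borel_measurable M"
    by (rule stationarity_measurable; measurable)+
  show "rs t \<in> borel_measurable M" "dz t \<in> borel_measurable M" "ds t \<in> borel_measurable M" "gn t \<in> borel_measurable M"
    "v0 \<in> borel_measurable M"
    unfolding rs_def dz_def ds_def gn_def v0_def by measurable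
qed

section \<open>Expected recursions and integrability\<close>

lemma integrable_of_nn_le:
  fixes F B :: "'w \<Rightarrow> real"
  assumes [measurable]: "F \<in> borel_measurable M" and F: "\<And>\<omega>. 0 \<le> F \<omega>" and B: "integrable M B" "\<And>\<omega>. 0 \<le> B \<omega>"
    and le: "(\<integral>\<^sup>+\<omega>. ennreal (F \<omega>) \<partial>M) \<le> (\<integral>\<^sup>+\<omega>. ennreal (B \<omega>) \<partial>M)"
  shows "integrable M F \<and> (\<integral>\<omega>. F \<omega> \<partial>M) \<le> (\<integral>\<omega>. B \<omega> \<partial>M)"
proof -
  have Bi: "(\<integral>\<^sup>+\<omega>. ennreal (B \<omega>) \<partial>M) = ennreal (\<integral>\<omega>. B \<omega> \<partial>M)" by (rule nn_integral_eq_integral[OF B(1)]) (simp add: B)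
  have 1: "integrable M F"
    using le F Bi by (intro integrableI_bounded) (auto simp: order_le_less_trans[OF _ ennreal_less_top])
  have "ennreal (\<integral>\<omega>. F \<omega> \<partial>M) \<le> ennreal (\<integral>\<omega>. B \<omega> \<partial>M)"
    using le Bi nn_integral_eq_integral[OF 1] F by simp
  then show ?thesis using 1 B by (simp add: integral_nonneg)
qed

lemma zdist_sum: "(\<Sum>i\<in>UNIV. zdist (X t \<omega> $ i) (Y t \<omega> $ i) (X (Suc t) \<omega> $ i) (Y (Suc t) \<omega> $ i)) = dz t \<omega>"
  unfolding dz_def norm_rows_sq[where 'm='m and 'a="real^'p"] norm_rows_sq[where 'm='m and 'a="real^'q"]
  by (simp add: zdist_def sum.distrib)

lemma rs_rows: "rs t \<omega> = (\<Sum>i\<in>UNIV. (norm (D t \<omega> $ i - gf i (X t \<omega> $ i) (Y t \<omega> $ i)))\<^sup>2)"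
  unfolding rs_def norm_rows_sq[where 'm='m and 'a="(real^'p) \<times> (real^'q)"] by (simp add: grad_F_def gf_def)

lemma nn_integral_rows_le:
  fixes F B :: "'m \<Rightarrow> 'w \<Rightarrow> real"
  assumes "\<And>i. F i \<in> borel_measurable M" "\<And>i. B i \<in> borel_measurable M" "\<And>i \<omega>. 0 \<le> F i \<omega>" "\<And>i \<omega>. 0 \<le> B i \<omega>"
    and "\<And>i. (\<integral>\<^sup>+\<omega>. ennreal (F i \<omega>) \<partial>M) \<le> (\<integral>\<^sup>+\<omega>. ennreal (B i \<omega>) \<partial>M)"
  shows "(\<integral>\<^sup>+\<omega>. ennreal (\<Sum>i\<in>UNIV. F i \<omega>) \<partial>M) \<le> (\<integral>\<^sup>+\<omega>. ennreal (\<Sum>i\<in>UNIV. B i \<omega>) \<partial>M)"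
proof -
  have "(\<integral>\<^sup>+\<omega>. ennreal (\<Sum>i\<in>UNIV. F i \<omega>) \<partial>M) = (\<Sum>i\<in>UNIV. (\<integral>\<^sup>+\<omega>. ennreal (F i \<omega>) \<partial>M))"
    by (subst nn_integral_sum[symmetric]) (simp_all add: assms sum_ennreal)
  also have "\<dots> \<le> (\<Sum>i\<in>UNIV. (\<integral>\<^sup>+\<omega>. ennreal (B i \<omega>) \<partial>M))" by (intro sum_mono assms(5))
  also have "\<dots> = (\<integral>\<^sup>+\<omega>. ennreal (\<Sum>i\<in>UNIV. B i \<omega>) \<partial>M)"
    by (subst nn_integral_sum[symmetric]) (simp_all add: assms sum_ennreal)
  finally show ?thesis .
qed

lemma row_measurable [measurable]:
  "(\<lambda>\<omega>. X t \<omega> $ i) \<in> borel_measurable M" "(\<lambda>\<omega>. Y t \<omega> $ i) \<in> borel_measurable M" "(\<lambda>\<omega>. D t \<omega> $ i) \<in> borel_measurable M"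
  by measurable

lemma zdist_measurable [measurable]:
  "(\<lambda>\<omega>. zdist (X t \<omega> $ i) (Y t \<omega> $ i) (X (Suc t) \<omega> $ i) (Y (Suc t) \<omega> $ i)) \<in> borel_measurable M"
  unfolding zdist_def by measurable

lemma row_error_measurable [measurable]:
  "(\<lambda>\<omega>. (norm (D t \<omega> $ i - gf i (X t \<omega> $ i) (Y t \<omega> $ i)))\<^sup>2) \<in> borel_measurable M"
  by (intro borel_measurable_power measurable_compose[OF _ borel_measurable_norm] borel_measurable_diff gf_measurable row_measurable)

lemma row_increment_measurable [measurable]:
  "(\<lambda>\<omega>. (norm (D (Suc t) \<omega> $ i - D t \<omega> $ i))\<^sup>2) \<in> borel_measurable M"
  by (intro borel_measurable_power measurable_compose[OF _ borel_measurable_norm] borel_measurable_diff row_measurable)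

lemma zdist_nonneg: "0 \<le> zdist x y x' y'" by (simp add: zdist_def)

text \<open>The squared norm is a sum over agents, so the one-agent bounds add up whatever the joint
  law of the batches within an iteration.\<close>

lemma rs_recursion:
  assumes int: "integrable M (rs t)" "integrable M (dz t)"
  shows "integrable M (rs (Suc t)) \<and> expectation (rs (Suc t))
     \<le> (1 - \<beta>) * expectation (rs t) + 2 * L\<^sup>2 * expectation (dz t) + 2 * \<beta>\<^sup>2 * (real CARD('m) * (\<sigma>\<^sup>2 / real (S (Suc t))))"
proof -
  let ?s = "\<sigma>\<^sup>2 / real (S (Suc t))"
  define B where "B \<omega> = (1 - \<beta>) * rs t \<omega> + 2 * L\<^sup>2 * dz t \<omega> + 2 * \<beta>\<^sup>2 * (real CARD('m) * ?s)" for \<omega>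
  have b: "0 \<le> 1 - \<beta>" using beta by simp
  have "(\<integral>\<^sup>+\<omega>. ennreal (rs (Suc t) \<omega>) \<partial>M)
    \<le> (\<integral>\<^sup>+\<omega>. ennreal (\<Sum>i\<in>UNIV. (1 - \<beta>) * (norm (D t \<omega> $ i - gf i (X t \<omega> $ i) (Y t \<omega> $ i)))\<^sup>2
        + 2 * L\<^sup>2 * zdist (X t \<omega> $ i) (Y t \<omega> $ i) (X (Suc t) \<omega> $ i) (Y (Suc t) \<omega> $ i) + 2 * \<beta>\<^sup>2 * \<sigma>\<^sup>2 / real (S (Suc t))) \<partial>M)"
    unfolding rs_rows
  proof (rule nn_integral_rows_le)
    fix i
    have "(\<integral>\<^sup>+\<omega>. ennreal ((norm (D (Suc t) \<omega> $ i - gf i (X (Suc t) \<omega> $ i) (Y (Suc t) \<omega> $ i)))\<^sup>2) \<partial>M)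
      = (\<integral>\<^sup>+\<omega>. ennreal ((norm (storm_est i (Suc t) (\<lambda>k. \<xi> (Suc t) i k \<omega>) (X t \<omega> $ i) (Y t \<omega> $ i)
        (X (Suc t) \<omega> $ i) (Y (Suc t) \<omega> $ i) (D t \<omega> $ i)
        - gf i (X (Suc t) \<omega> $ i) (Y (Suc t) \<omega> $ i)))\<^sup>2) \<partial>M)"
      by (rule nn_integral_cong) (simp only: run_eqs(6))
    also have "\<dots> \<le> (\<integral>\<^sup>+\<omega>. ennreal ((1 - \<beta>) * (norm (D t \<omega> $ i - gf i (X t \<omega> $ i) (Y t \<omega> $ i)))\<^sup>2
        + 2 * L\<^sup>2 * zdist (X t \<omega> $ i) (Y t \<omega> $ i) (X (Suc t) \<omega> $ i) (Y (Suc t) \<omega> $ i) + 2 * \<beta>\<^sup>2 * \<sigma>\<^sup>2 / real (S (Suc t))) \<partial>M)"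
      by (rule condition_on_past[where v="\<lambda>x y d. gf i x y" and i=i and t=t
          and B="\<lambda>x y x' y' d. (1 - \<beta>) * (norm (d - gf i x y))\<^sup>2 + 2 * L\<^sup>2 * zdist x y x' y' + 2 * \<beta>\<^sup>2 * \<sigma>\<^sup>2 / real (S (Suc t))",
          OF refl gf_measurable storm_error_fixed])
    finally show "(\<integral>\<^sup>+\<omega>. ennreal ((norm (D (Suc t) \<omega> $ i - gf i (X (Suc t) \<omega> $ i) (Y (Suc t) \<omega> $ i)))\<^sup>2) \<partial>M) \<le> \<dots>" .
  qed (intro zero_le_power2 borel_measurable_add borel_measurable_times borel_measurable_const row_error_measurable
      row_increment_measurable zdist_measurable add_nonneg_nonneg mult_nonneg_nonneg divide_nonneg_nonneg
      zdist_nonneg zero_le_numeral of_nat_0_le_iff b)+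
  also have "\<dots> = (\<integral>\<^sup>+\<omega>. ennreal (B \<omega>) \<partial>M)"
    by (simp add: sum.distrib sum_distrib_left[symmetric] zdist_sum rs_rows[symmetric] B_def ac_simps)
  finally have le: "(\<integral>\<^sup>+\<omega>. ennreal (rs (Suc t) \<omega>) \<partial>M) \<le> (\<integral>\<^sup>+\<omega>. ennreal (B \<omega>) \<partial>M)" .
  have Bi: "integrable M B" unfolding B_def using int by simp
  have B0: "0 \<le> B \<omega>" for \<omega> unfolding B_def using b nonneg by (intro add_nonneg_nonneg mult_nonneg_nonneg) auto
  have "(\<integral>\<omega>. B \<omega> \<partial>M) = (1 - \<beta>) * expectation (rs t) + 2 * L\<^sup>2 * expectation (dz t) + 2 * \<beta>\<^sup>2 * (real CARD('m) * ?s)"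
    unfolding B_def using int by (simp add: prob_space)
  then show ?thesis using integrable_of_nn_le[OF _ nonneg(1) Bi B0 le] by simp
qed

lemma ds_bound:
  assumes int: "integrable M (rs t)" "integrable M (dz t)"
  shows "integrable M (ds t) \<and> expectation (ds t)
     \<le> 3 * \<beta>\<^sup>2 * expectation (rs t) + 3 * L\<^sup>2 * expectation (dz t) + 3 * \<beta>\<^sup>2 * (real CARD('m) * (\<sigma>\<^sup>2 / real (S (Suc t))))"
proof -
  let ?s = "\<sigma>\<^sup>2 / real (S (Suc t))"
  define B where "B \<omega> = 3 * \<beta>\<^sup>2 * rs t \<omega> + 3 * L\<^sup>2 * dz t \<omega> + 3 * \<beta>\<^sup>2 * (real CARD('m) * ?s)" for \<omega>
  have "(\<integral>\<^sup>+\<omega>. ennreal (ds t \<omega>) \<partial>M)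
    \<le> (\<integral>\<^sup>+\<omega>. ennreal (\<Sum>i\<in>UNIV. 3 * \<beta>\<^sup>2 * (norm (D t \<omega> $ i - gf i (X t \<omega> $ i) (Y t \<omega> $ i)))\<^sup>2
        + 3 * L\<^sup>2 * zdist (X t \<omega> $ i) (Y t \<omega> $ i) (X (Suc t) \<omega> $ i) (Y (Suc t) \<omega> $ i) + 3 * \<beta>\<^sup>2 * \<sigma>\<^sup>2 / real (S (Suc t))) \<partial>M)"
    unfolding ds_def norm_rows_sq[where 'm='m and 'a="(real^'p) \<times> (real^'q)"] vector_minus_component
  proof (rule nn_integral_rows_le)
    fix i
    have "(\<integral>\<^sup>+\<omega>. ennreal ((norm (D (Suc t) \<omega> $ i - D t \<omega> $ i))\<^sup>2) \<partial>M)
      = (\<integral>\<^sup>+\<omega>. ennreal ((norm (storm_est i (Suc t) (\<lambda>k. \<xi> (Suc t) i k \<omega>) (X t \<omega> $ i) (Y t \<omega> $ i)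
        (X (Suc t) \<omega> $ i) (Y (Suc t) \<omega> $ i) (D t \<omega> $ i)
        - D t \<omega> $ i))\<^sup>2) \<partial>M)"
      by (rule nn_integral_cong) (simp only: run_eqs(6))
    also have "\<dots> \<le> (\<integral>\<^sup>+\<omega>. ennreal (3 * \<beta>\<^sup>2 * (norm (D t \<omega> $ i - gf i (X t \<omega> $ i) (Y t \<omega> $ i)))\<^sup>2
        + 3 * L\<^sup>2 * zdist (X t \<omega> $ i) (Y t \<omega> $ i) (X (Suc t) \<omega> $ i) (Y (Suc t) \<omega> $ i) + 3 * \<beta>\<^sup>2 * \<sigma>\<^sup>2 / real (S (Suc t))) \<partial>M)"
      by (rule condition_on_past[where v="\<lambda>x y d. d" and i=i and t=t
          and B="\<lambda>x y x' y' d. 3 * \<beta>\<^sup>2 * (norm (d - gf i x y))\<^sup>2 + 3 * L\<^sup>2 * zdist x y x' y' + 3 * \<beta>\<^sup>2 * \<sigma>\<^sup>2 / real (S (Suc t))",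
          OF refl _ storm_increment_fixed])
    finally show "(\<integral>\<^sup>+\<omega>. ennreal ((norm (D (Suc t) \<omega> $ i - D t \<omega> $ i))\<^sup>2) \<partial>M) \<le> \<dots>" .
  qed (intro zero_le_power2 borel_measurable_add borel_measurable_times borel_measurable_const row_error_measurable
      row_increment_measurable zdist_measurable add_nonneg_nonneg mult_nonneg_nonneg divide_nonneg_nonneg
      zdist_nonneg zero_le_numeral of_nat_0_le_iff)+
  also have "\<dots> = (\<integral>\<^sup>+\<omega>. ennreal (B \<omega>) \<partial>M)"
    by (simp add: sum.distrib sum_distrib_left[symmetric] zdist_sum rs_rows[symmetric] B_def ac_simps)
  finally have le: "(\<integral>\<^sup>+\<omega>. ennreal (ds t \<omega>) \<partial>M) \<le> (\<integral>\<^sup>+\<omega>. ennreal (B \<omega>) \<partial>M)" .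
  have Bi: "integrable M B" unfolding B_def using int by simp
  have B0: "0 \<le> B \<omega>" for \<omega> unfolding B_def using nonneg by (intro add_nonneg_nonneg mult_nonneg_nonneg) auto
  have "(\<integral>\<omega>. B \<omega> \<partial>M) = 3 * \<beta>\<^sup>2 * expectation (rs t) + 3 * L\<^sup>2 * expectation (dz t) + 3 * \<beta>\<^sup>2 * (real CARD('m) * ?s)"
    unfolding B_def using int by (simp add: prob_space)
  then show ?thesis using integrable_of_nn_le[OF _ nonneg(3) Bi B0 le] by simp
qed

lemma rs_0_integrable: "integrable M (rs 0)"
proof -
  have "(\<integral>\<^sup>+\<omega>. ennreal (rs 0 \<omega>) \<partial>M) \<le> (\<integral>\<^sup>+\<omega>. ennreal (\<Sum>i\<in>(UNIV::'m set). \<sigma>\<^sup>2 / real (S 0)) \<partial>M)"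
    unfolding rs_rows
  proof (rule nn_integral_rows_le)
    fix i
    show "(\<integral>\<^sup>+\<omega>. ennreal ((norm (D 0 \<omega> $ i - gf i (X 0 \<omega> $ i) (Y 0 \<omega> $ i)))\<^sup>2) \<partial>M) \<le> (\<integral>\<^sup>+\<omega>. ennreal (\<sigma>\<^sup>2 / real (S 0)) \<partial>M)"
      using initial_error_fixed[of i 0 x0 y0] by (simp add: run_eqs(1,2,4) emeasure_space_1 cong: nn_integral_cong)
  qed auto
  from integrable_of_nn_le[OF _ nonneg(1) _ _ this] show ?thesis by (simp add: sum_nonneg)
qed

text \<open>The initial estimate differs from a deterministic gradient by an error with finite
  second moment.\<close>

lemma v0_integrable: "integrable M v0"
proof (rule Bochner_Integration.integrable_bound)
  define c where "c = (norm (grad_F f (const_rows x0) (const_rows y0)))\<^sup>2"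
  show "integrable M (\<lambda>\<omega>. 2 * rs 0 \<omega> + 2 * c)" using rs_0_integrable by simp
  show "AE \<omega> in M. norm (v0 \<omega>) \<le> norm (2 * rs 0 \<omega> + 2 * c)"
  proof (rule AE_I2)
    fix \<omega> assume w: "\<omega> \<in> space M"
    have "norm (perp (V 0 \<omega>)) \<le> norm (D 0 \<omega>)"
      unfolding run_eqs(5)[OF w] by (rule order_trans[OF norm_perp_le norm_x_part_le])
    then have "v0 \<omega> \<le> (norm (D 0 \<omega>))\<^sup>2" unfolding v0_def by (rule power_mono) simp
    also have "\<dots> \<le> 2 * rs 0 \<omega> + 2 * c"
      using norm_add_sq_le[of "D 0 \<omega> - grad_F f (X 0 \<omega>) (Y 0 \<omega>)" "grad_F f (X 0 \<omega>) (Y 0 \<omega>)"]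
      by (simp add: rs_def c_def run_eqs(1,2)[OF w])
    finally show "norm (v0 \<omega>) \<le> norm (2 * rs 0 \<omega> + 2 * c)" using nonneg(7)[of \<omega>] by simp
  qed
qed measurable

text \<open>The order matters: \<open>dz n\<close> comes first, from the pathwise bound free of
  \<open>ds n\<close>; only then do the moment bounds give \<open>rs (Suc n)\<close> and
  \<open>ds n\<close>.\<close>

lemma integrable_all: "integrable M (rs n) \<and> (\<forall>t<n. integrable M (rs t) \<and> integrable M (dz t) \<and> integrable M (ds t))"
proof (induction n)
  case 0
  show ?case using rs_0_integrable by simp
next
  case (Suc n)
  have LU: "0 < 23 / 20 * (L * cU)" using L_pos cU_ge by simp
  have dz: "integrable M (dz n)"
  proof -
    define B where "B \<omega> = psiC + wv * v0 \<omega> + 7 * \<beta> * cU / (20 * L) * (\<Sum>t<Suc n. rs t \<omega>) + cB / (40 * L) * (\<Sum>t<n. ds t \<omega>)" for \<omega>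
    have "integrable M B" unfolding B_def
      by (intro Bochner_Integration.integrable_add integrable_mult_right Bochner_Integration.integrable_sum)
         (use Suc v0_integrable in \<open>auto simp: less_Suc_eq\<close>)
    then have "integrable M (\<lambda>\<omega>. 23 / 20 * (L * cU) * dz n \<omega>)"
    proof (rule Bochner_Integration.integrable_bound)
      have "\<bar>23 / 20 * (L * cU) * dz n \<omega>\<bar> \<le> \<bar>B \<omega>\<bar>" if "\<omega> \<in> space M" for \<omega>
      proof -
        have "0 \<le> 23 / 20 * (L * cU) * dz n \<omega>" by (rule mult_nonneg_nonneg[OF less_imp_le[OF LU] nonneg(2)])
        then show ?thesis using pathwise(2)[OF that, of n] unfolding B_def by linarith
      qed
      then show "AE \<omega> in M. norm (23 / 20 * (L * cU) * dz n \<omega>) \<le> norm (B \<omega>)" by (intro AE_I2) simp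
    qed measurable
    moreover have "(\<lambda>\<omega>. 1 / (23 / 20 * (L * cU)) * (23 / 20 * (L * cU) * dz n \<omega>)) = dz n"
    proof
      have "1 / c * (c * x) = x" if "0 < c" for c x :: real using that by simp
      from this[OF LU] show "1 / (23 / 20 * (L * cU)) * (23 / 20 * (L * cU) * dz n \<omega>) = dz n \<omega>" for \<omega> .
    qed
    ultimately show ?thesis
      using integrable_mult_right[of "1 / (23 / 20 * (L * cU))" M "\<lambda>\<omega>. 23 / 20 * (L * cU) * dz n \<omega>"]
      by (simp only: simp_thms)
  qed
  then show ?case using Suc rs_recursion[of n] ds_bound[of n] by (auto simp: less_Suc_eq)
qed

lemma integrable_iterates: "integrable M (rs t)" "integrable M (dz t)" "integrable M (ds t)"
  using integrable_all[of "Suc t"] by auto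

lemma gn_integrable: "integrable M (gn t)"
proof (rule Bochner_Integration.integrable_bound)
  define B where "B \<omega> = psiC + wv * v0 \<omega> + 7 * \<beta> * cU / (20 * L) * (\<Sum>t<Suc t. rs t \<omega>) + cB / (40 * L) * (\<Sum>t<Suc t. ds t \<omega>)" for \<omega>
  show "integrable M B" unfolding B_def
    by (intro Bochner_Integration.integrable_add integrable_mult_right Bochner_Integration.integrable_sum)
       (use v0_integrable integrable_iterates in auto)
  have "\<bar>gn t \<omega>\<bar> \<le> \<bar>B \<omega>\<bar>" if "\<omega> \<in> space M" for \<omega>
  proof -
    have "0 \<le> 23 / 20 * (L * cU) * (\<Sum>t<Suc t. dz t \<omega>)" "0 \<le> (\<Sum>t<t. gn t \<omega>)" "0 \<le> gn t \<omega>"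
      by (intro mult_nonneg_nonneg sum_nonneg nonneg; use L_pos cU_ge in simp)+
    then show ?thesis using pathwise(1)[OF that, of "Suc t"] unfolding B_def by simp
  qed
  then show "AE \<omega> in M. norm (gn t \<omega>) \<le> norm (B \<omega>)" by (intro AE_I2) simp
qed measurable

text \<open>Here the loop closes. The price \<open>7 / 20\<close> on the errors from the Lyapunov
  step and \<open>3 / 20\<close> from the increments make \<open>1 / 2\<close>, which the summed
  STORM recursion times \<open>cU / (2 * L)\<close> repays. That recursion costs
  \<open>L * cU\<close> of displacement and the increments cost \<open>3 / 20\<close> of it,
  together the \<open>23 / 20\<close> provided by the Lyapunov step.\<close>

lemma expected_gain_bound:
  "(\<Sum>t<n. expectation (gn t)) \<le> psiC + wv * expectation v0 + cU / (2 * L) * expectation (rs 0)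
     + (cU + 3 * cB / 40) / L * \<beta>\<^sup>2 * (real CARD('m) * (\<Sum>t<n. \<sigma>\<^sup>2 / real (S (Suc t))))"
proof -
  define r where "r t = expectation (rs t)" for t
  define z where "z t = expectation (dz t)" for t
  define d where "d t = expectation (ds t)" for t
  define u where "u t = real CARD('m) * (\<sigma>\<^sup>2 / real (S (Suc t)))" for t
  define Rn Zn Dn Qn where "Rn = (\<Sum>t<n. r t)" and "Zn = (\<Sum>t<n. z t)" and "Dn = (\<Sum>t<n. d t)" and "Qn = (\<Sum>t<n. u t)"
  note int = integrable_iterates v0_integrable gn_integrable
  have nn: "0 \<le> r t" "0 \<le> z t" for t
    unfolding r_def z_def by (simp_all add: integral_nonneg nonneg)
  have Rn0: "0 \<le> Rn" "0 \<le> Zn" "0 \<le> Qn" unfolding Rn_def Zn_def Qn_def using nn by (auto intro!: sum_nonneg simp: u_def)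
  have "(\<integral>\<omega>. (\<Sum>t<n. gn t \<omega>) + 23 / 20 * (L * cU) * (\<Sum>t<n. dz t \<omega>) \<partial>M)
    \<le> (\<integral>\<omega>. psiC + wv * v0 \<omega> + 7 * \<beta> * cU / (20 * L) * (\<Sum>t<n. rs t \<omega>) + cB / (40 * L) * (\<Sum>t<n. ds t \<omega>) \<partial>M)"
    by (intro integral_mono pathwise(1) Bochner_Integration.integrable_add integrable_mult_right Bochner_Integration.integrable_sum)
       (use int in auto)
  then have 1: "(\<Sum>t<n. expectation (gn t)) + 23 / 20 * (L * cU) * Zn
      \<le> psiC + wv * expectation v0 + 7 * \<beta> * cU / (20 * L) * Rn + cB / (40 * L) * Dn"
    using int by (simp add: prob_space r_def z_def d_def Rn_def Zn_def Dn_def)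
  have "Dn \<le> (\<Sum>t<n. 3 * \<beta>\<^sup>2 * r t + 3 * L\<^sup>2 * z t + 3 * \<beta>\<^sup>2 * u t)"
    unfolding Dn_def using ds_bound[OF int(1,2)] by (intro sum_mono) (simp add: d_def r_def z_def u_def)
  then have 2: "Dn \<le> 3 * \<beta>\<^sup>2 * Rn + 3 * L\<^sup>2 * Zn + 3 * \<beta>\<^sup>2 * Qn"
    by (simp add: sum.distrib sum_distrib_left[symmetric] Rn_def Zn_def Qn_def)
  \<comment> \<open>The last error is kept on the left to close the induction and dropped
    afterwards.\<close>
  have "\<beta> * (\<Sum>t<k. r t) + r k \<le> r 0 + 2 * L\<^sup>2 * (\<Sum>t<k. z t) + 2 * \<beta>\<^sup>2 * (\<Sum>t<k. u t)" for k
  proof (induction k)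
    case (Suc k)
    have "r (Suc k) \<le> (1 - \<beta>) * r k + 2 * L\<^sup>2 * z k + 2 * \<beta>\<^sup>2 * u k"
      using rs_recursion[OF int(1,2), of k] by (simp add: r_def z_def u_def)
    then show ?case using Suc by (simp add: algebra_simps)
  qed simp
  from this[of n] have 3: "\<beta> * Rn \<le> r 0 + 2 * L\<^sup>2 * Zn + 2 * \<beta>\<^sup>2 * Qn"
    using nn(1)[of n] by (simp add: Rn_def Zn_def Qn_def)
  have L: "0 < L" by (rule L_pos)
  have e3: "\<beta> * cU / (2 * L) * Rn \<le> cU / (2 * L) * r 0 + L * cU * Zn + cU / L * \<beta>\<^sup>2 * Qn"
    using mult_left_mono[OF 3, of "cU / (2 * L)"] L cU_ge by (simp add: power2_eq_square field_simps)
  have e2: "cB / (40 * L) * Dn \<le> 3 * \<beta> * cU / (20 * L) * Rn + 3 / 20 * (L * cU) * Zn + 3 * cB / 40 / L * \<beta>\<^sup>2 * Qn"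
  proof -
    have "cB / (40 * L) * Dn \<le> cB / (40 * L) * (3 * \<beta>\<^sup>2 * Rn + 3 * L\<^sup>2 * Zn + 3 * \<beta>\<^sup>2 * Qn)"
      using 2 L cB_pos by (intro mult_left_mono) auto
    also have "\<dots> = (cB * \<beta>\<^sup>2) * (3 / (40 * L) * Rn) + cB * (3 / 40 * L * Zn) + 3 * cB / 40 / L * \<beta>\<^sup>2 * Qn"
      using L by (simp add: power2_eq_square field_simps)
    \<comment> \<open>\<open>cB\<close> and \<open>\<beta>\<^sup>2\<close> are relaxed in the error
      and displacement terms only; the noise term must keep the square of
      \<open>\<beta>\<close>.\<close>
    also have "\<dots> \<le> (2 * cU * \<beta>) * (3 / (40 * L) * Rn) + 2 * cU * (3 / 40 * L * Zn) + 3 * cB / 40 / L * \<beta>\<^sup>2 * Qn"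
    proof (intro add_mono mult_right_mono order_refl[of "3 * cB / 40 / L * \<beta>\<^sup>2 * Qn"])
      have "\<beta>\<^sup>2 \<le> \<beta>" using beta by (simp add: power2_eq_square mult_left_le)
      then show "cB * \<beta>\<^sup>2 \<le> 2 * cU * \<beta>" using cU_ge cB_pos beta by (intro mult_mono) auto
    qed (use cU_ge L Rn0 in auto)
    also have "\<dots> = 3 * \<beta> * cU / (20 * L) * Rn + 3 / 20 * (L * cU) * Zn + 3 * cB / 40 / L * \<beta>\<^sup>2 * Qn"
      using L by (simp add: field_simps)
    finally show ?thesis .
  qed
  have e1: "\<beta> * cU / (2 * L) * Rn = 7 * \<beta> * cU / (20 * L) * Rn + 3 * \<beta> * cU / (20 * L) * Rn"
    using L by (simp add: field_simps)
  have "(\<Sum>t<n. expectation (gn t)) \<le> psiC + wv * expectation v0 + cU / (2 * L) * r 0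
      + (cU / L * \<beta>\<^sup>2 * Qn + 3 * cB / 40 / L * \<beta>\<^sup>2 * Qn)"
    using 1 e1 e2 e3 by (simp add: algebra_simps)
  also have "cU / L * \<beta>\<^sup>2 * Qn + 3 * cB / 40 / L * \<beta>\<^sup>2 * Qn = (cU + 3 * cB / 40) / L * \<beta>\<^sup>2 * Qn"
    by (simp add: add_divide_distrib algebra_simps)
  finally show ?thesis by (simp add: r_def Qn_def u_def sum_distrib_left)
qed

text \<open>The random index is independent of the sigma-algebra generated by all samples, so the
  iterates have to be measurable for that one and not just for \<open>M\<close>.\<close>

lemma full_measurable:
  defines "J \<equiv> {(s, j, k). k < S s}"
  shows "X t \<in> borel_measurable (vimage_algebra (space M) (samples \<xi> J) (sample_space \<D> J))"
    "\<Lambda> t \<in> borel_measurable (vimage_algebra (space M) (samples \<xi> J) (sample_space \<D> J))"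
proof -
  have rv: "samples \<xi> J \<in> M \<rightarrow>\<^sub>M sample_space \<D> J"
    unfolding samples_def sample_space_def
    by (rule measurable_restrict) (use sample_distr in \<open>auto simp: J_def\<close>)
  have "\<xi> s i k \<in> vimage_algebra (space M) (samples \<xi> J) (sample_space \<D> J) \<rightarrow>\<^sub>M \<D> i" if "k < S s" for s i k
    by (rule samples_measurable_vimage[OF _ rv]) (use that in \<open>simp add: J_def\<close>)
  then show "X t \<in> borel_measurable (vimage_algebra (space M) (samples \<xi> J) (sample_space \<D> J))"
    "\<Lambda> t \<in> borel_measurable (vimage_algebra (space M) (samples \<xi> J) (sample_space \<D> J))"
    using iterates_measurable[of "vimage_algebra (space M) (samples \<xi> J) (sample_space \<D> J)" t] by auto
qed

end

text \<open>Split by the value of the index; independence factors each indicator from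
  \<open>F t\<close>, and every value below \<open>T\<close> has probability
  \<open>1 / T\<close>.\<close>

lemma (in prob_space) nn_integral_random_index:
  fixes F :: "nat \<Rightarrow> 'a \<Rightarrow> real"
  assumes T: "T \<ge> (1::nat)" and d: "distr M (count_space UNIV) \<tau> = measure_pmf (pmf_of_set {0..<T})"
    and ind: "indep_set (sets (vimage_algebra (space M) \<tau> (count_space UNIV))) (sets B)" and sp: "space B = space M"
    and F: "\<And>t. F t \<in> borel_measurable B"
  shows "(\<integral>\<^sup>+\<omega>. ennreal (F (\<tau> \<omega>) \<omega>) \<partial>M) = (\<Sum>t<T. ennreal (1 / real T) * (\<integral>\<^sup>+\<omega>. ennreal (F t \<omega>) \<partial>M))"
proof -
  let ?A = "vimage_algebra (space M) \<tau> (count_space UNIV)"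
  have ev: "sets ?A \<subseteq> events" "sets B \<subseteq> events" using ind by (auto simp: indep_sets2_eq)
  have tA: "\<tau> \<in> ?A \<rightarrow>\<^sub>M count_space UNIV" by (rule measurable_vimage_algebra1) simp
  \<comment> \<open>Independence already places the sigma-algebra of the index inside the events,
    which gives its measurability.\<close>
  have tm[measurable]: "\<tau> \<in> M \<rightarrow>\<^sub>M count_space UNIV"
  proof (rule measurableI)
    fix C show "\<tau> -` C \<inter> space M \<in> events" using measurable_sets[OF tA, of C] ev by auto
  qed simp
  have Fm[measurable]: "F t \<in> borel_measurable M" for t
  proof (rule measurableI)
    fix C :: "real set" assume "C \<in> sets borel"
    then show "F t -` C \<inter> space M \<in> events" using measurable_sets[OF F, of C t] ev sp by auto
  qed simp
  have Fe: "(\<lambda>\<omega>. ennreal (F t \<omega>)) \<in> borel_measurable M" for t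
    by (rule measurable_compose[OF Fm measurable_ennreal])
  have ind_m: "(\<lambda>\<omega>. indicator {t} (\<tau> \<omega>) :: ennreal) \<in> borel_measurable M" for t
    by (rule measurable_compose[OF tm]) simp
  have tset: "\<tau> -` {t} \<inter> space M \<in> events" for t using measurable_sets[OF tm, of "{t}"] by simp
  have P: "emeasure M (\<tau> -` {t} \<inter> space M) = ennreal (1 / real T)" if "t < T" for t
  proof -
    have "emeasure M (\<tau> -` {t} \<inter> space M) = emeasure (distr M (count_space UNIV) \<tau>) {t}"
      by (subst emeasure_distr) auto
    also have "\<dots> = ennreal (1 / real T)"
      unfolding d using that T by (simp add: emeasure_pmf_single)
    finally show ?thesis .
  qed
  have lt: "AE \<omega> in M. \<tau> \<omega> < T"
  proof -
    have "AE t in distr M (count_space UNIV) \<tau>. t < T"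
      unfolding d using T by (intro AE_pmfI) auto
    then show ?thesis by (subst (asm) AE_distr_iff) auto
  qed
  have "(\<integral>\<^sup>+\<omega>. ennreal (F (\<tau> \<omega>) \<omega>) \<partial>M) = (\<integral>\<^sup>+\<omega>. (\<Sum>t<T. indicator {t} (\<tau> \<omega>) * ennreal (F t \<omega>)) \<partial>M)"
  proof (rule nn_integral_cong_AE, use lt in eventually_elim)
    fix \<omega> assume "\<tau> \<omega> < T"
    then have "(\<Sum>t<T. indicator {t} (\<tau> \<omega>) * ennreal (F t \<omega>)) = (\<Sum>t\<in>{\<tau> \<omega>}. indicator {t} (\<tau> \<omega>) * ennreal (F t \<omega>))"
      by (intro sum.mono_neutral_right) auto
    then show "ennreal (F (\<tau> \<omega>) \<omega>) = (\<Sum>t<T. indicator {t} (\<tau> \<omega>) * ennreal (F t \<omega>))" by simp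
  qed
  also have "\<dots> = (\<Sum>t<T. (\<integral>\<^sup>+\<omega>. indicator {t} (\<tau> \<omega>) * ennreal (F t \<omega>) \<partial>M))"
    by (rule nn_integral_sum) (intro borel_measurable_times_ennreal ind_m Fe)
  also have "\<dots> = (\<Sum>t<T. ennreal (1 / real T) * (\<integral>\<^sup>+\<omega>. ennreal (F t \<omega>) \<partial>M))"
  proof (rule sum.cong[OF refl])
    fix t assume t: "t \<in> {..<T}"
    have "(\<integral>\<^sup>+\<omega>. indicator {t} (\<tau> \<omega>) * ennreal (F t \<omega>) \<partial>M)
        = (\<integral>\<^sup>+\<omega>. (\<integral>\<^sup>+\<omega>'. indicator {t} (\<tau> \<omega>') * ennreal (F t \<omega>) \<partial>M) \<partial>M)"
    proof -
      have "(\<lambda>p. indicator {t} (fst p) * ennreal (snd p)) \<in> borel_measurable (count_space UNIV \<Otimes>\<^sub>M borel)"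
        by (intro borel_measurable_times_ennreal measurable_compose[OF measurable_fst] measurable_compose[OF measurable_snd]) auto
      from nn_integral_indep_set[OF ind _ sp tA F[of t] this] show ?thesis by simp
    qed
    also have "\<dots> = (\<integral>\<^sup>+\<omega>. ennreal (1 / real T) * ennreal (F t \<omega>) \<partial>M)"
    proof (rule nn_integral_cong)
      fix \<omega>
      have "(\<integral>\<^sup>+\<omega>'. indicator {t} (\<tau> \<omega>') * ennreal (F t \<omega>) \<partial>M) = (\<integral>\<^sup>+\<omega>'. indicator (\<tau> -` {t} \<inter> space M) \<omega>' \<partial>M) * ennreal (F t \<omega>)"
        by (subst nn_integral_multc[symmetric, OF borel_measurable_indicator[OF tset]])
           (auto intro!: nn_integral_cong split: split_indicator)
      then show "(\<integral>\<^sup>+\<omega>'. indicator {t} (\<tau> \<omega>') * ennreal (F t \<omega>) \<partial>M) = ennreal (1 / real T) * ennreal (F t \<omega>)"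
        using P[of t] t by simp
    qed
    also have "\<dots> = ennreal (1 / real T) * (\<integral>\<^sup>+\<omega>. ennreal (F t \<omega>) \<partial>M)" by (rule nn_integral_cmult[OF Fe])
    finally show "(\<integral>\<^sup>+\<omega>. indicator {t} (\<tau> \<omega>) * ennreal (F t \<omega>) \<partial>M) = ennreal (1 / real T) * (\<integral>\<^sup>+\<omega>. ennreal (F t \<omega>) \<partial>M)" .
  qed
  finally show ?thesis .
qed

section \<open>The bound at the random iterate\<close>

context vrlm_random
begin

lemma stationarity_integrable: "integrable M (gm t)" "integrable M (xs t)" "integrable M (ps t)"
proof -
  have pos: "0 < real CARD('m) * \<eta>x / 50" "0 < \<eta>x * L\<^sup>2 / 50" "0 < real CARD('m) * \<eta>L / 2"
    using eta_pos L_pos by simp_all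
  have g: "gn t \<omega> = real CARD('m) * \<eta>x / 50 * gm t \<omega> + \<eta>x * L\<^sup>2 / 50 * xs t \<omega> + real CARD('m) * \<eta>L / 2 * ps t \<omega>" for \<omega>
    by (simp add: gn_def algebra_simps)
  have *: "integrable M F" if F: "F \<in> borel_measurable M" "\<And>\<omega>. 0 \<le> F \<omega>" and c: "0 < c" and le: "\<And>\<omega>. c * F \<omega> \<le> gn t \<omega>" for F c
  proof (rule Bochner_Integration.integrable_bound)
    show "integrable M (\<lambda>\<omega>. 1 / c * gn t \<omega>)" using gn_integrable by simp
    have "F \<omega> \<le> 1 / c * gn t \<omega>" for \<omega> using le[of \<omega>] c by (simp add: field_simps)
    then show "AE \<omega> in M. norm (F \<omega>) \<le> norm (1 / c * gn t \<omega>)"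
      using F(2) by (intro AE_I2) (smt (verit) real_norm_def)
  qed (rule F)
  have nn: "0 \<le> real CARD('m) * \<eta>x / 50 * gm t \<omega>" "0 \<le> \<eta>x * L\<^sup>2 / 50 * xs t \<omega>" "0 \<le> real CARD('m) * \<eta>L / 2 * ps t \<omega>" for \<omega>
    by (intro mult_nonneg_nonneg nonneg less_imp_le[OF pos(1)] less_imp_le[OF pos(2)] less_imp_le[OF pos(3)])+
  show "integrable M (gm t)"
    by (rule *[OF _ nonneg(5) pos(1)]) (measurable, insert nn g, smt (verit))
  show "integrable M (xs t)"
    by (rule *[OF _ nonneg(4) pos(2)]) (measurable, insert nn g, smt (verit))
  show "integrable M (ps t)"
    by (rule *[OF _ nonneg(6) pos(3)]) (measurable, insert nn g, smt (verit))
qed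

text \<open>Both parts of the averaged gain are nonnegative, so each is bounded by dropping the
  other. The sign of \<open>E\<close> follows as well; it is needed to enlarge the factors
  multiplying \<open>E\<close> at the end.\<close>

lemma random_iterate_bound:
  assumes T: "T \<ge> 1" and d: "distr M (count_space UNIV) \<tau> = measure_pmf (pmf_of_set {0..<T})"
    and ind: "indep_set (sets (vimage_algebra (space M) \<tau> (count_space UNIV)))
         (sets (vimage_algebra (space M) (samples \<xi> {(s, j, k). k < S s}) (sample_space \<D> {(s, j, k). k < S s})))"
    and bd: "(\<Sum>t<T. expectation (gn t)) \<le> real CARD('m) * (real T * E)"
  shows "(\<integral>\<^sup>+\<omega>. ennreal (gm (\<tau> \<omega>) \<omega>) \<partial>M) + ennreal (L\<^sup>2 / real CARD('m)) * (\<integral>\<^sup>+\<omega>. ennreal (xs (\<tau> \<omega>) \<omega>) \<partial>M)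
      \<le> ennreal (E * (50 / \<eta>x))"
    and "(\<integral>\<^sup>+\<omega>. ennreal (ps (\<tau> \<omega>) \<omega>) \<partial>M) \<le> ennreal (E * (2 / \<eta>L))"
    and "0 \<le> E"
proof -
  let ?m = "real CARD('m)" and ?T = "real T"
  define a where "a = (\<Sum>t<T. expectation (gm t))"
  define b where "b = (\<Sum>t<T. expectation (xs t))"
  define c where "c = (\<Sum>t<T. expectation (ps t))"
  have nn: "0 \<le> a" "0 \<le> b" "0 \<le> c"
    unfolding a_def b_def c_def by (simp_all add: sum_nonneg integral_nonneg nonneg)
  have T0: "0 < ?T" using T by simp
  have red: "(\<integral>\<^sup>+\<omega>. ennreal (F (\<tau> \<omega>) \<omega>) \<partial>M) = ennreal ((\<Sum>t<T. \<integral>\<omega>. F t \<omega> \<partial>M) / ?T)"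
    if F: "\<And>t. F t \<in> borel_measurable (vimage_algebra (space M) (samples \<xi> {(s, j, k). k < S s}) (sample_space \<D> {(s, j, k). k < S s}))"
      and i: "\<And>t. integrable M (F t)" and p: "\<And>t \<omega>. 0 \<le> F t \<omega>" for F :: "nat \<Rightarrow> 'w \<Rightarrow> real"
  proof -
    have "(\<integral>\<^sup>+\<omega>. ennreal (F (\<tau> \<omega>) \<omega>) \<partial>M) = (\<Sum>t<T. ennreal (1 / ?T) * (\<integral>\<^sup>+\<omega>. ennreal (F t \<omega>) \<partial>M))"
      by (rule nn_integral_random_index[OF T d ind _ F]) simp
    also have "\<dots> = (\<Sum>t<T. ennreal (1 / ?T * (\<integral>\<omega>. F t \<omega> \<partial>M)))"
    proof (intro sum.cong refl)
      fix t
      have "(\<integral>\<^sup>+\<omega>. ennreal (F t \<omega>) \<partial>M) = ennreal (\<integral>\<omega>. F t \<omega> \<partial>M)"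
        by (rule nn_integral_eq_integral[OF i]) (simp add: p)
      then show "ennreal (1 / ?T) * (\<integral>\<^sup>+\<omega>. ennreal (F t \<omega>) \<partial>M) = ennreal (1 / ?T * (\<integral>\<omega>. F t \<omega> \<partial>M))"
        by (subst ennreal_mult') simp_all
    qed
    also have "\<dots> = ennreal (\<Sum>t<T. 1 / ?T * (\<integral>\<omega>. F t \<omega> \<partial>M))"
      by (rule sum_ennreal) (simp add: p integral_nonneg)
    finally show ?thesis by (simp add: sum_divide_distrib)
  qed
  note st = stationarity_measurable[OF full_measurable]
  have ga: "(\<integral>\<^sup>+\<omega>. ennreal (gm (\<tau> \<omega>) \<omega>) \<partial>M) = ennreal (a / ?T)"
    unfolding a_def by (rule red[OF st(1) stationarity_integrable(1) nonneg(5)])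
  have gb: "(\<integral>\<^sup>+\<omega>. ennreal (xs (\<tau> \<omega>) \<omega>) \<partial>M) = ennreal (b / ?T)"
    unfolding b_def by (rule red[OF st(2) stationarity_integrable(2) nonneg(4)])
  have gc: "(\<integral>\<^sup>+\<omega>. ennreal (ps (\<tau> \<omega>) \<omega>) \<partial>M) = ennreal (c / ?T)"
    unfolding c_def by (rule red[OF st(3) stationarity_integrable(3) nonneg(6)])
  have "expectation (gn t) = ?m * (\<eta>x / 50 * (expectation (gm t) + L\<^sup>2 / ?m * expectation (xs t)) + \<eta>L / 2 * expectation (ps t))" for t
    unfolding gn_def using stationarity_integrable by simp
  then have "(\<Sum>t<T. expectation (gn t)) = ?m * (\<eta>x / 50 * (a + L\<^sup>2 / ?m * b) + \<eta>L / 2 * c)"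
    by (simp only: sum_distrib_left[symmetric] sum.distrib a_def b_def c_def)
  then have "?m * (\<eta>x / 50 * (a + L\<^sup>2 / ?m * b) + \<eta>L / 2 * c) \<le> ?m * (?T * E)" using bd by simp
  then have main: "\<eta>x / 50 * (a + L\<^sup>2 / ?m * b) + \<eta>L / 2 * c \<le> ?T * E"
    by (simp only: mult_le_cancel_left_pos[OF mm_pos])
  have n1: "0 \<le> \<eta>x / 50 * (a + L\<^sup>2 / ?m * b)" "0 \<le> \<eta>L / 2 * c" using nn eta_pos by auto
  have "0 \<le> ?T * E" using main n1 by linarith
  then show "0 \<le> E" using T0 by (simp add: zero_le_mult_iff)
  have "\<eta>x / 50 * (a + L\<^sup>2 / ?m * b) \<le> ?T * E" "\<eta>L / 2 * c \<le> ?T * E" using main n1 by linarith+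
  then have i1: "a / ?T + L\<^sup>2 / ?m * (b / ?T) \<le> E * (50 / \<eta>x)" and i2: "c / ?T \<le> E * (2 / \<eta>L)"
    using T0 eta_pos by (simp_all add: field_simps)
  have "ennreal (a / ?T) + ennreal (L\<^sup>2 / ?m) * ennreal (b / ?T) = ennreal (a / ?T + L\<^sup>2 / ?m * (b / ?T))"
    using nn T0 by (simp add: ennreal_mult[symmetric] ennreal_plus[symmetric] del: ennreal_plus)
  then show "(\<integral>\<^sup>+\<omega>. ennreal (gm (\<tau> \<omega>) \<omega>) \<partial>M) + ennreal (L\<^sup>2 / ?m) * (\<integral>\<^sup>+\<omega>. ennreal (xs (\<tau> \<omega>) \<omega>) \<partial>M)
      \<le> ennreal (E * (50 / \<eta>x))"
    unfolding ga gb using i1 by (simp add: ennreal_leI)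
  show "(\<integral>\<^sup>+\<omega>. ennreal (ps (\<tau> \<omega>) \<omega>) \<partial>M) \<le> ennreal (E * (2 / \<eta>L))"
    unfolding gc using i2 by (rule ennreal_leI)
qed

section \<open>Comparison with the constants of the claim\<close>

lemma sqrt2_bounds: "11 / 8 \<le> sqrt 2" "0 < sqrt 2"
proof -
  show "11 / 8 \<le> sqrt 2" by (rule real_le_rsqrt) (simp add: power2_eq_square)
qed simp

text \<open>The coefficients of the tracking error \<open>a\<close> and the gradient error
  \<open>b\<close> agree exactly with those of the claim, up to \<open>m\<close>. The distance
  \<open>y\<close>, the gap \<open>dl\<close> and the noise \<open>Q\<close> are where the weights
  fit with an inequality.\<close>

lemma initial_budget:
  fixes a b y dl Q :: real
  assumes nn: "0 \<le> y" "0 \<le> dl" "0 \<le> Q"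
  shows "wd * dl + wy * y + wv * a + cU / (2 * L) * b + (cU + 3 * cB / 40) / L * \<beta>\<^sup>2 * (real CARD('m) * Q)
    \<le> real CARD('m) * (1 / (40 * real CARD('m) * (1 - \<rho>) * \<kappa> * L) * a
        + ((1 + 1 / L) / (2 * sqrt \<beta> * real CARD('m) * L) + 1 / (4 * real CARD('m) * \<kappa> * L * (1 - \<rho>)\<^sup>2)) * b
        + ((L + 1) / (5 * real CARD('m) * \<kappa>) + sqrt \<beta> * L / (10 * real CARD('m) * \<kappa>\<^sup>2 * (1 - \<rho>)\<^sup>2)) * y
        + sqrt \<beta> / sqrt 2 * (1 / ((1 - \<rho>)\<^sup>2 * \<kappa>) + (1 + 1 / L) / sqrt \<beta>) * (dl / real CARD('m))
        + (1 / ((1 - \<rho>)\<^sup>2 * \<kappa> * L) + (1 + 1 / L) / (sqrt \<beta> * L)) * \<beta>\<^sup>2 * Q)"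
proof -
  let ?m = "real CARD('m)"
  define r where "r = 1 - \<rho>"
  have r: "0 < r" using rho_less by (simp add: r_def)
  have k: "0 < \<kappa>" using kappa_ge1 by linarith
  note L = L_pos and s = sb(1)
  have vs_eq: "vs = sqrt \<beta> / (4 * sqrt 2)" unfolding vs_def unfolding eta_y using L by simp
  have B: "cB = 1 / (\<kappa> * r\<^sup>2)" by (simp add: cB_def r_def)
  have e1: "?m * (1 / (40 * ?m * r * \<kappa> * L) * a) = wv * a"
    using r k L by (simp add: wv_def r_def[symmetric] B power2_eq_square)
  have e2: "?m * (((1 + 1 / L) / (2 * sqrt \<beta> * ?m * L) + 1 / (4 * ?m * \<kappa> * L * r\<^sup>2)) * b) = cU / (2 * L) * b"
  proof -
    have "?m * ((1 + 1 / L) / (2 * sqrt \<beta> * ?m * L)) = cA / (2 * L)" by (simp add: cA_def)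
    moreover have "?m * (1 / (4 * ?m * \<kappa> * L * r\<^sup>2)) = cB / (4 * L)" by (simp add: B)
    moreover have "cA / (2 * L) + cB / (4 * L) = cU / (2 * L)" using L by (simp add: cU_def field_simps)
    ultimately show ?thesis by (simp only: mult.assoc[symmetric] distrib_left)
  qed
  have e3: "wy * y \<le> ?m * (((L + 1) / (5 * ?m * \<kappa>) + sqrt \<beta> * L / (10 * ?m * \<kappa>\<^sup>2 * r\<^sup>2)) * y)"
  proof -
    have "x * (c / (5 * x * \<kappa>)) = c / (5 * \<kappa>)" if "0 < x" for c x :: real using that by simp
    from this[OF mm_pos, of "L + 1"] have "?m * ((L + 1) / (5 * ?m * \<kappa>)) = sqrt \<beta> * L * cA / (5 * \<kappa>)"
      using L_cA s by (simp add: mult.assoc)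
    moreover have "?m * (sqrt \<beta> * L / (10 * ?m * \<kappa>\<^sup>2 * r\<^sup>2)) = sqrt \<beta> * L * cB / (10 * \<kappa>)"
      by (simp add: B power2_eq_square)
    moreover have "sqrt \<beta> * L * cA / (5 * \<kappa>) + sqrt \<beta> * L * cB / (10 * \<kappa>) = (sqrt \<beta> / 5) * (L * cU / \<kappa>)"
      using k by (simp add: cU_def field_simps)
    ultimately have c: "?m * ((L + 1) / (5 * ?m * \<kappa>) + sqrt \<beta> * L / (10 * ?m * \<kappa>\<^sup>2 * r\<^sup>2)) = (sqrt \<beta> / 5) * (L * cU / \<kappa>)"
      by (simp only: distrib_left)
    \<comment> \<open>The factor \<open>11 / 10\<close> in \<open>wy\<close> fits below the
      coefficient \<open>1 / 5\<close> precisely because \<open>sqrt 2\<close> is at least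
      \<open>11 / 8\<close>.\<close>
    have "sqrt \<beta> * (11 / 8) \<le> sqrt \<beta> * sqrt 2" using sqrt2_bounds s by (intro mult_left_mono) auto
    then have "11 / 10 * vs \<le> sqrt \<beta> / 5" using sqrt2_bounds by (simp add: vs_eq field_simps)
    then have "(11 / 10 * vs) * (L * cU / \<kappa>) \<le> (sqrt \<beta> / 5) * (L * cU / \<kappa>)"
      using L k cU_ge by (intro mult_right_mono) auto
    then have "wy \<le> (sqrt \<beta> / 5) * (L * cU / \<kappa>)" by (simp add: wy_def)
    then have "wy * y \<le> (?m * ((L + 1) / (5 * ?m * \<kappa>) + sqrt \<beta> * L / (10 * ?m * \<kappa>\<^sup>2 * r\<^sup>2))) * y"
      unfolding c by (rule mult_right_mono) (rule nn)
    then show ?thesis by (simp only: mult.assoc)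
  qed
  have e4: "wd * dl \<le> ?m * (sqrt \<beta> / sqrt 2 * (1 / (r\<^sup>2 * \<kappa>) + (1 + 1 / L) / sqrt \<beta>) * (dl / ?m))"
  proof -
    \<comment> \<open>\<open>3 * vs\<close> is \<open>3 / 4\<close> of
      \<open>sqrt \<beta> / sqrt 2\<close>, and \<open>cU\<close> is at most
      \<open>cA + cB\<close>.\<close>
    have "wd = 3 / 4 * (sqrt \<beta> / sqrt 2 * cU)" by (simp add: wd_def vs_eq)
    also have "\<dots> \<le> 1 * (sqrt \<beta> / sqrt 2 * (cB + cA))"
      using s cA_ge cB_pos sqrt2_bounds by (intro mult_mono mult_left_mono) (auto simp: cU_def)
    finally have "wd * dl \<le> (sqrt \<beta> / sqrt 2 * (cB + cA)) * dl" using nn by (intro mult_right_mono) auto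
    also have "\<dots> = ?m * (sqrt \<beta> / sqrt 2 * (cB + cA) * (dl / ?m))" by simp
    also have "cB = 1 / (r\<^sup>2 * \<kappa>)" by (simp add: B mult.commute)
    finally show ?thesis by (simp add: cA_def)
  qed
  have e5: "(cU + 3 * cB / 40) / L * \<beta>\<^sup>2 * (?m * Q)
     \<le> ?m * ((1 / (r\<^sup>2 * \<kappa> * L) + (1 + 1 / L) / (sqrt \<beta> * L)) * \<beta>\<^sup>2 * Q)"
  proof -
    \<comment> \<open>\<open>cU\<close> contains only half of \<open>cB\<close>, which leaves room
      for \<open>3 / 40\<close>.\<close>
    have "(cU + 3 * cB / 40) / L \<le> (cB + cA) / L"
      using L cB_pos by (intro divide_right_mono) (auto simp: cU_def)
    then have l: "(cU + 3 * cB / 40) / L * (\<beta>\<^sup>2 * (?m * Q)) \<le> (cB + cA) / L * (\<beta>\<^sup>2 * (?m * Q))"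
      using nn by (intro mult_right_mono) auto
    have q: "(cB + cA) / L = 1 / (r\<^sup>2 * \<kappa> * L) + (1 + 1 / L) / (sqrt \<beta> * L)"
      by (simp add: B cA_def add_divide_distrib mult.commute)
    from l[unfolded q] show ?thesis by (simp only: ac_simps)
  qed
  show ?thesis unfolding r_def[symmetric] distrib_left[of ?m] e1 e2 using e3 e4 e5 by linarith
qed

end

theorem theorem3p4:
  fixes \<D> :: "'m::finite \<Rightarrow> 's measure"
    and ft :: "'m \<Rightarrow> real^'p::finite \<Rightarrow> real^'q::finite \<Rightarrow> 's \<Rightarrow> real"
    and f :: "'m \<Rightarrow> real^'p \<Rightarrow> real^'q \<Rightarrow> real"
    and G :: "'m \<Rightarrow> real^'p \<Rightarrow> real^'q \<Rightarrow> 's \<Rightarrow> (real^'p) \<times> (real^'q)"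
    and g :: "real^'p \<Rightarrow> ereal"
    and h :: "real^'q \<Rightarrow> ereal"
    and W :: "real^'m^'m"
    and \<mu> L \<kappa> \<rho> \<sigma> phi_star \<beta> \<eta>x \<eta>y \<eta>\<Lambda> C\<^sub>0 E\<^sub>T :: real
    and M :: "'w measure"
    and \<xi> :: "nat \<Rightarrow> 'm \<Rightarrow> nat \<Rightarrow> 'w \<Rightarrow> 's"
    and S :: "nat \<Rightarrow> nat"
    and x0 :: "real^'p"
    and y0 :: "real^'q"
    and X V :: "nat \<Rightarrow> 'w \<Rightarrow> real^'p^'m"
    and \<Lambda> Y :: "nat \<Rightarrow> 'w \<Rightarrow> real^'q^'m"
    and D :: "nat \<Rightarrow> 'w \<Rightarrow> ((real^'p) \<times> (real^'q))^'m"
    and T :: nat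
    and \<tau> :: "'w \<Rightarrow> nat"
  assumes prob_D: "\<And>i. prob_space (\<D> i)"
    and f_expect: "\<And>i x y. has_bochner_integral (\<D> i) (ft i x y) (f i x y)"
    and g_cc: "closed_convex_fun g"
    and h_cc: "closed_convex_fun h"
    and mu_pos: "\<mu> > 0"
    and f_sc: "\<And>i x. strongly_concave \<mu> (f i x)"
    and phi_lb: "\<And>x U. ereal phi_star \<le> phi_fun f g h W L x U"
    and ri_dom_h: "rel_interior (eff_dom h) \<noteq> {}"
    and W_null: "{v. (W - mat 1) *v v = 0} = span {(1 :: real^'m)}"
    and W_ones: "transpose W *v (1 :: real^'m) = 1"
    and rho_def: "\<rho> = onorm (\<lambda>v. (W - (\<chi> i j. 1 / real CARD('m))) *v v)"
    and rho_less: "\<rho> < 1"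
    and W_norm: "onorm (\<lambda>v. (W - mat 1) *v v) \<le> 2"
    and f_smooth: "\<And>i. smooth_fun L (\<lambda>(x, y). f i x y)"
    and G_measurable:
      "\<And>i. (\<lambda>((x, y), s). G i x y s) \<in> borel_measurable (borel \<Otimes>\<^sub>M \<D> i)"
    and G_unbiased:
      "\<And>i x y. has_bochner_integral (\<D> i) (G i x y) (grad (\<lambda>(x, y). f i x y) (x, y))"
    and G_variance:
      "\<And>i x y. (\<integral>\<^sup>+s. ennreal ((norm (G i x y s - grad (\<lambda>(x, y). f i x y) (x, y)))\<^sup>2) \<partial>\<D> i)
         \<le> ennreal (\<sigma>\<^sup>2)"
    and G_ms_lipschitz:
      "\<And>i x y x' y'. (\<integral>\<^sup>+s. ennreal ((norm (G i x y s - G i x' y' s))\<^sup>2) \<partial>\<D> i)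
         \<le> ennreal (L\<^sup>2 * ((norm (x - x'))\<^sup>2 + (norm (y - y'))\<^sup>2))"
    and kappa_def: "\<kappa> = L / \<mu>"
    and prob_M: "prob_space M"
    and S_pos: "\<And>t. S t \<ge> 1"
    and sample_distr:
      "\<And>t i k. k < S t \<Longrightarrow> \<xi> t i k \<in> measurable M (\<D> i) \<and> distr M (\<D> i) (\<xi> t i k) = \<D> i"
    and sample_indep:
      "\<And>t i. prob_space.indep_vars M (\<lambda>_. \<D> i) (\<xi> t i) {..<S t}"
    and sample_indep_past:
      "\<And>t i. prob_space.indep_var M
         (sample_space \<D> {(s, j, k). s = t \<and> j = i \<and> k < S s})
           (samples \<xi> {(s, j, k). s = t \<and> j = i \<and> k < S s})
         (sample_space \<D> {(s, j, k). s < t \<and> k < S s})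
           (samples \<xi> {(s, j, k). s < t \<and> k < S s})"
    and T_ge: "T \<ge> 1"
    and tau_distr: "distr M (count_space UNIV) \<tau> = measure_pmf (pmf_of_set {0..<T})"
    and tau_indep:
      "prob_space.indep_set M
         (sets (vimage_algebra (space M) \<tau> (count_space UNIV)))
         (sets (vimage_algebra (space M) (samples \<xi> {(s, j, k). k < S s})
            (sample_space \<D> {(s, j, k). k < S s})))"
    and x0_dom: "x0 \<in> eff_dom g"
    and y0_dom: "y0 \<in> eff_dom h"
    and beta: "\<beta> \<in> {0<..<1}"
    and eta_y: "\<eta>y = sqrt \<beta> / (4 * sqrt 2 * L)"
    and eta_x: "\<eta>x = min
        (\<kappa> * (1 - \<rho>)\<^sup>2 / (40 * L * (24 * \<kappa>\<^sup>2 + 8 * \<kappa> + 5)))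
        (sqrt \<beta> / (48 * (L + 1) * (24 * \<kappa>\<^sup>2 + 7 * \<kappa> + 4)))"
    and eta_Lambda: "\<eta>\<Lambda> = min
        ((1 - \<rho>)\<^sup>2 / (4 * L * (20 * \<kappa> + 3)))
        (sqrt \<beta> / (4 * (L + 1) * (52 * \<kappa>\<^sup>2 + \<kappa> + 1)))"
    and run: "\<And>\<omega>. \<omega> \<in> space M \<Longrightarrow>
        vrlm_storm G g h W L \<beta> \<eta>x \<eta>y \<eta>\<Lambda> S x0 y0 (\<lambda>t i k. \<xi> t i k \<omega>)
          (\<lambda>t. X t \<omega>) (\<lambda>t. \<Lambda> t \<omega>) (\<lambda>t. Y t \<omega>) (\<lambda>t. D t \<omega>) (\<lambda>t. V t \<omega>)"
    and C0_def: "C\<^sub>0 =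
        real_of_ereal (phi_fun f g h W L (row_avg (const_rows x0 :: real^'p^'m)) 0) - phi_star
        + 1 / (40 * real CARD('m) * (1 - \<rho>) * \<kappa> * L)
          * (\<integral>\<omega>. (norm (perp (V 0 \<omega>)))\<^sup>2 \<partial>M)
        + ((1 + 1 / L) / (2 * sqrt \<beta> * real CARD('m) * L)
            + 1 / (4 * real CARD('m) * \<kappa> * L * (1 - \<rho>)\<^sup>2))
          * (\<integral>\<omega>. (norm (D 0 \<omega> - grad_F f (X 0 \<omega>) (Y 0 \<omega>)))\<^sup>2 \<partial>M)
        + ((L + 1) / (5 * real CARD('m) * \<kappa>)
            + sqrt \<beta> * L / (10 * real CARD('m) * \<kappa>\<^sup>2 * (1 - \<rho>)\<^sup>2))
          * (norm (Y_argmax f h W L (const_rows x0) 0 - const_rows y0))\<^sup>2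
        + sqrt \<beta> / sqrt 2 * (1 / ((1 - \<rho>)\<^sup>2 * \<kappa>) + (1 + 1 / L) / sqrt \<beta>)
          * real_of_ereal (Q_fun f h W L (const_rows x0) 0
              - Phi_fun f h W L (const_rows x0) 0 (const_rows y0))"
    and ET_def: "E\<^sub>T =
        C\<^sub>0 / real T
        + (1 / ((1 - \<rho>)\<^sup>2 * \<kappa> * L) + (1 + 1 / L) / (sqrt \<beta> * L)) * \<beta>\<^sup>2
          * (\<Sum>t<T. (\<sigma>\<^sup>2 / real (S (t + 1))) / real T)"
  shows
    "(\<integral>\<^sup>+\<omega>. ennreal ((norm ((1 / \<eta>x) *\<^sub>R
          (row_avg (X (\<tau> \<omega>) \<omega>)
           - prox (\<lambda>v. ereal \<eta>x * g v)
               (row_avg (X (\<tau> \<omega>) \<omega>)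
                - \<eta>x *\<^sub>R grad_x_P f h W L (row_avg (X (\<tau> \<omega>) \<omega>)) (\<Lambda> (\<tau> \<omega>) \<omega>)))))\<^sup>2) \<partial>M)
     + ennreal (L\<^sup>2 / real CARD('m))
       * (\<integral>\<^sup>+\<omega>. ennreal ((norm (perp (X (\<tau> \<omega>) \<omega>)))\<^sup>2) \<partial>M)
     \<le> ennreal (E\<^sub>T *
         (20 / \<eta>x + 6 * \<eta>x * (2 * L\<^sup>2 * (3 + 5 * \<kappa>\<^sup>2) + 5 / \<eta>x\<^sup>2)
          + 1600 * \<kappa>\<^sup>2 * L / sqrt \<beta> + 80 * L / sqrt \<beta> + 5 * (1 - \<rho>)\<^sup>2 / \<eta>x))
     \<and>
     (\<integral>\<^sup>+\<omega>. ennreal ((norm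
          (grad_\<Lambda>_P f h W L (row_avg (X (\<tau> \<omega>) \<omega>)) (\<Lambda> (\<tau> \<omega>) \<omega>)))\<^sup>2) \<partial>M)
     \<le> ennreal (E\<^sub>T *
         (4 / \<eta>\<Lambda> + 24 * \<kappa>\<^sup>2 * L\<^sup>2 * \<eta>x + 640 * \<kappa>\<^sup>2 * L / sqrt \<beta>))"
proof -
  interpret mm: minimax W \<rho> f h \<mu> L y0
    by unfold_locales (use W_null W_ones rho_def rho_less W_norm h_cc mu_pos f_sc f_smooth y0_dom in auto)
  have kap: "mm.\<kappa> = \<kappa>" by (simp add: mm.\<kappa>_def kappa_def)
  interpret vr: vrlm W \<rho> f h \<mu> L y0 g phi_star \<beta> \<eta>x \<eta>y \<eta>\<Lambda> x0
  proof unfold_locales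
    show "\<eta>x = min (mm.\<kappa> * (1 - \<rho>)\<^sup>2 / (40 * L * (24 * mm.\<kappa>\<^sup>2 + 8 * mm.\<kappa> + 5)))
        (sqrt \<beta> / (48 * (L + 1) * (24 * mm.\<kappa>\<^sup>2 + 7 * mm.\<kappa> + 4)))"
      unfolding kap by (rule eta_x)
    show "\<eta>\<Lambda> = min ((1 - \<rho>)\<^sup>2 / (4 * L * (20 * mm.\<kappa> + 3)))
        (sqrt \<beta> / (4 * (L + 1) * (52 * mm.\<kappa>\<^sup>2 + mm.\<kappa> + 1)))"
      unfolding kap by (rule eta_Lambda)
  qed (use g_cc phi_lb x0_dom beta eta_y in auto)
  interpret prob_space M by (rule prob_M)
  interpret R: vrlm_random W \<rho> f h \<mu> L y0 g phi_star \<beta> \<eta>x \<eta>y \<eta>\<Lambda> x0 M \<D> G \<sigma> \<xi> S X V \<Lambda> Y D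
    by (rule vrlm_random.intro[OF vr.vrlm_axioms prob_M vrlm_random_axioms.intro[OF prob_D G_measurable
      G_unbiased G_variance G_ms_lipschitz S_pos sample_distr sample_indep sample_indep_past run]])
  let ?m = "real CARD('m)"
  define Q where "Q = (\<Sum>t<T. \<sigma>\<^sup>2 / real (S (Suc t)))"
  define dl where "dl = mm.H (const_rows x0) 0 (mm.Ystar (const_rows x0) 0) - mm.H (const_rows x0) 0 (const_rows y0)"
  define y where "y = (norm (mm.Ystar (const_rows x0) 0 - const_rows y0))\<^sup>2"
  have yd: "const_rows y0 \<in> mm.domY" using y0_dom by (simp add: mm.domY_def)
  have Q0: "0 \<le> Q" by (simp add: Q_def sum_nonneg)
  have dl0: "0 \<le> dl" using mm.Ystar_max'[OF yd] by (simp add: dl_def)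
  have delta: "real_of_ereal (Q_fun f h W L (const_rows x0) 0 - Phi_fun f h W L (const_rows x0) 0 (const_rows y0)) = dl / ?m"
    by (simp add: mm.Q_eq mm.Phi_dom[OF yd] dl_def diff_divide_distrib)
  have phi: "real_of_ereal (phi_fun f g h W L (row_avg (const_rows x0 :: real^'p^'m)) 0) = mm.PP x0 0 + vr.gr x0"
    by (simp add: vr.phi_eq[OF x0_dom])
  have V: "(\<integral>\<omega>. (norm (perp (V 0 \<omega>)))\<^sup>2 \<partial>M) = (\<integral>\<omega>. R.v0 \<omega> \<partial>M)" by (simp add: R.v0_def)
  have Rs: "(\<integral>\<omega>. (norm (D 0 \<omega> - grad_F f (X 0 \<omega>) (Y 0 \<omega>)))\<^sup>2 \<partial>M) = (\<integral>\<omega>. R.rs 0 \<omega> \<partial>M)" by (simp add: R.rs_def)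
  have TE: "real T * E\<^sub>T = C\<^sub>0 + (1 / ((1 - \<rho>)\<^sup>2 * \<kappa> * L) + (1 + 1 / L) / (sqrt \<beta> * L)) * \<beta>\<^sup>2 * Q"
  proof -
    have q: "(\<Sum>t<T. (\<sigma>\<^sup>2 / real (S (t + 1))) / real T) = Q / real T"
      by (simp only: Q_def sum_divide_distrib Suc_eq_plus1)
    show ?thesis unfolding ET_def q using T_ge by (simp add: distrib_left)
  qed
  have "R.psiC + vr.wv * (\<integral>\<omega>. R.v0 \<omega> \<partial>M) + vr.cU / (2 * L) * (\<integral>\<omega>. R.rs 0 \<omega> \<partial>M)
     + (vr.cU + 3 * vr.cB / 40) / L * \<beta>\<^sup>2 * (?m * Q) \<le> ?m * (real T * E\<^sub>T)"
    using R.initial_budget[OF _ dl0 Q0, of y "\<integral>\<omega>. R.v0 \<omega> \<partial>M" "\<integral>\<omega>. R.rs 0 \<omega> \<partial>M"]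
    unfolding TE C0_def delta phi V Rs mm.Y_argmax_eq y_def[symmetric] R.psiC_def dl_def[symmetric] kap
    by (simp add: y_def distrib_left right_diff_distrib)
  then have bd: "(\<Sum>t<T. \<integral>\<omega>. R.gn t \<omega> \<partial>M) \<le> ?m * (real T * E\<^sub>T)"
    using R.expected_gain_bound[of T] unfolding Q_def by linarith
  note fin = R.random_iterate_bound[OF T_ge tau_distr tau_indep bd]
  have gm: "(norm ((1 / \<eta>x) *\<^sub>R (row_avg (X (\<tau> \<omega>) \<omega>)
           - prox (\<lambda>v. ereal \<eta>x * g v) (row_avg (X (\<tau> \<omega>) \<omega>)
                - \<eta>x *\<^sub>R grad_x_P f h W L (row_avg (X (\<tau> \<omega>) \<omega>)) (\<Lambda> (\<tau> \<omega>) \<omega>)))))\<^sup>2 = R.gm (\<tau> \<omega>) \<omega>" for \<omega>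
    by (simp add: R.gm_def mm.grad_x_P_eq)
  have ps: "(norm (grad_\<Lambda>_P f h W L (row_avg (X (\<tau> \<omega>) \<omega>)) (\<Lambda> (\<tau> \<omega>) \<omega>)))\<^sup>2 = R.ps (\<tau> \<omega>) \<omega>" for \<omega>
    by (simp add: R.ps_def mm.grad_\<Lambda>_P_eq)
  have xs: "(norm (perp (X (\<tau> \<omega>) \<omega>)))\<^sup>2 = R.xs (\<tau> \<omega>) \<omega>" for \<omega>
    by (simp add: R.xs_def)
  have sb: "0 < sqrt \<beta>" using beta by simp
  note pos = vr.eta_pos mm.L_pos sb
  have nn: "0 \<le> 12 * \<eta>x * L\<^sup>2 * (3 + 5 * \<kappa>\<^sup>2)" "0 \<le> 1600 * \<kappa>\<^sup>2 * L / sqrt \<beta>" "0 \<le> 80 * L / sqrt \<beta>"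
    "0 \<le> 5 * (1 - \<rho>)\<^sup>2 / \<eta>x" "0 \<le> 24 * \<kappa>\<^sup>2 * L\<^sup>2 * \<eta>x" "0 \<le> 640 * \<kappa>\<^sup>2 * L / sqrt \<beta>" "0 \<le> 2 / \<eta>\<Lambda>"
    using pos by simp_all
  \<comment> \<open>The \<open>30 / \<eta>x\<close> hidden in this summand completes
    \<open>20 / \<eta>x\<close> to the \<open>50 / \<eta>x\<close> produced by the gain; the other
    summands are nonnegative.\<close>
  have "6 * \<eta>x * (2 * L\<^sup>2 * (3 + 5 * \<kappa>\<^sup>2) + 5 / \<eta>x\<^sup>2) = 12 * \<eta>x * L\<^sup>2 * (3 + 5 * \<kappa>\<^sup>2) + 30 / \<eta>x"
    using pos(1) by (simp add: distrib_left power2_eq_square)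
  then have "50 / \<eta>x \<le> 20 / \<eta>x + 6 * \<eta>x * (2 * L\<^sup>2 * (3 + 5 * \<kappa>\<^sup>2) + 5 / \<eta>x\<^sup>2)
          + 1600 * \<kappa>\<^sup>2 * L / sqrt \<beta> + 80 * L / sqrt \<beta> + 5 * (1 - \<rho>)\<^sup>2 / \<eta>x"
    using nn by simp
  then have b1: "E\<^sub>T * (50 / \<eta>x) \<le> E\<^sub>T * (20 / \<eta>x + 6 * \<eta>x * (2 * L\<^sup>2 * (3 + 5 * \<kappa>\<^sup>2) + 5 / \<eta>x\<^sup>2)
          + 1600 * \<kappa>\<^sup>2 * L / sqrt \<beta> + 80 * L / sqrt \<beta> + 5 * (1 - \<rho>)\<^sup>2 / \<eta>x)"
    by (rule mult_left_mono) (rule fin(3))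
  have "2 / \<eta>\<Lambda> \<le> 4 / \<eta>\<Lambda> + 24 * \<kappa>\<^sup>2 * L\<^sup>2 * \<eta>x + 640 * \<kappa>\<^sup>2 * L / sqrt \<beta>"
    using nn(5-7) add_divide_distrib[of 2 2 \<eta>\<Lambda>] by linarith
  then have b2: "E\<^sub>T * (2 / \<eta>\<Lambda>) \<le> E\<^sub>T * (4 / \<eta>\<Lambda> + 24 * \<kappa>\<^sup>2 * L\<^sup>2 * \<eta>x + 640 * \<kappa>\<^sup>2 * L / sqrt \<beta>)"
    by (rule mult_left_mono) (rule fin(3))
  show ?thesis
    unfolding gm ps xs
    using order_trans[OF fin(1) ennreal_leI[OF b1]] order_trans[OF fin(2) ennreal_leI[OF b2]] by (rule conjI)
qed

end
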